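(* Let $\rho\in(0,1)$ and, for each $n\ge2$, let $(X_k)_{-p+1\le k\le n}$ be an INAR($p$) process with a change only in the innovation mean after time $\tau=\max(\lfloor n\rho\rfloor,1)$: the innovation mean changes from $\mu'$ to $\mu''$, where $\mu'>\mu''>0$, while the coefficients $\alpha_1,\dots,\alpha_p$ stay constant. Suppose that $\operatorname E(X_0^6)<\infty,\dots,\operatorname E(X_{-p+1}^6)<\infty$, $\operatorname E(\varepsilon_1^6)<\infty$, $\operatorname E(\varepsilon_{\tau+1}^6)<\infty$, $\alpha_1+\cdots+\alpha_p<1$, and that $\alpha_1+\cdots+\alpha_p>0$ or the innovation variance is positive both before and after the change. Let $$\widehat\tau_n:=\min\Big\{k\in\{1,\dots,n\}:\sum_{j=1}^k\widehat M_j^{(n)}=\max_{1\le m\le n}\sum_{j=1}^m\widehat M_j^{(n)}\Big\}.$$ Then $$\widehat\tau_n-\lfloor n\rho\rfloor=\mathrm O_{\operatorname P}(1)\qquad\text{as }n\to\infty.$$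
   Context: For each $n$ the process satisfies $$X_k=\sum_{i=1}^p\sum_{j=1}^{X_{k-i}}\xi_{i,k,j}+\varepsilon_k,\qquad 1\le k\le n,$$ where for each $k$ and $i$ the variables $\{\xi_{i,k,j}:j\in\mathbb N\}$ are i.i.d. Bernoulli with mean $\alpha_i$; the innovations $\varepsilon_k$ are independent non-negative integer-valued with finite variance, $\varepsilon_1,\dots,\varepsilon_\tau$ being identically distributed with mean $\mu'$ and $\varepsilon_{\tau+1},\dots,\varepsilon_n$ identically distributed with mean $\mu''$; all the sequences $\{\xi_{i,k,j}\}_j$ are mutually independent and independent of the innovations; $X_0,\dots,X_{-p+1}$ are non-negative integer-valued and independent of all $\xi_{i,k,j},\varepsilon_k$. The distribution of $(X_0,\dots,X_{-p+1})$, the coefficients, and the two innovation laws do not depend on $n$; only the change point $\tau=\tau(n)$ does (the dependence of the process on $n$ is suppressed in notation). Put $\boldsymbol X_k:=(X_k,\dots,X_{k-p+1})^\top$ and $$\boldsymbol Q_n:=\sum_{k=1}^n\begin{bmatrix}\boldsymbol X_{k-1}\\1\end{bmatrix}\begin{bmatrix}\boldsymbol X_{k-1}\\1\end{bmatrix}^\top,\quad \widehat{\boldsymbol\theta}_n:=\boldsymbol Q_n^{-1}\sum_{k=1}^nX_k\begin{bmatrix}\boldsymbol X_{k-1}\\1\end{bmatrix},\quad \widehat M_k^{(n)}:=X_k-\widehat{\boldsymbol\theta}_n^\top\begin{bmatrix}\boldsymbol X_{k-1}\\1\end{bmatrix}.$$ ($\boldsymbol Q_n$ is invertible with probability tending to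 $1$; on the complement $\widehat{\boldsymbol\theta}_n$ may be defined arbitrarily.) *)

theory Defs
  imports "HOL-Probability.Probability" "Jordan_Normal_Form.Matrix"
begin

no_notation inner (infix "\<bullet>" 70)
no_notation Finite_Cartesian_Product.vec_nth (infixl "$" 90)

text \<open>
  \<open>Innovation k\<close> stands for $\varepsilon_k$ and \<open>Thinning i k j\<close> for $\xi_{i,k,j}$.
\<close>

datatype noise_index = Innovation nat | Thinning nat nat nat

definition noise_indices :: "nat \<Rightarrow> nat \<Rightarrow> noise_index set" where
  "noise_indices p n =
     {Innovation k |k. k \<in> {1..n}} \<union>
     {Thinning i k j |i k j. i \<in> {1..p} \<and> k \<in> {1..n} \<and> j \<ge> 1}"

primrec noise ::
  "(nat \<Rightarrow> nat \<Rightarrow> nat \<Rightarrow> 'a \<Rightarrow> nat) \<Rightarrow> (nat \<Rightarrow> 'a \<Rightarrow> nat) \<Rightarrow> noise_index \<Rightarrow> 'a \<Rightarrow> nat" where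
  "noise \<xi> \<epsilon> (Innovation k) = \<epsilon> k"
| "noise \<xi> \<epsilon> (Thinning i k j) = \<xi> i k j"

text \<open>
  An INAR(p) process on the time horizon \<open>1, \<dots>, n\<close> whose innovation law changes from \<open>\<nu>1\<close> to
  \<open>\<nu>2\<close> after time \<open>\<tau>\<close> (the two laws may differ in more than their means), with constant
  coefficients \<open>\<alpha> 1, \<dots>, \<alpha> p\<close>. Time is an integer in \<open>X\<close>, since
  the initial values live at times \<open>-p+1, \<dots>, 0\<close>; these have joint law \<open>\<pi>\<close> and need not be
  independent of each other. Independence of the initial vector from the noise family is stated for
  the generated \<open>\<sigma>\<close>-algebras, because \<open>indep_var\<close> requires both variables to take values in the
  same type.
\<close>

locale INAR_innovation_change = prob_space M for M :: "'a measure" +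
  fixes p :: nat and \<alpha> :: "nat \<Rightarrow> real" and \<nu>1 \<nu>2 :: "nat pmf"
    and \<pi> :: "(int \<Rightarrow> nat) measure" and \<tau> n :: nat
    and X :: "int \<Rightarrow> 'a \<Rightarrow> nat"
    and \<xi> :: "nat \<Rightarrow> nat \<Rightarrow> nat \<Rightarrow> 'a \<Rightarrow> nat"
    and \<epsilon> :: "nat \<Rightarrow> 'a \<Rightarrow> nat"
  assumes p_pos: "p \<ge> 1"
    and coeff: "\<And>i. i \<in> {1..p} \<Longrightarrow> \<alpha> i \<in> {0..1}"
    and recursion: "\<And>k \<omega>. k \<in> {1..n} \<Longrightarrow> \<omega> \<in> space M \<Longrightarrow>
      X (int k) \<omega> = (\<Sum>i = 1..p. \<Sum>j = 1..X (int k - int i) \<omega>. \<xi> i k j \<omega>) + \<epsilon> k \<omega>"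
    and thinning_law: "\<And>i k j. i \<in> {1..p} \<Longrightarrow> k \<in> {1..n} \<Longrightarrow> j \<ge> 1 \<Longrightarrow>
      distr M (count_space UNIV) (\<xi> i k j) = measure_pmf (map_pmf of_bool (bernoulli_pmf (\<alpha> i)))"
    and innovation_law_before: "\<And>k. k \<in> {1..min \<tau> n} \<Longrightarrow>
      distr M (count_space UNIV) (\<epsilon> k) = measure_pmf \<nu>1"
    and innovation_law_after: "\<And>k. k \<in> {\<tau><..n} \<Longrightarrow>
      distr M (count_space UNIV) (\<epsilon> k) = measure_pmf \<nu>2"
    and innovation_square_integrable:
      "integrable (measure_pmf \<nu>1) (\<lambda>x. (real x)^2)" "integrable (measure_pmf \<nu>2) (\<lambda>x. (real x)^2)"
    and initial_law:
      "distr M (\<Pi>\<^sub>M k\<in>{1 - int p..0}. count_space UNIV) (\<lambda>\<omega>. \<lambda>k\<in>{1 - int p..0}. X k \<omega>) = \<pi>"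
    and noise_indep:
      "indep_vars (\<lambda>_. count_space UNIV) (noise \<xi> \<epsilon>) (noise_indices p n)"
    and initial_measurable: "\<And>k. k \<in> {1 - int p..0} \<Longrightarrow> X k \<in> measurable M (count_space UNIV)"
    and initial_indep_noise:
      "indep_set
         (sets (vimage_algebra (space M)
            (\<lambda>\<omega>. \<lambda>k\<in>{1 - int p..0}. X k \<omega>)
            (\<Pi>\<^sub>M k\<in>{1 - int p..0}. count_space UNIV)))
         (sets (vimage_algebra (space M)
            (\<lambda>\<omega>. \<lambda>s\<in>noise_indices p n. noise \<xi> \<epsilon> s \<omega>)
            (\<Pi>\<^sub>M s\<in>noise_indices p n. count_space UNIV)))"

text \<open>
  Least squares along a path \<open>x\<close>. The vector \<open>regressor p x k\<close> is
  $(x_{k-1}, \dots, x_{k-p}, 1)^\top$; \<open>design_matrix\<close> is $\boldsymbol Q_n$ written entrywise.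
\<close>

definition state_vec :: "nat \<Rightarrow> (int \<Rightarrow> nat) \<Rightarrow> int \<Rightarrow> real Matrix.vec" where
  "state_vec p x k = Matrix.vec p (\<lambda>i. real (x (k - int i)))"

definition regressor :: "nat \<Rightarrow> (int \<Rightarrow> nat) \<Rightarrow> nat \<Rightarrow> real Matrix.vec" where
  "regressor p x k = state_vec p x (int k - 1) @\<^sub>v Matrix.vec 1 (\<lambda>_. 1)"

definition design_matrix :: "nat \<Rightarrow> nat \<Rightarrow> (int \<Rightarrow> nat) \<Rightarrow> real Matrix.mat" where
  "design_matrix p n x = Matrix.mat (p + 1) (p + 1)
     (\<lambda>(a, b). \<Sum>k = 1..n. regressor p x k $ a * regressor p x k $ b)"

definition response_vec :: "nat \<Rightarrow> nat \<Rightarrow> (int \<Rightarrow> nat) \<Rightarrow> real Matrix.vec" where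
  "response_vec p n x = Matrix.vec (p + 1)
     (\<lambda>a. \<Sum>k = 1..n. real (x (int k)) * regressor p x k $ a)"

text \<open>
  A random vector \<open>\<theta>\<close> is a conditional least squares estimator if it is $\boldsymbol Q_n^{-1}$ times
  the response vector wherever $\boldsymbol Q_n$ is invertible; elsewhere it is arbitrary, subject
  only to measurability.
\<close>

definition cls_estimator ::
  "'a measure \<Rightarrow> nat \<Rightarrow> nat \<Rightarrow> (int \<Rightarrow> 'a \<Rightarrow> nat) \<Rightarrow> ('a \<Rightarrow> real Matrix.vec) \<Rightarrow> bool" where
  "cls_estimator M p n X \<theta> \<longleftrightarrow>
     (\<forall>\<omega>\<in>space M. \<theta> \<omega> \<in> carrier_vec (p + 1)) \<and>
     (\<forall>a<p + 1. (\<lambda>\<omega>. \<theta> \<omega> $ a) \<in> borel_measurable M) \<and>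
     (\<forall>\<omega>\<in>space M. \<forall>B\<in>carrier_mat (p + 1) (p + 1).
        inverts_mat (design_matrix p n (\<lambda>k. X k \<omega>)) B \<and>
        inverts_mat B (design_matrix p n (\<lambda>k. X k \<omega>)) \<longrightarrow>
        \<theta> \<omega> = B *\<^sub>v response_vec p n (\<lambda>k. X k \<omega>))"

definition residual :: "nat \<Rightarrow> real Matrix.vec \<Rightarrow> (int \<Rightarrow> nat) \<Rightarrow> nat \<Rightarrow> real" where
  "residual p th x k = real (x (int k)) - th \<bullet> regressor p x k"

definition change_estimator :: "nat \<Rightarrow> nat \<Rightarrow> real Matrix.vec \<Rightarrow> (int \<Rightarrow> nat) \<Rightarrow> nat" where
  "change_estimator p n th x =
     Min {k \<in> {1..n}. (\<Sum>j = 1..k. residual p th x j) =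
                      Max ((\<lambda>m. \<Sum>j = 1..m. residual p th x j) ` {1..n})}"

text \<open>
  $Z_n = \mathrm O_{\mathrm P}(1)$, where each \<open>Z n\<close> lives on its own probability space \<open>M n\<close>.
  Measurability is part of the notion because \<open>measure\<close> is zero on non-measurable sets.
\<close>

definition bounded_in_probability :: "(nat \<Rightarrow> 'a measure) \<Rightarrow> (nat \<Rightarrow> 'a \<Rightarrow> real) \<Rightarrow> bool" where
  "bounded_in_probability M Z \<longleftrightarrow>
     (\<forall>\<^sub>F n in sequentially. Z n \<in> borel_measurable (M n)) \<and>
     (\<forall>\<eta>>0. \<exists>K. \<forall>\<^sub>F n in sequentially.
        measure (M n) {\<omega> \<in> space (M n). \<bar>Z n \<omega>\<bar> > K} < \<eta>)"

end

theory Submission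
  imports Defs "HOL-Library.Discrete_Functions" "HOL-Real_Asymp.Real_Asymp"
    "Jordan_Normal_Form.Determinant"
begin

text \<open>
  Put \<open>M\<^sub>t = X\<^sub>t - \<Sum>\<^sub>i \<alpha>\<^sub>i X\<^sub>t\<^sub>-\<^sub>i - \<mu>\<^sub>t\<close>, the centred noise of step \<open>t\<close>; it is a martingale difference. Let
  \<open>y\<^sub>t = (X\<^sub>t\<^sub>-\<^sub>1, \<dots>, X\<^sub>t\<^sub>-\<^sub>p, 1)\<close>, let \<open>\<Delta> = \<mu>' - \<mu>''\<close>, and let \<open>u\<close> be the difference between
  \<open>(\<alpha>\<^sub>1, \<dots>, \<alpha>\<^sub>p, \<mu>')\<close> and the least squares estimate. The residual is \<open>M\<^sub>t + u \<bullet> y\<^sub>t\<close> before the change and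
  \<open>M\<^sub>t + u \<bullet> y\<^sub>t - \<Delta>\<close> after it. If \<open>m'\<close>, \<open>m''\<close> are the stationary means of \<open>y\<^sub>t\<close> in the two
  regimes, the partial sums of the residuals have slope about \<open>u \<bullet> m'\<close> before and
  \<open>u \<bullet> m'' - \<Delta>\<close> after the change. Once the first slope is bounded away from zero from below and the second from above,
  the sums peak within a bounded distance of the change point, because averages over
  windows that start or end there are close to their means as soon as the window is long,
  uniformly over all longer windows.

  The signs of the slopes follow from the normal equations. Let \<open>a = u \<bullet> m'\<close> and
  \<open>b = u \<bullet> m''\<close>. The equation that belongs to the constant regressor says
  \<open>\<rho> a + (1 - \<rho>) b \<approx> (1 - \<rho>) \<Delta>\<close>. Contracting all equations with \<open>u\<close> gives
  \<open>\<rho> a\<^sup>2 + (1 - \<rho>) b\<^sup>2 + v \<lesssim> (1 - \<rho>) \<Delta> b\<close>, where \<open>v\<close> is the spread of \<open>u \<bullet> y\<^sub>t\<close> around its mean.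
  Together they yield \<open>\<rho> a (a - b) + v \<lesssim> 0\<close>. The spread \<open>v\<close> dominates a multiple of \<open>(a - b)\<^sup>2\<close>,
  and if \<open>a\<close> were small or negative, then \<open>a - b\<close> would be close to \<open>-\<Delta>\<close> or below it, which is
  impossible; then \<open>(1 - \<rho>) (\<Delta> - b) \<approx> \<rho> a\<close> is positive as well
  (\<open>normal_equations_drift\<close>).

  The lower bound on the spread comes from a dual family. Take
  bounded martingale differences \<open>T\<^sub>t\<close> that are correlated with \<open>M\<^sub>t\<close>, and filter them by the
  autoregression: \<open>U\<^sup>j\<^sub>t = T\<^sub>t\<^sub>-\<^sub>j - \<Sum>\<^sub>l \<alpha>\<^sub>l T\<^sub>t\<^sub>-\<^sub>j\<^sub>+\<^sub>l\<close>. Summation by parts moves the filter onto \<open>X\<close>, where it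
  leaves \<open>M + \<mu>'\<close>. So the average of \<open>X\<^sub>t\<^sub>-\<^sub>i U\<^sup>j\<^sub>t\<close> is close to that of
  \<open>T\<^sub>t M\<^sub>t\<^sub>+\<^sub>j\<^sub>-\<^sub>i\<close>: positive for \<open>i = j\<close>, negligible otherwise. By Cauchy-Schwarz the spread of
  \<open>u \<bullet> y\<^sub>t\<close> bounds every \<open>u\<^sub>j\<close> with \<open>j \<le> p\<close> (\<open>dual_sum\<close>, \<open>dispersion_A\<close>). The
  nondegeneracy assumption is what provides \<open>T\<close>: a centred indicator of a random innovation, or of one thinning
  variable with \<open>0 < \<alpha>\<^sub>i < 1\<close> (\<open>innovation_test\<close>, \<open>thinning_test\<close>).

  All probabilistic estimates rest on second moments, which are bounded uniformly in time by
  \<open>second_moment\<close>, on the orthogonality of martingale differences, and on Chebyshev's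
  inequality. Uniformity over windows comes from the subsequence of squares
  (\<open>uniform_weak_law\<close>). A path is called good if all these averages are within tolerance;
  \<open>change_estimator_close\<close> treats good paths and \<open>good_path_likely\<close> bounds the probability of
  the others.
\<close>

section \<open>Drift of the fitted residuals in a nearly ideal design\<close>

text \<open>
  One path, up to a relative error \<open>\<delta>\<close>: \<open>A\<close> and \<open>B\<close> index the observations before and after the
  change, and \<open>y k a\<close> is the \<open>a\<close>-th regressor of observation \<open>k\<close>. The families \<open>U j\<close> are
  approximately dual to the nonconstant regressors and almost orthogonal to the constant one; pairing
  with them bounds the spread of the regressors from below.
\<close>

locale near_ideal_design =
  fixes p :: nat and A B :: "'k set" and n \<rho> \<delta> \<kappa> K :: real
    and y :: "'k \<Rightarrow> nat \<Rightarrow> real" and m1 m2 :: "nat \<Rightarrow> real" and U :: "nat \<Rightarrow> 'k \<Rightarrow> real"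
  assumes fin: "finite A" "finite B" and disj: "A \<inter> B = {}"
    and n_pos: "n > 0" and rho: "0 < \<rho>" "\<rho> < 1" and delta: "0 \<le> \<delta>" "\<delta> \<le> 1"
    and kappa: "\<kappa> > 0" and K1: "K \<ge> 1" and p_pos: "p \<ge> 1"
    and means: "\<And>a. a \<le> p \<Longrightarrow> \<bar>m1 a\<bar> \<le> K" "\<And>a. a \<le> p \<Longrightarrow> \<bar>m2 a\<bar> \<le> K"
    and const: "m1 p = 1" "m2 p = 1" "\<And>k. y k p = 1"
    and cards: "\<bar>real (card A) - \<rho> * n\<bar> \<le> \<delta> * n" "\<bar>real (card B) - (1 - \<rho>) * n\<bar> \<le> \<delta> * n"
    and lln_A: "\<And>a. a \<le> p \<Longrightarrow> \<bar>\<Sum>k\<in>A. y k a - m1 a\<bar> \<le> \<delta> * n"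
    and lln_B: "\<And>a. a \<le> p \<Longrightarrow> \<bar>\<Sum>k\<in>B. y k a - m2 a\<bar> \<le> \<delta> * n"
    and dual_diag: "\<And>i. i < p \<Longrightarrow> (\<Sum>k\<in>A. y k i * U i k) \<ge> \<kappa> * n"
    and dual_off: "\<And>i j. i < p \<Longrightarrow> j < p \<Longrightarrow> i \<noteq> j \<Longrightarrow> \<bar>\<Sum>k\<in>A. y k i * U j k\<bar> \<le> \<delta> * n"
    and dual_const: "\<And>j. j < p \<Longrightarrow> \<bar>\<Sum>k\<in>A. U j k\<bar> \<le> \<delta> * n"
    and dual_size: "\<And>j. j < p \<Longrightarrow> (\<Sum>k\<in>A. (U j k)\<^sup>2) \<le> 4 * n"
begin

definition lin :: "(nat \<Rightarrow> real) \<Rightarrow> 'k \<Rightarrow> real" where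
  "lin v k = (\<Sum>a\<le>p. v a * y k a)"

definition mean1 :: "(nat \<Rightarrow> real) \<Rightarrow> real" where "mean1 v = (\<Sum>a\<le>p. v a * m1 a)"
definition mean2 :: "(nat \<Rightarrow> real) \<Rightarrow> real" where "mean2 v = (\<Sum>a\<le>p. v a * m2 a)"
definition size1 :: "(nat \<Rightarrow> real) \<Rightarrow> real" where "size1 v = (\<Sum>a\<le>p. \<bar>v a\<bar>)"

lemma size1_nonneg: "size1 v \<ge> 0" by (simp add: size1_def sum_nonneg)

lemma weighted_sum_le:
  assumes "\<And>a. a \<le> p \<Longrightarrow> \<bar>f a\<bar> \<le> C"
  shows "\<bar>\<Sum>a\<le>p. v a * f a\<bar> \<le> C * size1 v"
proof -
  have "\<bar>\<Sum>a\<le>p. v a * f a\<bar> \<le> (\<Sum>a\<le>p. \<bar>v a * f a\<bar>)" by (rule sum_abs)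
  also have "\<dots> \<le> (\<Sum>a\<le>p. C * \<bar>v a\<bar>)"
    using assms by (intro sum_mono) (simp add: abs_mult mult.commute mult_right_mono)
  finally show ?thesis by (simp add: size1_def sum_distrib_left)
qed

lemma mean1_le: "\<bar>mean1 v\<bar> \<le> K * size1 v" unfolding mean1_def by (rule weighted_sum_le) (rule means)
lemma mean2_le: "\<bar>mean2 v\<bar> \<le> K * size1 v" unfolding mean2_def by (rule weighted_sum_le) (rule means)

lemma lin_dev_A: "\<bar>\<Sum>k\<in>A. lin v k - mean1 v\<bar> \<le> \<delta> * n * size1 v"
proof -
  have "(\<Sum>k\<in>A. lin v k - mean1 v) = (\<Sum>k\<in>A. \<Sum>a\<le>p. v a * (y k a - m1 a))"
    by (simp add: lin_def mean1_def sum_subtractf right_diff_distrib)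
  also have "\<dots> = (\<Sum>a\<le>p. v a * (\<Sum>k\<in>A. y k a - m1 a))"
    by (subst sum.swap) (simp add: sum_distrib_left)
  finally show ?thesis using weighted_sum_le[OF lln_A] by simp
qed

lemma lin_dev_B: "\<bar>\<Sum>k\<in>B. lin v k - mean2 v\<bar> \<le> \<delta> * n * size1 v"
proof -
  have "(\<Sum>k\<in>B. lin v k - mean2 v) = (\<Sum>k\<in>B. \<Sum>a\<le>p. v a * (y k a - m2 a))"
    by (simp add: lin_def mean2_def sum_subtractf right_diff_distrib)
  also have "\<dots> = (\<Sum>a\<le>p. v a * (\<Sum>k\<in>B. y k a - m2 a))"
    by (subst sum.swap) (simp add: sum_distrib_left)
  finally show ?thesis using weighted_sum_le[OF lln_B] by simp
qed

text \<open>
  Pairing the centred linear form with \<open>U j\<close> isolates the coefficient \<open>v j\<close> up to an error of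
  order \<open>\<delta>\<close>, and by Cauchy-Schwarz the pairing is controlled by the spread.
\<close>

lemma dispersion_A:
  assumes j: "j < p"
  shows "n * ((v j)\<^sup>2 * \<kappa>\<^sup>2 / 8 - 4 * K\<^sup>2 * \<delta> * (size1 v)\<^sup>2) \<le> (\<Sum>k\<in>A. (lin v k - mean1 v)\<^sup>2)"
proof -
  define S where "S = size1 v"
  define G where "G = (\<lambda>a. \<Sum>k\<in>A. y k a * U j k)"
  define e where "e = (\<Sum>a\<in>{..p}-{j}. v a * G a) - mean1 v * (\<Sum>k\<in>A. U j k)"
  define V where "V = (\<Sum>k\<in>A. (lin v k - mean1 v)\<^sup>2)"
  have S0: "S \<ge> 0" by (simp add: S_def size1_nonneg)
  have eq: "(\<Sum>k\<in>A. (lin v k - mean1 v) * U j k) = v j * G j + e"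
  proof -
    have "(\<Sum>k\<in>A. (lin v k - mean1 v) * U j k) = (\<Sum>k\<in>A. \<Sum>a\<le>p. v a * (y k a * U j k)) - mean1 v * (\<Sum>k\<in>A. U j k)"
    proof -
      have "(lin v k - mean1 v) * U j k = (\<Sum>a\<le>p. v a * (y k a * U j k)) - mean1 v * U j k" for k
        by (simp add: lin_def left_diff_distrib sum_distrib_right mult.assoc)
      then show ?thesis by (simp add: sum_subtractf sum_distrib_left)
    qed
    also have "(\<Sum>k\<in>A. \<Sum>a\<le>p. v a * (y k a * U j k)) = (\<Sum>a\<le>p. v a * G a)"
      by (subst sum.swap) (simp add: G_def sum_distrib_left)
    also have "\<dots> = v j * G j + (\<Sum>a\<in>{..p}-{j}. v a * G a)"
      using j by (subst sum.remove[of _ j]) auto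
    finally show ?thesis by (simp add: e_def)
  qed
  have Ga: "\<bar>G a\<bar> \<le> \<delta> * n" if "a \<le> p" "a \<noteq> j" for a
    using that dual_off[of a j] dual_const[OF j] j const by (cases "a = p") (auto simp: G_def)
  have "\<bar>\<Sum>a\<in>{..p}-{j}. v a * G a\<bar> \<le> (\<Sum>a\<in>{..p}-{j}. \<bar>v a * G a\<bar>)" by (rule sum_abs)
  also have "\<dots> \<le> (\<Sum>a\<in>{..p}-{j}. \<delta> * n * \<bar>v a\<bar>)"
    using Ga by (intro sum_mono) (auto simp: abs_mult mult.commute[of "\<bar>v a\<bar>" for a] intro!: mult_right_mono)
  also have "\<dots> \<le> (\<Sum>a\<le>p. \<delta> * n * \<bar>v a\<bar>)"
    using delta n_pos by (intro sum_mono2) auto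
  finally have e1: "\<bar>\<Sum>a\<in>{..p}-{j}. v a * G a\<bar> \<le> \<delta> * n * S"
    by (simp add: S_def size1_def sum_distrib_left)
  have "\<bar>mean1 v * (\<Sum>k\<in>A. U j k)\<bar> \<le> (K * S) * (\<delta> * n)"
    unfolding abs_mult S_def using mean1_le dual_const[OF j] K1 size1_nonneg by (intro mult_mono) auto
  then have "\<bar>e\<bar> \<le> \<delta> * n * S + (K * S) * (\<delta> * n)" using e1 unfolding e_def by linarith
  also have "\<dots> \<le> 2 * K * \<delta> * n * S"
  proof -
    have "1 * (\<delta> * n * S) \<le> K * (\<delta> * n * S)" using K1 delta n_pos S0 by (intro mult_right_mono) auto
    then show ?thesis by (simp add: algebra_simps)
  qed
  finally have e: "\<bar>e\<bar> \<le> 2 * K * \<delta> * n * S" .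
  then have e2: "e\<^sup>2 \<le> (2 * K * \<delta> * n * S)\<^sup>2" by (metis abs_ge_zero power2_abs power_mono)
  have "(v j * G j)\<^sup>2 \<ge> (v j)\<^sup>2 * (\<kappa> * n)\<^sup>2"
    unfolding power_mult_distrib[of "v j"] using dual_diag[OF j] kappa n_pos
    by (intro mult_left_mono power_mono) (auto simp: G_def)
  moreover have "(v j * G j + e)\<^sup>2 \<ge> (v j * G j)\<^sup>2 / 2 - e\<^sup>2"
    using zero_le_power2[of "v j * G j + 2 * e"] by (simp add: power2_eq_square algebra_simps)
  ultimately have lower: "(v j)\<^sup>2 * (\<kappa> * n)\<^sup>2 / 2 - (2 * K * \<delta> * n * S)\<^sup>2 \<le> (v j * G j + e)\<^sup>2"
    using e2 by linarith
  have "(v j * G j + e)\<^sup>2 \<le> V * (\<Sum>k\<in>A. (U j k)\<^sup>2)"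
    unfolding eq[symmetric] V_def by (rule Cauchy_Schwarz_ineq_sum)
  also have "\<dots> \<le> V * (4 * n)"
    using dual_size[OF j] by (intro mult_left_mono) (auto simp: V_def sum_nonneg)
  finally have "(v j)\<^sup>2 * (\<kappa> * n)\<^sup>2 / 2 - (2 * K * \<delta> * n * S)\<^sup>2 \<le> V * (4 * n)" using lower by linarith
  then have "(4 * n) * (n * ((v j)\<^sup>2 * \<kappa>\<^sup>2 / 8 - K\<^sup>2 * \<delta>\<^sup>2 * S\<^sup>2)) \<le> (4 * n) * V"
    by (simp add: power2_eq_square algebra_simps)
  then have "n * ((v j)\<^sup>2 * \<kappa>\<^sup>2 / 8 - K\<^sup>2 * \<delta>\<^sup>2 * S\<^sup>2) \<le> V"
    using n_pos by simp
  moreover have "K\<^sup>2 * \<delta>\<^sup>2 * S\<^sup>2 \<le> 4 * K\<^sup>2 * \<delta> * S\<^sup>2"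
  proof -
    have "\<delta>\<^sup>2 \<le> 4 * \<delta>" using mult_right_mono[OF delta(2) delta(1)] delta by (simp add: power2_eq_square)
    then have "(K\<^sup>2 * S\<^sup>2) * \<delta>\<^sup>2 \<le> (K\<^sup>2 * S\<^sup>2) * (4 * \<delta>)" by (intro mult_left_mono) auto
    then show ?thesis by (simp add: mult_ac)
  qed
  then have "n * ((v j)\<^sup>2 * \<kappa>\<^sup>2 / 8 - 4 * K\<^sup>2 * \<delta> * S\<^sup>2) \<le> n * ((v j)\<^sup>2 * \<kappa>\<^sup>2 / 8 - K\<^sup>2 * \<delta>\<^sup>2 * S\<^sup>2)"
    using n_pos by (intro mult_left_mono) auto
  ultimately show ?thesis unfolding V_def S_def by linarith
qed

lemma square_split:
  "(\<Sum>k\<in>C. (f k)\<^sup>2) = (\<Sum>k\<in>C. (f k - m)\<^sup>2) + 2 * m * (\<Sum>k\<in>C. f k - m) + real (card C) * m\<^sup>2" for m :: real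
proof -
  have "(\<Sum>k\<in>C. (f k)\<^sup>2) = (\<Sum>k\<in>C. (f k - m)\<^sup>2 + 2 * m * (f k - m) + m\<^sup>2)"
    by (intro sum.cong) (auto simp: power2_eq_square algebra_simps)
  then show ?thesis by (simp add: sum.distrib sum_distrib_left)
qed

text \<open>
  In each regime a sum of squares is its spread plus the squared mean, and the spread before the
  change is bounded by \<open>dispersion_A\<close>. The error constant 10 adds the 4 from there to a cross term
  (2) and a cardinality error (1) from each of the two regimes.
\<close>

lemma square_sum_lower:
  assumes j: "j < p"
  shows "n * ((v j)\<^sup>2 * \<kappa>\<^sup>2 / 8 + \<rho> * (mean1 v)\<^sup>2 + (1 - \<rho>) * (mean2 v)\<^sup>2
              - 10 * K\<^sup>2 * \<delta> * (size1 v)\<^sup>2) \<le> (\<Sum>k\<in>A \<union> B. (lin v k)\<^sup>2)"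
proof -
  define S where "S = size1 v"
  have S0: "S \<ge> 0" by (simp add: S_def size1_nonneg)
  define Q where "Q = n * (K\<^sup>2 * \<delta> * S\<^sup>2)"
  have cross: "\<bar>2 * m * s\<bar> \<le> 2 * Q"
    if "\<bar>m\<bar> \<le> K * S" "\<bar>s\<bar> \<le> \<delta> * n * S" for m s
  proof -
    have "\<bar>m\<bar> * \<bar>s\<bar> \<le> (K * S) * (\<delta> * n * S)" using that K1 S0 by (intro mult_mono) auto
    also have "\<dots> = K * (\<delta> * n * S\<^sup>2)" by (simp add: power2_eq_square mult_ac)
    also have "\<dots> \<le> K\<^sup>2 * (\<delta> * n * S\<^sup>2)" using K1 delta n_pos S0
      by (intro mult_right_mono) (auto simp: power2_eq_square)
    finally show ?thesis by (simp add: abs_mult mult_ac Q_def)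
  qed
  have sq: "\<delta> * n * m\<^sup>2 \<le> Q" if "\<bar>m\<bar> \<le> K * S" for m
  proof -
    have "m\<^sup>2 \<le> (K * S)\<^sup>2" using that by (metis abs_ge_zero power2_abs power_mono)
    then have "\<delta> * n * m\<^sup>2 \<le> \<delta> * n * (K * S)\<^sup>2" using delta n_pos by (intro mult_left_mono) auto
    then show ?thesis by (simp add: power_mult_distrib mult_ac Q_def)
  qed
  have main: "r * n * m\<^sup>2 - Q \<le> c * m\<^sup>2" if "\<bar>c - r * n\<bar> \<le> \<delta> * n" "\<bar>m\<bar> \<le> K * S" for c r m :: real
  proof -
    have "(r * n - \<delta> * n) * m\<^sup>2 \<le> c * m\<^sup>2" using that(1) by (intro mult_right_mono) auto
    with sq[OF that(2)] show ?thesis by (simp add: left_diff_distrib)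
  qed
  have A: "(\<Sum>k\<in>A. (lin v k)\<^sup>2) \<ge> n * ((v j)\<^sup>2 * \<kappa>\<^sup>2 / 8 - 4 * K\<^sup>2 * \<delta> * S\<^sup>2)
      + \<rho> * n * (mean1 v)\<^sup>2 - 3 * Q"
    using square_split[of "lin v" A "mean1 v"] dispersion_A[OF j, of v, folded S_def]
      cross[OF mean1_le[of v, folded S_def] lin_dev_A[of v, folded S_def]]
      main[OF cards(1) mean1_le[of v, folded S_def]]
    by linarith
  have B: "(\<Sum>k\<in>B. (lin v k)\<^sup>2) \<ge> (1 - \<rho>) * n * (mean2 v)\<^sup>2 - 3 * Q"
    using square_split[of "lin v" B "mean2 v"] sum_nonneg[of B "\<lambda>k. (lin v k - mean2 v)\<^sup>2"]
      cross[OF mean2_le[of v, folded S_def] lin_dev_B[of v, folded S_def]]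
      main[OF cards(2) mean2_le[of v, folded S_def]]
    by simp
  have "(\<Sum>k\<in>A \<union> B. (lin v k)\<^sup>2) = (\<Sum>k\<in>A. (lin v k)\<^sup>2) + (\<Sum>k\<in>B. (lin v k)\<^sup>2)"
    using fin disj by (rule sum.union_disjoint)
  with A B show ?thesis unfolding S_def[symmetric] Q_def by (simp add: algebra_simps)
qed

text \<open>
  Half of this number bounds the quadratic form of the averaged design matrix from below, relative
  to the square of the 1-norm of the argument, as soon as \<open>\<delta>\<close> is small.
\<close>

definition coercivity :: real where
  "coercivity = min (\<kappa>\<^sup>2 / (16 * (1 + K)\<^sup>2 * (real p)\<^sup>2)) (\<rho> / 2)"

lemma coercivity_pos: "coercivity > 0"
  using kappa K1 p_pos rho by (auto simp: coercivity_def)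

text \<open>
  The constant regressor has mean 1, so its coefficient is determined by \<open>mean1 v\<close> and the other
  coefficients. Hence the largest of these and \<open>mean1 v\<close> control the whole vector.
\<close>

lemma obtain_dominant:
  obtains j where "j < p" "\<And>i. i < p \<Longrightarrow> \<bar>v i\<bar> \<le> \<bar>v j\<bar>"
    "coercivity * (size1 v)\<^sup>2 \<le> (v j)\<^sup>2 * \<kappa>\<^sup>2 / 8 + \<rho> * (mean1 v)\<^sup>2"
proof -
  have ne: "{..<p} \<noteq> {}" using p_pos by (simp add: lessThan_empty_iff bot_nat_def)
  have "Max ((\<lambda>i. \<bar>v i\<bar>) ` {..<p}) \<in> (\<lambda>i. \<bar>v i\<bar>) ` {..<p}" using ne by (intro Max_in) auto
  then obtain j where jM: "j < p" "Max ((\<lambda>i. \<bar>v i\<bar>) ` {..<p}) = \<bar>v j\<bar>" by auto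
  have j: "j < p" "\<And>i. i < p \<Longrightarrow> \<bar>v i\<bar> \<le> \<bar>v j\<bar>"
    unfolding jM(2)[symmetric] using jM(1) by (auto intro!: Max_ge)
  define R where "R = \<bar>v j\<bar>"
  have sum1: "(\<Sum>i<p. \<bar>v i\<bar>) \<le> real p * R"
    using sum_mono[of "{..<p}" "\<lambda>i. \<bar>v i\<bar>" "\<lambda>_. R"] j by (auto simp: R_def)
  have "\<bar>\<Sum>i<p. v i * m1 i\<bar> \<le> (\<Sum>i<p. \<bar>v i * m1 i\<bar>)" by (rule sum_abs)
  also have "\<dots> \<le> (\<Sum>i<p. K * \<bar>v i\<bar>)"
    using means(1) by (intro sum_mono) (simp add: abs_mult mult.commute mult_right_mono)
  also have "\<dots> \<le> K * (real p * R)" unfolding sum_distrib_left[symmetric] using sum1 K1 by (intro mult_left_mono) auto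
  finally have "\<bar>\<Sum>i<p. v i * m1 i\<bar> \<le> K * (real p * R)" .
  moreover have "v p = mean1 v - (\<Sum>i<p. v i * m1 i)"
    unfolding mean1_def lessThan_Suc_atMost[symmetric] by (simp add: const)
  ultimately have "\<bar>v p\<bar> \<le> \<bar>mean1 v\<bar> + K * (real p * R)" by linarith
  moreover have "size1 v = (\<Sum>i<p. \<bar>v i\<bar>) + \<bar>v p\<bar>"
    unfolding size1_def lessThan_Suc_atMost[symmetric] by simp
  ultimately have "size1 v \<le> (1 + K) * real p * R + \<bar>mean1 v\<bar>" using sum1 by (simp add: algebra_simps)
  then have "(size1 v)\<^sup>2 \<le> ((1 + K) * real p * R + \<bar>mean1 v\<bar>)\<^sup>2"
    using size1_nonneg by (intro power_mono) auto
  also have "\<dots> \<le> 2 * ((1 + K) * real p * R)\<^sup>2 + 2 * (mean1 v)\<^sup>2"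
    using zero_le_power2[of "(1 + K) * real p * R - \<bar>mean1 v\<bar>"] power2_abs[of "mean1 v"]
    by (simp add: power2_sum power2_diff)
  finally have "coercivity * (size1 v)\<^sup>2 \<le> coercivity * (2 * ((1 + K) * real p * R)\<^sup>2) + coercivity * (2 * (mean1 v)\<^sup>2)"
    using coercivity_pos by (simp add: distrib_left[symmetric] del: distrib_left_numeral)
  also have "coercivity * (2 * ((1 + K) * real p * R)\<^sup>2) \<le> (\<kappa>\<^sup>2 / (16 * (1 + K)\<^sup>2 * (real p)\<^sup>2)) * (2 * ((1 + K) * real p * R)\<^sup>2)"
    by (intro mult_right_mono) (auto simp: coercivity_def)
  also have "\<dots> = (v j)\<^sup>2 * \<kappa>\<^sup>2 / 8"
    using K1 p_pos by (simp add: R_def power_mult_distrib)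
  also have "coercivity * (2 * (mean1 v)\<^sup>2) \<le> (\<rho> / 2) * (2 * (mean1 v)\<^sup>2)"
    by (intro mult_right_mono) (auto simp: coercivity_def)
  finally show ?thesis using that[OF j] by simp
qed

lemma coercive:
  assumes "\<delta> \<le> coercivity / (20 * K\<^sup>2)"
  shows "n * (coercivity / 2 * (size1 v)\<^sup>2) \<le> (\<Sum>k\<in>A \<union> B. (lin v k)\<^sup>2)"
proof -
  obtain j where j: "j < p" and c: "coercivity * (size1 v)\<^sup>2 \<le> (v j)\<^sup>2 * \<kappa>\<^sup>2 / 8 + \<rho> * (mean1 v)\<^sup>2"
    by (rule obtain_dominant)
  have "10 * K\<^sup>2 * \<delta> \<le> coercivity / 2" using assms K1 by (simp add: field_simps)
  then have "10 * K\<^sup>2 * \<delta> * (size1 v)\<^sup>2 \<le> coercivity / 2 * (size1 v)\<^sup>2" by (rule mult_right_mono) auto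
  moreover have nn: "0 \<le> (1 - \<rho>) * (mean2 v)\<^sup>2" using rho by simp
  ultimately have "coercivity / 2 * (size1 v)\<^sup>2 \<le> (v j)\<^sup>2 * \<kappa>\<^sup>2 / 8 + \<rho> * (mean1 v)\<^sup>2 + (1 - \<rho>) * (mean2 v)\<^sup>2
              - 10 * K\<^sup>2 * \<delta> * (size1 v)\<^sup>2"
    using c nn by linarith
  then have "n * (coercivity / 2 * (size1 v)\<^sup>2) \<le> n * ((v j)\<^sup>2 * \<kappa>\<^sup>2 / 8 + \<rho> * (mean1 v)\<^sup>2 + (1 - \<rho>) * (mean2 v)\<^sup>2
              - 10 * K\<^sup>2 * \<delta> * (size1 v)\<^sup>2)" using n_pos by (intro mult_left_mono) auto
  with square_sum_lower[OF j, of v] show ?thesis by linarith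
qed


text \<open>
  The step that decides the sign of both slopes. With \<open>D = mean1 u - mean2 u\<close>, the contracted
  equations and the equation of the constant regressor combine to
  \<open>\<kappa>1 D\<^sup>2 + \<rho> (mean1 u) D \<le> \<delta> E3\<close>, where the first term is the contribution of the spread. A value
  \<open>mean1 u < c\<close> would force \<open>D \<le> - \<Delta> / 2\<close>, and then the left hand side is at least
  \<open>\<kappa>1 \<Delta>\<^sup>2 / 8\<close>. The numbers \<open>N0\<close>, \<open>E2\<close> and \<open>E3\<close> bound the size of \<open>u\<close> and the errors per unit of
  \<open>\<delta>\<close>; they depend only on the constants of the design, so \<open>\<delta>\<close> can be chosen after them.
\<close>

lemma normal_equations_drift:
  fixes u :: "nat \<Rightarrow> real" and \<epsilon> :: "'k \<Rightarrow> real" and \<Delta> :: real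
  assumes Delta: "\<Delta> > 0"
    and normal: "\<And>a. a \<le> p \<Longrightarrow>
      (\<Sum>k\<in>A \<union> B. lin u k * y k a) = \<Delta> * (\<Sum>k\<in>B. y k a) - (\<Sum>k\<in>A \<union> B. \<epsilon> k * y k a)"
    and noise: "\<And>a. a \<le> p \<Longrightarrow> \<bar>\<Sum>k\<in>A \<union> B. \<epsilon> k * y k a\<bar> \<le> \<delta> * n"
    and E_def: "E = 2 * \<Delta> * K + 1"
    and N0_def: "N0 = 2 * (\<Delta> * K + E) / coercivity"
    and E2_def: "E2 = 4 * K * N0 + \<Delta> + 1"
    and E3_def: "E3 = 10 * K\<^sup>2 * N0\<^sup>2 + E * N0 + K * N0 * E2"
    and kappa1: "\<kappa>1 = \<kappa>\<^sup>2 / (32 * K\<^sup>2 * (real p)\<^sup>2)"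
    and c_def: "c = min (\<Delta> * (1 - \<rho>) / 4) (\<kappa>1 * \<Delta> / 4)"
    and small: "\<delta> \<le> coercivity / (20 * K\<^sup>2)" "\<delta> * E2 \<le> \<Delta> * (1 - \<rho>) / 4"
      "\<delta> * E2 \<le> \<rho> * c / 2" "\<delta> * E3 < \<kappa>1 * \<Delta>\<^sup>2 / 8"
  shows "size1 u \<le> N0" "mean1 u \<ge> \<rho> * c / 2" "\<Delta> - mean2 u \<ge> \<rho> * c / 2"
proof -
  define S where "S = size1 u"
  define a where "a = mean1 u"
  define b where "b = mean2 u"
  define Q where "Q = (\<Sum>k\<in>A \<union> B. (lin u k)\<^sup>2)"
  have S0: "S \<ge> 0" by (simp add: S_def size1_nonneg)
  have aS: "\<bar>a\<bar> \<le> K * S" and bS: "\<bar>b\<bar> \<le> K * S" by (simp_all add: a_def b_def S_def mean1_le mean2_le)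
  have dnS: "0 \<le> \<delta> * n * S" "\<delta> * n * S \<le> K * (\<delta> * n * S)"
    using mult_right_mono[OF K1, of "\<delta> * n * S"] delta n_pos S0 by auto
  have sum_total: "\<bar>(\<Sum>k\<in>C. lin u k) - r * n * m\<bar> \<le> 2 * K * (\<delta> * n * S)"
    if "\<bar>real (card C) - r * n\<bar> \<le> \<delta> * n" "\<bar>\<Sum>k\<in>C. lin u k - m\<bar> \<le> \<delta> * n * S" "\<bar>m\<bar> \<le> K * S" for C r m
  proof -
    have "(\<Sum>k\<in>C. lin u k) - r * n * m = (\<Sum>k\<in>C. lin u k - m) + (real (card C) - r * n) * m"
      by (simp add: sum_subtractf algebra_simps)
    moreover have "\<bar>(real (card C) - r * n) * m\<bar> \<le> (\<delta> * n) * (K * S)"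
      unfolding abs_mult using that delta n_pos by (intro mult_mono) auto
    ultimately show ?thesis using that(2) dnS by (simp add: algebra_simps)
  qed
  have sumA: "\<bar>(\<Sum>k\<in>A. lin u k) - \<rho> * n * a\<bar> \<le> 2 * K * (\<delta> * n * S)"
    using sum_total[OF cards(1) _ aS] lin_dev_A[of u] by (simp add: a_def S_def)
  have sumB: "\<bar>(\<Sum>k\<in>B. lin u k) - (1 - \<rho>) * n * b\<bar> \<le> 2 * K * (\<delta> * n * S)"
    using sum_total[OF cards(2) _ bS] lin_dev_B[of u] by (simp add: b_def S_def)
  \<comment> \<open>The quadratic form of the design matrix at \<open>u\<close>, read off the normal equations contracted with \<open>u\<close>.\<close>
  have "Q = (\<Sum>k\<in>A \<union> B. \<Sum>i\<le>p. u i * (lin u k * y k i))"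
  proof -
    have "(\<Sum>i\<le>p. u i * (lin u k * y k i)) = lin u k * (\<Sum>i\<le>p. u i * y k i)" for k
      by (simp add: sum_distrib_left mult.left_commute)
    then show ?thesis by (simp add: Q_def power2_eq_square lin_def[symmetric])
  qed
  also have "\<dots> = (\<Sum>i\<le>p. u i * (\<Sum>k\<in>A \<union> B. lin u k * y k i))"
    by (subst sum.swap) (simp add: sum_distrib_left)
  also have "\<dots> = (\<Sum>i\<le>p. u i * (\<Delta> * (\<Sum>k\<in>B. y k i) - (\<Sum>k\<in>A \<union> B. \<epsilon> k * y k i)))"
    using normal by (intro sum.cong) auto
  also have "\<dots> = \<Delta> * (\<Sum>i\<le>p. \<Sum>k\<in>B. u i * y k i) - (\<Sum>i\<le>p. u i * (\<Sum>k\<in>A \<union> B. \<epsilon> k * y k i))"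
    by (simp add: right_diff_distrib sum_subtractf sum_distrib_left mult_ac)
  also have "(\<Sum>i\<le>p. \<Sum>k\<in>B. u i * y k i) = (\<Sum>k\<in>B. lin u k)"
    by (subst sum.swap) (simp add: lin_def)
  finally have Q_eq: "Q = \<Delta> * (\<Sum>k\<in>B. lin u k) - (\<Sum>i\<le>p. u i * (\<Sum>k\<in>A \<union> B. \<epsilon> k * y k i))" .
  have "\<bar>\<Sum>i\<le>p. u i * (\<Sum>k\<in>A \<union> B. \<epsilon> k * y k i)\<bar> \<le> \<delta> * n * S"
    unfolding S_def by (rule weighted_sum_le[OF noise])
  moreover have "\<Delta> * (\<Sum>k\<in>B. lin u k) \<le> \<Delta> * ((1 - \<rho>) * n * b + 2 * K * (\<delta> * n * S))"
    using sumB Delta by (intro mult_left_mono) auto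
  ultimately have Qu: "Q \<le> n * (\<Delta> * (1 - \<rho>) * b + E * (\<delta> * S))"
    unfolding Q_eq E_def by (simp add: algebra_simps)
  have "n * (coercivity / 2 * S\<^sup>2) \<le> Q" unfolding Q_def S_def by (rule coercive[OF small(1)])
  then have "n * (coercivity / 2 * S\<^sup>2) \<le> n * (\<Delta> * (1 - \<rho>) * b + E * (\<delta> * S))" using Qu by linarith
  then have "coercivity / 2 * S\<^sup>2 \<le> \<Delta> * (1 - \<rho>) * b + E * (\<delta> * S)" using n_pos by simp
  also have "\<dots> \<le> \<Delta> * K * S + E * S"
  proof -
    have "(1 - \<rho>) * b \<le> (1 - \<rho>) * \<bar>b\<bar>" using rho by (intro mult_left_mono) auto
    also have "\<dots> \<le> 1 * \<bar>b\<bar>" using rho by (intro mult_right_mono) auto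
    finally have "(1 - \<rho>) * b \<le> 1 * \<bar>b\<bar>" .
    then have "\<Delta> * ((1 - \<rho>) * b) \<le> \<Delta> * (K * S)" using bS Delta by (intro mult_left_mono) auto
    moreover have "E * (\<delta> * S) \<le> E * (1 * S)" using delta S0 Delta K1
      by (intro mult_left_mono mult_right_mono) (auto simp: E_def)
    ultimately show ?thesis by (simp add: mult.assoc)
  qed
  finally have "S * (coercivity / 2 * S) \<le> S * (\<Delta> * K + E)" by (simp add: power2_eq_square algebra_simps)
  moreover have "\<Delta> * K + E \<ge> 0" using Delta K1 by (simp add: E_def)
  ultimately have "coercivity / 2 * S \<le> \<Delta> * K + E" using S0
    by (cases "S = 0") auto
  then have SN: "S \<le> N0" using coercivity_pos by (simp add: N0_def field_simps)
  then show "size1 u \<le> N0" by (simp add: S_def)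
  have N0: "N0 \<ge> 0" using SN S0 by linarith
  \<comment> \<open>The normal equation of the constant regressor fixes \<open>\<rho> a + (1 - \<rho>) b\<close>.\<close>
  define e where "e = \<rho> * a + (1 - \<rho>) * b - \<Delta> * (1 - \<rho>)"
  have e_bound: "\<bar>e\<bar> \<le> \<delta> * E2"
  proof -
    have "(\<Sum>k\<in>A. lin u k) + (\<Sum>k\<in>B. lin u k) = (\<Sum>k\<in>A \<union> B. lin u k)"
      using fin disj by (rule sum.union_disjoint[symmetric])
    also have "\<dots> = \<Delta> * real (card B) - (\<Sum>k\<in>A \<union> B. \<epsilon> k)"
      using normal[of p] by (simp add: const)
    finally have eq: "(\<Sum>k\<in>A. lin u k) + (\<Sum>k\<in>B. lin u k) = \<Delta> * real (card B) - (\<Sum>k\<in>A \<union> B. \<epsilon> k)" .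
    have "n * e = (\<Delta> * real (card B) - \<Delta> * ((1 - \<rho>) * n)) - (\<Sum>k\<in>A \<union> B. \<epsilon> k)
      - ((\<Sum>k\<in>A. lin u k) - \<rho> * n * a) - ((\<Sum>k\<in>B. lin u k) - (1 - \<rho>) * n * b)"
      using eq by (simp add: e_def algebra_simps)
    moreover have "\<bar>\<Delta> * real (card B) - \<Delta> * ((1 - \<rho>) * n)\<bar> \<le> \<Delta> * (\<delta> * n)"
      using cards(2) Delta by (simp add: right_diff_distrib[symmetric] abs_mult)
    moreover have "\<bar>\<Sum>k\<in>A \<union> B. \<epsilon> k\<bar> \<le> \<delta> * n" using noise[of p] by (simp add: const)
    ultimately have "\<bar>n * e\<bar> \<le> \<Delta> * (\<delta> * n) + \<delta> * n + 4 * K * (\<delta> * n * S)" using sumA sumB by linarith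
    also have "\<dots> \<le> \<Delta> * (\<delta> * n) + \<delta> * n + 4 * K * (\<delta> * n * N0)"
      using SN K1 delta n_pos by (intro add_left_mono mult_left_mono) auto
    also have "\<dots> = n * (\<delta> * E2)" by (simp add: E2_def algebra_simps)
    finally show ?thesis using n_pos by (simp add: abs_mult)
  qed
  obtain j where j: "j < p" and dom: "\<And>i. i < p \<Longrightarrow> \<bar>u i\<bar> \<le> \<bar>u j\<bar>" by (metis obtain_dominant[of u])
  define D where "D = a - b"
  have key: "\<kappa>1 * D\<^sup>2 + \<rho> * a * D \<le> \<delta> * E3"
  proof -
    have "n * ((u j)\<^sup>2 * \<kappa>\<^sup>2 / 8 + \<rho> * a\<^sup>2 + (1 - \<rho>) * b\<^sup>2 - 10 * K\<^sup>2 * \<delta> * S\<^sup>2)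
        \<le> n * (\<Delta> * (1 - \<rho>) * b + E * (\<delta> * S))"
      using square_sum_lower[OF j, of u] Qu unfolding a_def b_def S_def Q_def by linarith
    then have "(u j)\<^sup>2 * \<kappa>\<^sup>2 / 8 + \<rho> * a\<^sup>2 + (1 - \<rho>) * b\<^sup>2 - \<Delta> * (1 - \<rho>) * b \<le> 10 * K\<^sup>2 * \<delta> * S\<^sup>2 + E * (\<delta> * S)"
      using n_pos by simp
    moreover have "\<rho> * a\<^sup>2 + (1 - \<rho>) * b\<^sup>2 - \<Delta> * (1 - \<rho>) * b = \<rho> * a * D + b * e"
      by (simp add: D_def e_def power2_eq_square algebra_simps)
    ultimately have 1: "(u j)\<^sup>2 * \<kappa>\<^sup>2 / 8 + \<rho> * a * D \<le> 10 * K\<^sup>2 * \<delta> * S\<^sup>2 + E * (\<delta> * S) - b * e" by linarith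
    have "\<bar>b * e\<bar> \<le> (K * N0) * (\<delta> * E2)"
      unfolding abs_mult using bS SN K1 N0 e_bound
      by (intro mult_mono) (auto intro: order_trans[OF _ mult_left_mono])
    moreover have "10 * K\<^sup>2 * \<delta> * S\<^sup>2 \<le> 10 * K\<^sup>2 * \<delta> * N0\<^sup>2" using SN S0 delta
      by (intro mult_left_mono power_mono) auto
    moreover have "E * (\<delta> * S) \<le> E * (\<delta> * N0)" using SN delta Delta K1
      by (intro mult_left_mono) (auto simp: E_def)
    ultimately have 2: "(u j)\<^sup>2 * \<kappa>\<^sup>2 / 8 + \<rho> * a * D \<le> \<delta> * E3" using 1 by (simp add: E3_def algebra_simps)
    have "D = (\<Sum>i\<le>p. u i * (m1 i - m2 i))"
      by (simp add: D_def a_def b_def mean1_def mean2_def sum_subtractf right_diff_distrib)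
    also have "\<dots> = (\<Sum>i<p. u i * (m1 i - m2 i))"
      unfolding lessThan_Suc_atMost[symmetric] by (simp add: const)
    finally have "\<bar>D\<bar> \<le> (\<Sum>i<p. \<bar>u i * (m1 i - m2 i)\<bar>)" by simp
    also have "\<dots> \<le> (\<Sum>i<p. \<bar>u j\<bar> * (2 * K))"
    proof (intro sum_mono)
      fix i assume "i \<in> {..<p}"
      then have i: "i < p" "i \<le> p" by auto
      have "\<bar>m1 i - m2 i\<bar> \<le> 2 * K" using means[OF i(2)] by linarith
      then show "\<bar>u i * (m1 i - m2 i)\<bar> \<le> \<bar>u j\<bar> * (2 * K)"
        unfolding abs_mult using dom[OF i(1)] by (intro mult_mono) auto
    qed
    finally have "\<bar>D\<bar> \<le> 2 * K * real p * \<bar>u j\<bar>" by (simp add: mult_ac)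
    then have "D\<^sup>2 \<le> (2 * K * real p * \<bar>u j\<bar>)\<^sup>2" by (metis abs_ge_zero power2_abs power_mono)
    then have "\<kappa>1 * D\<^sup>2 \<le> \<kappa>1 * (2 * K * real p * \<bar>u j\<bar>)\<^sup>2" by (intro mult_left_mono) (auto simp: kappa1)
    also have "\<dots> = (u j)\<^sup>2 * \<kappa>\<^sup>2 / 8" using K1 p_pos by (simp add: kappa1 power_mult_distrib)
    finally show ?thesis using 2 by linarith
  qed
  have k1: "\<kappa>1 > 0" using kappa K1 p_pos by (simp add: kappa1)
  have c0: "c > 0" using Delta rho k1 by (simp add: c_def)
  have D_eq: "(1 - \<rho>) * D = a - e - \<Delta> * (1 - \<rho>)" by (simp add: D_def e_def algebra_simps)
  have ac: "a \<ge> c"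
  proof (rule ccontr)
    assume "\<not> a \<ge> c"
    then have "a < c" by simp
    moreover have "c \<le> \<Delta> * (1 - \<rho>) / 4" "c \<le> \<kappa>1 * \<Delta> / 4" by (auto simp: c_def)
    ultimately have "(1 - \<rho>) * D \<le> - (\<Delta> * (1 - \<rho>) / 2)"
      using D_eq e_bound small(2) by linarith
    then have "(1 - \<rho>) * D \<le> (1 - \<rho>) * (- (\<Delta> / 2))" by (simp add: algebra_simps)
    then have D: "D \<le> - (\<Delta> / 2)" using rho by (metis mult_le_cancel_left_pos diff_gt_0_iff_gt)
    have "\<rho> * a * (-D) \<le> c * (-D)"
    proof (rule mult_right_mono)
      show "0 \<le> - D" using D Delta by linarith
      have "\<rho> * a \<le> \<rho> * c" using \<open>a < c\<close> rho by simp
      also have "\<dots> \<le> 1 * c" using rho c0 by (intro mult_right_mono) auto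
      finally show "\<rho> * a \<le> c" by simp
    qed
    moreover have "c * (-D) \<le> \<kappa>1 * \<Delta> / 4 * (-D)"
      using D Delta \<open>c \<le> \<kappa>1 * \<Delta> / 4\<close> by (intro mult_right_mono) linarith+
    moreover have "\<kappa>1 * (\<Delta> / 2) * (- D) \<le> \<kappa>1 * (-D) * (- D)"
      using D Delta k1 by (intro mult_right_mono mult_left_mono) auto
    moreover have "\<kappa>1 * \<Delta> / 4 * (\<Delta> / 2) \<le> \<kappa>1 * \<Delta> / 4 * (- D)"
      using D Delta k1 by (intro mult_left_mono) auto
    moreover have "\<kappa>1 * (\<Delta> / 2) * (- D) = 2 * (\<kappa>1 * \<Delta> / 4 * (- D))" by simp
    moreover have "\<kappa>1 * D\<^sup>2 + \<rho> * a * D = \<kappa>1 * (- D) * (- D) - \<rho> * a * (- D)"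
      by (simp add: power2_eq_square)
    ultimately have "\<kappa>1 * \<Delta> / 4 * (\<Delta> / 2) \<le> \<kappa>1 * D\<^sup>2 + \<rho> * a * D"
      by linarith
    with key small(4) show False by (simp add: power2_eq_square)
  qed
  have "\<rho> * c / 2 \<le> 1 * c" using c0 rho by (simp add: field_simps)
  then show "mean1 u \<ge> \<rho> * c / 2" using ac by (simp add: a_def)
  have "(1 - \<rho>) * (\<Delta> - b) = \<rho> * a - e" by (simp add: e_def algebra_simps)
  moreover have "\<rho> * a \<ge> \<rho> * c" using ac rho by simp
  ultimately have 3: "(1 - \<rho>) * (\<Delta> - b) \<ge> \<rho> * c / 2" using e_bound small(3) by linarith
  have "\<Delta> - b \<ge> 0"
  proof (rule ccontr)
    assume "\<not> \<Delta> - b \<ge> 0"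
    then have "(1 - \<rho>) * (\<Delta> - b) < 0" using rho by (intro mult_pos_neg) auto
    moreover have "\<rho> * c / 2 > 0" using rho c0 by simp
    ultimately show False using 3 by linarith
  qed
  then have "(1 - \<rho>) * (\<Delta> - b) \<le> 1 * (\<Delta> - b)" using rho by (intro mult_right_mono) auto
  with 3 show "\<Delta> - mean2 u \<ge> \<rho> * c / 2" by (simp add: b_def)
qed

end

section \<open>From a good path to the change point estimator\<close>

lemma regressor_index:
  assumes "a \<le> p"
  shows "regressor p x k $ a = (if a < p then real (x (int k - 1 - int a)) else 1)"
  using assms by (auto simp: regressor_def state_vec_def)

lemma dim_regressor [simp]: "dim_vec (regressor p x k) = p + 1"
  by (simp add: regressor_def state_vec_def)

lemma scalar_prod_regressor:
  "v \<bullet> regressor p x k = (\<Sum>a\<le>p. v $ a * regressor p x k $ a)"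
  unfolding scalar_prod_def by (intro sum.cong) auto

lemma sum_nat_int: "(\<Sum>k = 1..N. f (int k)) = (\<Sum>t\<in>{1..int N}. f t)" for f :: "int \<Rightarrow> real"
  by (rule sum.reindex_bij_witness[where i = nat and j = int]) auto

lemma sum_nat_int': "(\<Sum>k\<in>{a + 1..b}. f (int k)) = (\<Sum>t\<in>{int a + 1..int b}. f t)" for f :: "int \<Rightarrow> real"
  by (rule sum.reindex_bij_witness[where i = nat and j = int]) auto

text \<open>
  A positive quadratic form makes the design matrix nonsingular, so the estimator is the least
  squares solution and not one of the arbitrary values allowed for singular matrices.
\<close>

lemma cls_normal_equations:
  assumes theta: "\<theta> \<in> carrier_vec (p + 1)"
    and inv: "\<And>B. B \<in> carrier_mat (p + 1) (p + 1) \<Longrightarrow> inverts_mat (design_matrix p n x) B \<Longrightarrow>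
      inverts_mat B (design_matrix p n x) \<Longrightarrow> \<theta> = B *\<^sub>v response_vec p n x"
    and pos: "\<And>v. (\<exists>a\<le>p. v a \<noteq> 0) \<Longrightarrow> (\<Sum>k = 1..n. (\<Sum>a\<le>p. v a * regressor p x k $ a)\<^sup>2) > 0"
    and a: "a \<le> p"
  shows "(\<Sum>k = 1..n. residual p \<theta> x k * regressor p x k $ a) = 0"
proof -
  let ?Q = "design_matrix p n x" and ?N = "p + 1"
  have Q: "?Q \<in> carrier_mat ?N ?N" by (simp add: design_matrix_def)
  have Qv: "(?Q *\<^sub>v v) $ a = (\<Sum>k = 1..n. (v \<bullet> regressor p x k) * regressor p x k $ a)"
    if v: "v \<in> carrier_vec ?N" and a: "a \<le> p" for v a
  proof -
    have "(?Q *\<^sub>v v) $ a = (\<Sum>b\<le>p. (\<Sum>k = 1..n. regressor p x k $ a * regressor p x k $ b) * v $ b)"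
      using a v unfolding index_mult_mat_vec[of a ?Q v] 
      by (simp add: design_matrix_def scalar_prod_def atLeast0LessThan lessThan_Suc_atMost)
    also have "\<dots> = (\<Sum>k = 1..n. \<Sum>b\<le>p. regressor p x k $ a * regressor p x k $ b * v $ b)"
      unfolding sum_distrib_right by (rule sum.swap)
    also have "\<dots> = (\<Sum>k = 1..n. (v \<bullet> regressor p x k) * regressor p x k $ a)"
      by (simp add: scalar_prod_regressor sum_distrib_left mult_ac)
    finally show ?thesis .
  qed
  have "Determinant.det ?Q \<noteq> 0"
  proof
    assume "Determinant.det ?Q = 0"
    then obtain v where v: "v \<in> carrier_vec ?N" "v \<noteq> 0\<^sub>v ?N" "?Q *\<^sub>v v = 0\<^sub>v ?N"
      using det_0_iff_vec_prod_zero_field[OF Q] by auto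
    have "\<exists>a\<le>p. v $ a \<noteq> 0"
    proof (rule ccontr)
      assume "\<not> ?thesis"
      then have "v = 0\<^sub>v ?N" using v(1) by (intro eq_vecI) auto
      then show False using v(2) by simp
    qed
    then have "0 < (\<Sum>k = 1..n. (\<Sum>a\<le>p. v $ a * regressor p x k $ a)\<^sup>2)" by (rule pos)
    also have "\<dots> = (\<Sum>k = 1..n. \<Sum>a\<le>p. v $ a * ((v \<bullet> regressor p x k) * regressor p x k $ a))"
    proof (rule sum.cong[OF refl])
      fix k
      have "(\<Sum>a\<le>p. v $ a * ((v \<bullet> regressor p x k) * regressor p x k $ a)) = (v \<bullet> regressor p x k) * (\<Sum>a\<le>p. v $ a * regressor p x k $ a)"
        by (simp add: sum_distrib_left mult.left_commute)
      then show "(\<Sum>a\<le>p. v $ a * regressor p x k $ a)\<^sup>2 = (\<Sum>a\<le>p. v $ a * ((v \<bullet> regressor p x k) * regressor p x k $ a))"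
        by (simp add: scalar_prod_regressor power2_eq_square)
    qed
    also have "\<dots> = (\<Sum>a\<le>p. v $ a * (\<Sum>k = 1..n. (v \<bullet> regressor p x k) * regressor p x k $ a))"
      by (subst sum.swap) (simp add: sum_distrib_left)
    also have "\<dots> = (\<Sum>a\<le>p. v $ a * (?Q *\<^sub>v v) $ a)" using Qv[OF v(1)] by simp
    also have "\<dots> = 0" using v(3) by simp
    finally show False by simp
  qed
  from det_non_zero_imp_unit[OF Q this, of undefined]
  obtain B where B: "B \<in> carrier_mat ?N ?N" "B * ?Q = 1\<^sub>m ?N" "?Q * B = 1\<^sub>m ?N"
    unfolding Units_def ring_mat_def by auto
  then have "\<theta> = B *\<^sub>v response_vec p n x" using Q by (intro inv) (auto simp: inverts_mat_def)
  moreover have r: "response_vec p n x \<in> carrier_vec ?N" by (simp add: response_vec_def)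
  ultimately have "?Q *\<^sub>v \<theta> = (?Q * B) *\<^sub>v response_vec p n x" using Q B(1) by (simp add: assoc_mult_mat_vec)
  then have "?Q *\<^sub>v \<theta> = response_vec p n x" using B(3) r by simp
  then have "(\<Sum>k = 1..n. (\<theta> \<bullet> regressor p x k) * regressor p x k $ a) = (\<Sum>k = 1..n. real (x (int k)) * regressor p x k $ a)"
    using Qv[OF theta a] a by (simp add: response_vec_def)
  then show ?thesis by (simp add: residual_def left_diff_distrib sum_subtractf)
qed

lemma change_estimator_near:
  assumes "n \<ge> 1" "c \<in> {1..n}"
    and before: "\<And>k. k \<in> {1..n} \<Longrightarrow> k + r \<le> c \<Longrightarrow> (\<Sum>j = 1..k. residual p \<theta> x j) < (\<Sum>j = 1..c. residual p \<theta> x j)"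
    and after: "\<And>k. k \<in> {1..n} \<Longrightarrow> c + r \<le> k \<Longrightarrow> (\<Sum>j = 1..k. residual p \<theta> x j) < (\<Sum>j = 1..c. residual p \<theta> x j)"
  shows "\<bar>real (change_estimator p n \<theta> x) - real c\<bar> < real r"
proof -
  define S where "S = (\<lambda>k. \<Sum>j = 1..k. residual p \<theta> x j)"
  define Am where "Am = {k \<in> {1..n}. S k = Max (S ` {1..n})}"
  have "Max (S ` {1..n}) \<in> S ` {1..n}" using assms by (intro Max_in) auto
  then have ne: "Am \<noteq> {}" by (auto simp: Am_def)
  have "finite Am" by (simp add: Am_def)
  then have "Min Am \<in> Am" using ne by (rule Min_in)
  moreover have "change_estimator p n \<theta> x = Min Am" by (simp add: change_estimator_def Am_def S_def)
  ultimately have k: "change_estimator p n \<theta> x \<in> {1..n}" "S (change_estimator p n \<theta> x) = Max (S ` {1..n})" by (auto simp: Am_def)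
  have "S c \<le> S (change_estimator p n \<theta> x)" unfolding k(2) using assms by (intro Max_ge) auto
  then have "\<not> change_estimator p n \<theta> x + r \<le> c" "\<not> c + r \<le> change_estimator p n \<theta> x"
    using before[OF k(1)] after[OF k(1)] by (auto simp: S_def)
  then show ?thesis by linarith
qed

text \<open>
  The centred noise of step \<open>t\<close>, computed from a path: the martingale difference of the process.
\<close>

definition noise_part :: "nat \<Rightarrow> (nat \<Rightarrow> real) \<Rightarrow> (int \<Rightarrow> real) \<Rightarrow> (int \<Rightarrow> nat) \<Rightarrow> int \<Rightarrow> real" where
  "noise_part p \<alpha> \<mu> x t = real (x t) - (\<Sum>i = 1..p. \<alpha> i * real (x (t - int i))) - \<mu> t"

text \<open>
  All averages along a path that matter are within the tolerance \<open>\<delta>\<close>: windows of length at least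
  \<open>R\<^sup>2\<close> that end or start at the change point, the products of the noise with the regressors,
  and those of the noise with test values \<open>T\<close>. The test values vanish outside
  \<open>p + 1, \<dots>, \<tau> - p\<close>, so that shifting them by up to \<open>p\<close> steps neither leaves the first regime nor
  creates boundary terms.
\<close>

locale good_path =
  fixes p n \<tau> R :: nat and \<alpha> :: "nat \<Rightarrow> real" and \<mu> :: "int \<Rightarrow> real" and \<mu>1 \<mu>2 s \<delta> \<kappa> :: real
    and T :: "int \<Rightarrow> real" and x :: "int \<Rightarrow> nat"
  assumes p_pos: "p \<ge> 1" and tau: "R\<^sup>2 \<le> \<tau>" "R\<^sup>2 \<le> n - \<tau>" "1 \<le> \<tau>" "\<tau> < n"
    and coeff: "\<And>i. i \<in> {1..p} \<Longrightarrow> 0 \<le> \<alpha> i" and s: "s = (\<Sum>i = 1..p. \<alpha> i)" "s < 1"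
    and mu: "\<And>t. t \<in> {1..int \<tau>} \<Longrightarrow> \<mu> t = \<mu>1" "\<And>t. t \<in> {int \<tau> + 1..int n} \<Longrightarrow> \<mu> t = \<mu>2" "\<mu>1 \<ge> 0" "\<mu>2 \<ge> 0"
    and tolerance_nonneg: "\<delta> \<ge> 0"
    and T_support: "\<And>t. t \<notin> {int p + 1..int \<tau> - int p} \<Longrightarrow> T t = 0" and T_le: "\<And>t. \<bar>T t\<bar> \<le> 1"
    and win_before: "\<And>k i. k \<in> {R\<^sup>2..\<tau>} \<Longrightarrow> i \<in> {1..p} \<Longrightarrow>
      \<bar>\<Sum>t\<in>{int \<tau> - int k + 1..int \<tau>}. real (x (t - int i)) - \<mu>1 / (1 - s)\<bar> \<le> \<delta> * real k"
    and win_after: "\<And>k i. k \<in> {R\<^sup>2..n - \<tau>} \<Longrightarrow> i \<in> {1..p} \<Longrightarrow>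
      \<bar>\<Sum>t\<in>{int \<tau> + 1..int \<tau> + int k}. real (x (t - int i)) - \<mu>2 / (1 - s)\<bar> \<le> \<delta> * real k"
    and noise_before: "\<And>k. k \<in> {R\<^sup>2..\<tau>} \<Longrightarrow>
      \<bar>\<Sum>t\<in>{int \<tau> - int k + 1..int \<tau>}. noise_part p \<alpha> \<mu> x t\<bar> \<le> \<delta> * real k"
    and noise_after: "\<And>k. k \<in> {R\<^sup>2..n - \<tau>} \<Longrightarrow>
      \<bar>\<Sum>t\<in>{int \<tau> + 1..int \<tau> + int k}. noise_part p \<alpha> \<mu> x t\<bar> \<le> \<delta> * real k"
    and noise_lag: "\<And>i. i \<in> {1..p} \<Longrightarrow> \<bar>\<Sum>t\<in>{1..int n}. real (x (t - int i)) * noise_part p \<alpha> \<mu> x t\<bar> \<le> \<delta> * real n"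
    and T_sum: "\<bar>\<Sum>t\<in>{int p + 1..int \<tau> - int p}. T t\<bar> \<le> \<delta> * real n"
    and T_off: "\<And>r. r \<noteq> 0 \<Longrightarrow> \<bar>r\<bar> < int p \<Longrightarrow> \<bar>\<Sum>t\<in>{int p + 1..int \<tau> - int p}. T t * noise_part p \<alpha> \<mu> x (t + r)\<bar> \<le> \<delta> * real n"
    and T_diag: "(\<Sum>t\<in>{int p + 1..int \<tau> - int p}. T t * noise_part p \<alpha> \<mu> x t) \<ge> 2 * \<kappa> * real n"
    and kappa: "\<mu>1 * \<delta> \<le> \<kappa>" "\<kappa> > 0"
begin

abbreviation "eps \<equiv> noise_part p \<alpha> \<mu> x"
abbreviation "y k a \<equiv> regressor p x k $ a"

text \<open>
  The autoregressive filter applied to the test values, at lag \<open>j + 1\<close>. Its adjoint turns a path into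
  its noise plus the innovation mean, which is why these functions are dual to the lagged regressors.
\<close>

definition U :: "nat \<Rightarrow> nat \<Rightarrow> real" where
  "U j k = T (int k - 1 - int j) - (\<Sum>l = 1..p. \<alpha> l * T (int k - 1 - int j + int l))"

definition m1 :: "nat \<Rightarrow> real" where "m1 a = (if a < p then \<mu>1 / (1 - s) else 1)"
definition m2 :: "nat \<Rightarrow> real" where "m2 a = (if a < p then \<mu>2 / (1 - s) else 1)"

lemma n_pos: "real n > 0" using tau by simp

lemma shift_test:
  assumes c: "1 - int p \<le> c" "c \<le> int p"
  shows "(\<Sum>k = 1..\<tau>. f (int k) * T (int k - c)) = (\<Sum>t\<in>{int p + 1..int \<tau> - int p}. f (t + c) * T t)"
proof -
  have "(\<Sum>k = 1..\<tau>. f (int k) * T (int k - c)) = (\<Sum>t\<in>{1..int \<tau>}. f t * T (t - c))"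
    by (rule sum_nat_int)
  also have "\<dots> = (\<Sum>t\<in>{1 - c..int \<tau> - c}. f (t + c) * T t)"
    by (rule sum.reindex_bij_witness[where i = "\<lambda>t. t + c" and j = "\<lambda>t. t - c"]) auto
  also have "\<dots> = (\<Sum>t\<in>{int p + 1..int \<tau> - int p}. f (t + c) * T t)"
    using c T_support by (intro sum.mono_neutral_right) auto
  finally show ?thesis .
qed

text \<open>
  Summation by parts: the filter moves from \<open>T\<close> to the path and leaves the noise and the innovation
  mean there.
\<close>

lemma dual_sum:
  assumes ij: "i < p" "j < p"
  shows "(\<Sum>k = 1..\<tau>. y k i * U j k)
    = (\<Sum>t\<in>{int p + 1..int \<tau> - int p}. T t * eps (t + (int j - int i))) + \<mu>1 * (\<Sum>t\<in>{int p + 1..int \<tau> - int p}. T t)"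
proof -
  let ?D = "{int p + 1..int \<tau> - int p}"
  have sh: "(\<Sum>k = 1..\<tau>. y k i * T (int k - 1 - int j + int l)) = (\<Sum>t\<in>?D. real (x (t + (int j - int i) - int l)) * T t)"
    if "l \<le> p" for l
  proof -
    have "(\<Sum>k = 1..\<tau>. y k i * T (int k - 1 - int j + int l)) = (\<Sum>k = 1..\<tau>. real (x (int k - 1 - int i)) * T (int k - (1 + int j - int l)))"
      using ij by (intro sum.cong) (auto simp: regressor_index algebra_simps)
    also have "\<dots> = (\<Sum>t\<in>?D. real (x (t + (1 + int j - int l) - 1 - int i)) * T t)"
      using ij that by (intro shift_test[where f = "\<lambda>t. real (x (t - 1 - int i))"]) auto
    also have "\<dots> = (\<Sum>t\<in>?D. real (x (t + (int j - int i) - int l)) * T t)"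
      by (intro sum.cong refl) (simp add: algebra_simps)
    finally show ?thesis .
  qed
  have "(\<Sum>k = 1..\<tau>. y k i * U j k) = (\<Sum>k = 1..\<tau>. y k i * T (int k - 1 - int j))
      - (\<Sum>k = 1..\<tau>. \<Sum>l = 1..p. \<alpha> l * (y k i * T (int k - 1 - int j + int l)))"
    unfolding U_def right_diff_distrib sum_subtractf sum_distrib_left by (simp add: mult.left_commute)
  also have "(\<Sum>k = 1..\<tau>. \<Sum>l = 1..p. \<alpha> l * (y k i * T (int k - 1 - int j + int l)))
    = (\<Sum>l = 1..p. \<alpha> l * (\<Sum>k = 1..\<tau>. y k i * T (int k - 1 - int j + int l)))"
    by (subst sum.swap) (simp add: sum_distrib_left)
  also have "\<dots> = (\<Sum>l = 1..p. \<alpha> l * (\<Sum>t\<in>?D. real (x (t + (int j - int i) - int l)) * T t))"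
    using sh by (intro sum.cong) auto
  also have "\<dots> = (\<Sum>t\<in>?D. \<Sum>l = 1..p. \<alpha> l * (real (x (t + (int j - int i) - int l)) * T t))"
    unfolding sum_distrib_left by (rule sum.swap)
  also have "(\<Sum>k = 1..\<tau>. y k i * T (int k - 1 - int j)) = (\<Sum>t\<in>?D. real (x (t + (int j - int i))) * T t)"
    using sh[of 0] by simp
  finally have "(\<Sum>k = 1..\<tau>. y k i * U j k) = (\<Sum>t\<in>?D. real (x (t + (int j - int i))) * T t
    - (\<Sum>l = 1..p. \<alpha> l * (real (x (t + (int j - int i) - int l)) * T t)))" by (simp add: sum_subtractf)
  also have "\<dots> = (\<Sum>t\<in>?D. T t * eps (t + (int j - int i)) + \<mu>1 * T t)"
  proof (rule sum.cong[OF refl])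
    fix t assume t: "t \<in> ?D"
    then have "\<mu> (t + (int j - int i)) = \<mu>1" using ij by (intro mu(1)) auto
    moreover have "(\<Sum>l = 1..p. \<alpha> l * (real (x (t + (int j - int i) - int l)) * T t)) = T t * (\<Sum>l = 1..p. \<alpha> l * real (x (t + (int j - int i) - int l)))"
      by (simp add: sum_distrib_left mult_ac)
    ultimately show "real (x (t + (int j - int i))) * T t - (\<Sum>l = 1..p. \<alpha> l * (real (x (t + (int j - int i) - int l)) * T t))
      = T t * eps (t + (int j - int i)) + \<mu>1 * T t"
      by (simp add: noise_part_def algebra_simps)
  qed
  finally show ?thesis by (simp add: sum.distrib sum_distrib_left)
qed

lemma U_sum:
  assumes j: "j < p"
  shows "(\<Sum>k = 1..\<tau>. U j k) = (1 - s) * (\<Sum>t\<in>{int p + 1..int \<tau> - int p}. T t)"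
proof -
  let ?D = "{int p + 1..int \<tau> - int p}"
  have sh: "(\<Sum>k = 1..\<tau>. T (int k - 1 - int j + int l)) = (\<Sum>t\<in>?D. T t)" if "l \<le> p" for l
    using shift_test[of "1 + int j - int l" "\<lambda>_. 1"] that j by (simp add: algebra_simps)
  have "(\<Sum>k = 1..\<tau>. U j k) = (\<Sum>k = 1..\<tau>. T (int k - 1 - int j)) - (\<Sum>l = 1..p. \<alpha> l * (\<Sum>k = 1..\<tau>. T (int k - 1 - int j + int l)))"
    unfolding U_def sum_subtractf sum_distrib_left by (subst sum.swap) simp
  also have "\<dots> = (\<Sum>t\<in>?D. T t) - (\<Sum>l = 1..p. \<alpha> l * (\<Sum>t\<in>?D. T t))"
    using sh[of 0] sh by simp
  also have "\<dots> = (1 - s) * (\<Sum>t\<in>?D. T t)" by (simp add: s(1) sum_distrib_right[symmetric] left_diff_distrib)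
  finally show ?thesis .
qed

lemma s_nonneg: "0 \<le> s" unfolding s(1) using coeff by (rule sum_nonneg)

lemma U_le: "\<bar>U j k\<bar> \<le> 2"
proof -
  have "\<bar>\<Sum>l = 1..p. \<alpha> l * T (int k - 1 - int j + int l)\<bar> \<le> (\<Sum>l = 1..p. \<bar>\<alpha> l * T (int k - 1 - int j + int l)\<bar>)" by (rule sum_abs)
  also have "\<dots> \<le> (\<Sum>l = 1..p. \<alpha> l * 1)"
  proof (rule sum_mono)
    fix l assume "l \<in> {1..p}"
    then show "\<bar>\<alpha> l * T (int k - 1 - int j + int l)\<bar> \<le> \<alpha> l * 1"
      using coeff[of l] T_le unfolding abs_mult by (intro mult_mono) auto
  qed
  finally have "\<bar>\<Sum>l = 1..p. \<alpha> l * T (int k - 1 - int j + int l)\<bar> \<le> s" by (simp add: s(1))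
  then show ?thesis using T_le[of "int k - 1 - int j"] s(2) unfolding U_def by linarith
qed

lemma regressor_window:
  assumes "a \<le> p" and C: "\<And>i. i \<in> {1..p} \<Longrightarrow> \<bar>\<Sum>t\<in>{int b + 1..int c}. real (x (t - int i)) - m\<bar> \<le> D" and D: "D \<ge> 0"
  shows "\<bar>\<Sum>k\<in>{b + 1..c}. y k a - (if a < p then m else 1)\<bar> \<le> D"
proof (cases "a < p")
  case True
  have "(\<Sum>k\<in>{b + 1..c}. y k a - (if a < p then m else 1)) = (\<Sum>k\<in>{b + 1..c}. real (x (int k - int (a + 1))) - m)"
    using True by (intro sum.cong refl) (simp add: regressor_index algebra_simps)
  also have "\<dots> = (\<Sum>t\<in>{int b + 1..int c}. real (x (t - int (a + 1))) - m)"
    by (rule sum_nat_int'[where f = "\<lambda>t. real (x (t - int (a + 1))) - m"])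
  finally show ?thesis using C[of "a + 1"] True by simp
next
  case False
  then show ?thesis using assms by (simp add: regressor_index)
qed

text \<open>
  Duality holds with the larger tolerance \<open>\<delta>'\<close> because the innovation mean multiplies the error of
  the average of \<open>T\<close> in \<open>dual_sum\<close>.
\<close>

context
  fixes \<rho> \<delta>' K :: real
  assumes rho: "0 < \<rho>" "\<rho> < 1" and K: "K \<ge> 1" "\<mu>1 / (1 - s) \<le> K" "\<mu>2 / (1 - s) \<le> K"
    and delta': "(1 + \<mu>1) * \<delta> \<le> \<delta>'" "\<delta>' \<le> 1" and card: "\<bar>real \<tau> - \<rho> * real n\<bar> \<le> \<delta>' * real n"
begin

lemma delta_le: "\<delta> \<le> \<delta>'" "0 \<le> \<delta>'"
proof -
  have "1 * \<delta> \<le> (1 + \<mu>1) * \<delta>" using mu(3) tolerance_nonneg by (intro mult_right_mono) auto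
  then show "\<delta> \<le> \<delta>'" using delta'(1) by simp
  then show "0 \<le> \<delta>'" using tolerance_nonneg by simp
qed

lemma near_ideal: "near_ideal_design p {1..\<tau>} {\<tau> + 1..n} (real n) \<rho> \<delta>' \<kappa> K y m1 m2 U"
proof
  have dn: "\<delta> * real k \<le> \<delta>' * real n" if "k \<le> n" for k
    using that tolerance_nonneg delta_le by (intro mult_mono) auto
  show "finite {1..\<tau>}" "finite {\<tau> + 1..n}" "{1..\<tau>} \<inter> {\<tau> + 1..n} = {}" by auto
  show "0 < real n" by (rule n_pos)
  show "0 < \<rho>" "\<rho> < 1" "0 \<le> \<delta>'" "\<delta>' \<le> 1" "0 < \<kappa>" "1 \<le> K" "1 \<le> p"
    using rho K delta' delta_le kappa p_pos by auto
  have "0 \<le> \<mu>1 / (1 - s)" "0 \<le> \<mu>2 / (1 - s)" using mu s by auto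
  then show "\<bar>m1 a\<bar> \<le> K" "\<bar>m2 a\<bar> \<le> K" for a using K by (auto simp: m1_def m2_def)
  show "m1 p = 1" "m2 p = 1" by (auto simp: m1_def m2_def)
  show "y k p = 1" for k by (simp add: regressor_index)
  show "\<bar>real (card {1..\<tau>}) - \<rho> * real n\<bar> \<le> \<delta>' * real n" using card by simp
  have "real (card {\<tau> + 1..n}) = real n - real \<tau>" using tau by (simp add: of_nat_diff)
  then have "real (card {\<tau> + 1..n}) - (1 - \<rho>) * real n = - (real \<tau> - \<rho> * real n)" by (simp add: algebra_simps)
  then show "\<bar>real (card {\<tau> + 1..n}) - (1 - \<rho>) * real n\<bar> \<le> \<delta>' * real n" using card by simp
  show "\<bar>\<Sum>k = 1..\<tau>. y k a - m1 a\<bar> \<le> \<delta>' * real n" if a: "a \<le> p" for a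
  proof -
    have "\<bar>\<Sum>k\<in>{0 + 1..\<tau>}. y k a - (if a < p then \<mu>1 / (1 - s) else 1)\<bar> \<le> \<delta> * real \<tau>"
      using win_before[of \<tau>] tau tolerance_nonneg by (intro regressor_window[OF a]) auto
    then show ?thesis using dn[of \<tau>] tau by (simp add: m1_def)
  qed
  show "\<bar>\<Sum>k = \<tau> + 1..n. y k a - m2 a\<bar> \<le> \<delta>' * real n" if a: "a \<le> p" for a
  proof -
    have "\<bar>\<Sum>k\<in>{\<tau> + 1..n}. y k a - (if a < p then \<mu>2 / (1 - s) else 1)\<bar> \<le> \<delta> * real (n - \<tau>)"
      using win_after[of "n - \<tau>"] tau tolerance_nonneg by (intro regressor_window[OF a]) (auto simp: of_nat_diff)
    then show ?thesis using dn[of "n - \<tau>"] tau by (simp add: m2_def)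
  qed
  have muT: "\<bar>\<mu>1 * (\<Sum>t\<in>{int p + 1..int \<tau> - int p}. T t)\<bar> \<le> \<mu>1 * (\<delta> * real n)"
    unfolding abs_mult using T_sum mu(3) by (intro mult_mono) auto
  show "\<kappa> * real n \<le> (\<Sum>k = 1..\<tau>. y k i * U i k)" if i: "i < p" for i
  proof -
    have "\<mu>1 * \<delta> * real n \<le> \<kappa> * real n" using kappa(1) by (intro mult_right_mono) auto
    then show ?thesis using dual_sum[OF i i] T_diag muT by simp
  qed
  show "\<bar>\<Sum>k = 1..\<tau>. y k i * U j k\<bar> \<le> \<delta>' * real n" if ij: "i < p" "j < p" "i \<noteq> j" for i j
  proof -
    have "\<bar>\<Sum>t\<in>{int p + 1..int \<tau> - int p}. T t * eps (t + (int j - int i))\<bar> \<le> \<delta> * real n" using ij by (intro T_off) auto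
    then have "\<bar>\<Sum>k = 1..\<tau>. y k i * U j k\<bar> \<le> (1 + \<mu>1) * \<delta> * real n"
      unfolding dual_sum[OF ij(1,2)] using muT by (simp add: algebra_simps)
    also have "\<dots> \<le> \<delta>' * real n" using delta'(1) by (intro mult_right_mono) auto
    finally show ?thesis .
  qed
  show "\<bar>\<Sum>k = 1..\<tau>. U j k\<bar> \<le> \<delta>' * real n" if j: "j < p" for j
  proof -
    have "\<bar>(1 - s) * (\<Sum>t\<in>{int p + 1..int \<tau> - int p}. T t)\<bar> \<le> 1 * (\<delta> * real n)"
      unfolding abs_mult using T_sum s_nonneg s(2) by (intro mult_mono) auto
    then show ?thesis unfolding U_sum[OF j] using dn[of n] by simp
  qed
  show "(\<Sum>k = 1..\<tau>. (U j k)\<^sup>2) \<le> 4 * real n" for j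
  proof -
    have "(U j k)\<^sup>2 \<le> 4" for k
    proof -
      have "\<bar>U j k\<bar>\<^sup>2 \<le> 2\<^sup>2" using U_le by (intro power_mono) auto
      then show ?thesis by simp
    qed
    then have "(\<Sum>k = 1..\<tau>. (U j k)\<^sup>2) \<le> (\<Sum>k = 1..\<tau>. 4)" by (intro sum_mono)
    also have "\<dots> \<le> 4 * real n" using tau by simp
    finally show ?thesis .
  qed
qed

interpretation near_ideal_design p "{1..\<tau>}" "{\<tau> + 1..n}" "real n" \<rho> \<delta>' \<kappa> K y m1 m2 U
  by (rule near_ideal)

lemma nat_split: "{1..\<tau>} \<union> {\<tau> + 1..n} = {1..n}" using tau by auto

lemma noise_regressor: "a \<le> p \<Longrightarrow> \<bar>\<Sum>k\<in>{1..\<tau>} \<union> {\<tau> + 1..n}. eps (int k) * y k a\<bar> \<le> \<delta>' * real n"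
proof (cases "a < p")
  case True
  have "(\<Sum>k = 1..n. eps (int k) * y k a) = (\<Sum>k = 1..n. real (x (int k - int (a + 1))) * eps (int k))"
    using True by (intro sum.cong refl) (simp add: regressor_index algebra_simps)
  also have "\<dots> = (\<Sum>t\<in>{1..int n}. real (x (t - int (a + 1))) * eps t)"
    by (rule sum_nat_int)
  also have "\<bar>\<dots>\<bar> \<le> \<delta> * real n" using True by (intro noise_lag) auto
  also have "\<dots> \<le> \<delta>' * real n" using delta_le by (intro mult_right_mono) auto
  finally show ?thesis unfolding nat_split .
next
  case False
  assume "a \<le> p"
  with False have a: "a = p" by simp
  have "(\<Sum>k = 1..n. eps (int k) * y k a) = (\<Sum>t\<in>{1..int n}. eps t)"
    using a sum_nat_int[of eps n] by (simp add: regressor_index)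
  also have "\<dots> = (\<Sum>t\<in>{int \<tau> - int \<tau> + 1..int \<tau>}. eps t) + (\<Sum>t\<in>{int \<tau> + 1..int \<tau> + int (n - \<tau>)}. eps t)"
  proof -
    have "{1..int n} = {int \<tau> - int \<tau> + 1..int \<tau>} \<union> {int \<tau> + 1..int \<tau> + int (n - \<tau>)}" using tau by auto
    then show ?thesis by (simp add: sum.union_disjoint)
  qed
  also have "\<bar>\<dots>\<bar> \<le> \<delta> * real \<tau> + \<delta> * real (n - \<tau>)"
    using noise_before[of \<tau>] noise_after[of "n - \<tau>"] tau by (intro order_trans[OF abs_triangle_ineq] add_mono) auto
  also have "\<dots> = \<delta> * real n" using tau by (simp add: of_nat_diff algebra_simps)
  also have "\<dots> \<le> \<delta>' * real n" using delta_le by (intro mult_right_mono) auto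
  finally show ?thesis unfolding nat_split .
qed

lemma residual_eq:
  assumes "\<theta> \<in> carrier_vec (p + 1)" and k: "k \<in> {1..n}"
  defines "u \<equiv> (\<lambda>a. (if a < p then \<alpha> (a + 1) else \<mu>1) - \<theta> $ a)"
  shows "residual p \<theta> x k = eps (int k) + lin u k - (if k \<le> \<tau> then 0 else \<mu>1 - \<mu>2)"
proof -
  have m: "\<mu> (int k) = (if k \<le> \<tau> then \<mu>1 else \<mu>2)" using k mu by auto
  have "(\<Sum>a\<le>p. (if a < p then \<alpha> (a + 1) else \<mu>1) * y k a) = (\<Sum>a<p. \<alpha> (a + 1) * real (x (int k - 1 - int a))) + \<mu>1"
    unfolding lessThan_Suc_atMost[symmetric] by (simp add: regressor_index)
  also have "(\<Sum>a<p. \<alpha> (a + 1) * real (x (int k - 1 - int a))) = (\<Sum>i = 1..p. \<alpha> i * real (x (int k - int i)))"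
    by (rule sum.reindex_bij_witness[where i = "\<lambda>i. i - 1" and j = Suc]) (auto simp: algebra_simps of_nat_diff)
  finally have "(\<Sum>a\<le>p. (if a < p then \<alpha> (a + 1) else \<mu>1) * y k a) = real (x (int k)) - eps (int k) - \<mu> (int k) + \<mu>1"
    by (simp add: noise_part_def)
  then have "lin u k = real (x (int k)) - eps (int k) - \<mu> (int k) + \<mu>1 - \<theta> \<bullet> regressor p x k"
    unfolding lin_def u_def scalar_prod_regressor by (simp add: left_diff_distrib sum_subtractf)
  then show ?thesis by (simp add: residual_def m)
qed

text \<open>
  The residual is noise plus a linear form in the regressors, and by \<open>normal_equations_drift\<close> the
  mean of that form is at least \<open>\<rho> c / 2\<close> before the change and at most \<open>- \<rho> c / 2\<close> after it. In windows of
  length at least \<open>R\<^sup>2\<close> the fluctuations are below \<open>\<delta> (1 + N0)\<close> per step and cannot compensate it.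
\<close>

lemma change_estimator_close:
  assumes Delta: "\<mu>1 > \<mu>2"
    and theta: "\<theta> \<in> carrier_vec (p + 1)"
    and inv: "\<And>B. B \<in> carrier_mat (p + 1) (p + 1) \<Longrightarrow> inverts_mat (design_matrix p n x) B \<Longrightarrow>
      inverts_mat B (design_matrix p n x) \<Longrightarrow> \<theta> = B *\<^sub>v response_vec p n x"
    and E_def: "E = 2 * (\<mu>1 - \<mu>2) * K + 1"
    and N0_def: "N0 = 2 * ((\<mu>1 - \<mu>2) * K + E) / min (\<kappa>\<^sup>2 / (16 * (1 + K)\<^sup>2 * (real p)\<^sup>2)) (\<rho> / 2)"
    and E2_def: "E2 = 4 * K * N0 + (\<mu>1 - \<mu>2) + 1"
    and E3_def: "E3 = 10 * K\<^sup>2 * N0\<^sup>2 + E * N0 + K * N0 * E2"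
    and kappa1: "\<kappa>1 = \<kappa>\<^sup>2 / (32 * K\<^sup>2 * (real p)\<^sup>2)"
    and c_def: "c = min ((\<mu>1 - \<mu>2) * (1 - \<rho>) / 4) (\<kappa>1 * (\<mu>1 - \<mu>2) / 4)"
    and small: "\<delta>' \<le> min (\<kappa>\<^sup>2 / (16 * (1 + K)\<^sup>2 * (real p)\<^sup>2)) (\<rho> / 2) / (20 * K\<^sup>2)" "\<delta>' * E2 \<le> (\<mu>1 - \<mu>2) * (1 - \<rho>) / 4"
      "\<delta>' * E2 \<le> \<rho> * c / 2" "\<delta>' * E3 < \<kappa>1 * (\<mu>1 - \<mu>2)\<^sup>2 / 8" "\<delta>' * (1 + N0) < \<rho> * c / 2"
    and R: "R \<ge> 1"
  shows "\<bar>real (change_estimator p n \<theta> x) - real \<tau>\<bar> < real (R\<^sup>2)"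
proof -
  define u where "u = (\<lambda>a. (if a < p then \<alpha> (a + 1) else \<mu>1) - \<theta> $ a)"
  define \<Delta> where "\<Delta> = \<mu>1 - \<mu>2"
  note small' = small[folded coercivity_def]
  have res: "residual p \<theta> x k = eps (int k) + lin u k - (if k \<le> \<tau> then 0 else \<Delta>)" if "k \<in> {1..n}" for k
    unfolding u_def \<Delta>_def by (rule residual_eq[OF theta that])
  have pos: "(\<Sum>k = 1..n. (\<Sum>a\<le>p. v a * y k a)\<^sup>2) > 0" if v: "\<exists>a\<le>p. v a \<noteq> 0" for v
  proof -
    have "size1 v > 0"
    proof -
      obtain a where a: "a \<le> p" "v a \<noteq> 0" using v by blast
      have "\<bar>v a\<bar> \<le> size1 v" unfolding size1_def using a by (intro member_le_sum) auto
      then show ?thesis using a by linarith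
    qed
    then have "0 < real n * (coercivity / 2 * (size1 v)\<^sup>2)" using coercivity_pos n_pos by simp
    then show ?thesis using coercive[OF small'(1), of v] unfolding nat_split lin_def by linarith
  qed
  have normal: "(\<Sum>k\<in>{1..\<tau>} \<union> {\<tau> + 1..n}. lin u k * y k a)
      = \<Delta> * (\<Sum>k\<in>{\<tau> + 1..n}. y k a) - (\<Sum>k\<in>{1..\<tau>} \<union> {\<tau> + 1..n}. eps (int k) * y k a)" if a: "a \<le> p" for a
  proof -
    have "0 = (\<Sum>k = 1..n. residual p \<theta> x k * y k a)" by (rule cls_normal_equations[OF theta inv pos a, symmetric])
    also have "\<dots> = (\<Sum>k = 1..n. eps (int k) * y k a + lin u k * y k a - (if k \<le> \<tau> then 0 else \<Delta>) * y k a)"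
      by (intro sum.cong refl) (simp add: res left_diff_distrib distrib_right)
    also have "\<dots> = (\<Sum>k = 1..n. eps (int k) * y k a) + (\<Sum>k = 1..n. lin u k * y k a) - (\<Sum>k = 1..n. (if k \<le> \<tau> then 0 else \<Delta>) * y k a)"
      by (simp add: sum.distrib sum_subtractf)
    also have "(\<Sum>k = 1..n. (if k \<le> \<tau> then 0 else \<Delta>) * y k a) = (\<Sum>k\<in>{\<tau> + 1..n}. (if k \<le> \<tau> then 0 else \<Delta>) * y k a)"
      using tau by (intro sum.mono_neutral_right) auto
    also have "\<dots> = \<Delta> * (\<Sum>k\<in>{\<tau> + 1..n}. y k a)" unfolding sum_distrib_left by (intro sum.cong) auto
    finally show ?thesis unfolding nat_split by linarith
  qed
  have "\<Delta> > 0" using Delta by (simp add: \<Delta>_def)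
  note drift = normal_equations_drift[OF this normal noise_regressor E_def[folded \<Delta>_def]
    N0_def[folded \<Delta>_def coercivity_def] E2_def[folded \<Delta>_def] E3_def kappa1 c_def[folded \<Delta>_def]
    small'(1) small'(2)[folded \<Delta>_def] small'(3) small'(4)[folded \<Delta>_def]]
  define g where "g = \<rho> * c / 2"
  have N: "size1 u \<le> N0" and a: "mean1 u \<ge> g" and b: "\<Delta> - mean2 u \<ge> g"
    unfolding g_def
    by (rule drift; assumption)+
  have N0: "0 \<le> N0" using N size1_nonneg[of u] by linarith
  have gap: "\<delta> * (1 + N0) < g"
    using mult_right_mono[OF delta_le(1), of "1 + N0"] N0 small(5) unfolding g_def by linarith
  have linw: "\<bar>\<Sum>k\<in>C. lin u k - (\<Sum>a\<le>p. u a * m a)\<bar> \<le> d * N0"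
    if d: "d \<ge> 0" and C: "\<And>a. a \<le> p \<Longrightarrow> \<bar>\<Sum>k\<in>C. y k a - m a\<bar> \<le> d" for C d m
  proof -
    have "(\<Sum>k\<in>C. lin u k - (\<Sum>a\<le>p. u a * m a)) = (\<Sum>k\<in>C. \<Sum>a\<le>p. u a * (y k a - m a))"
      by (simp add: lin_def sum_subtractf right_diff_distrib)
    also have "\<dots> = (\<Sum>a\<le>p. u a * (\<Sum>k\<in>C. y k a - m a))" by (subst sum.swap) (simp add: sum_distrib_left)
    also have "\<bar>\<dots>\<bar> \<le> d * size1 u" by (rule weighted_sum_le) (rule C)
    also have "\<dots> \<le> d * N0" using N d by (rule mult_left_mono)
    finally show ?thesis .
  qed
  have R2: "1 \<le> R\<^sup>2" using R by simp
  show ?thesis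
  proof (rule change_estimator_near)
    show "1 \<le> n" "\<tau> \<in> {1..n}" using tau by auto
  next
    fix k assume k: "k \<in> {1..n}" "k + R\<^sup>2 \<le> \<tau>"
    define h where "h = \<tau> - k"
    have h: "h \<in> {R\<^sup>2..\<tau>}" "k = \<tau> - h" "h \<ge> 1" "int k = int \<tau> - int h" using k R2 by (auto simp: h_def)
    have "(\<Sum>j = 1..\<tau>. residual p \<theta> x j) = (\<Sum>j = 1..k. residual p \<theta> x j) + (\<Sum>j\<in>{k + 1..\<tau>}. residual p \<theta> x j)"
    proof -
      have "{1..\<tau>} = {1..k} \<union> {k + 1..\<tau>}" using k by auto
      then show ?thesis by (simp add: sum.union_disjoint)
    qed
    moreover have "(\<Sum>j\<in>{k + 1..\<tau>}. residual p \<theta> x j) = (\<Sum>j\<in>{k + 1..\<tau>}. eps (int j)) + (\<Sum>j\<in>{k + 1..\<tau>}. lin u j - mean1 u) + real h * mean1 u"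
    proof -
      have "(\<Sum>j\<in>{k + 1..\<tau>}. residual p \<theta> x j) = (\<Sum>j\<in>{k + 1..\<tau>}. eps (int j) + (lin u j - mean1 u) + mean1 u)"
        using res k tau by (intro sum.cong) auto
      also have "\<dots> = (\<Sum>j\<in>{k + 1..\<tau>}. eps (int j)) + (\<Sum>j\<in>{k + 1..\<tau>}. lin u j - mean1 u) + (\<Sum>j\<in>{k + 1..\<tau>}. mean1 u)"
        by (simp only: sum.distrib)
      also have "(\<Sum>j\<in>{k + 1..\<tau>}. mean1 u) = real h * mean1 u" using k by (simp add: h_def)
      finally show ?thesis .
    qed
    moreover have "\<bar>\<Sum>j\<in>{k + 1..\<tau>}. eps (int j)\<bar> \<le> \<delta> * real h"
      using noise_before[OF h(1)] sum_nat_int'[of eps k \<tau>] h(4) by simp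
    moreover have "\<bar>\<Sum>j\<in>{k + 1..\<tau>}. lin u j - mean1 u\<bar> \<le> (\<delta> * real h) * N0"
      unfolding mean1_def
    proof (rule linw)
      show "0 \<le> \<delta> * real h" using tolerance_nonneg by simp
      fix a assume "a \<le> p"
      then show "\<bar>\<Sum>j\<in>{k + 1..\<tau>}. y j a - m1 a\<bar> \<le> \<delta> * real h"
        unfolding m1_def using win_before[OF h(1)] tolerance_nonneg h(4) by (intro regressor_window) auto
    qed
    moreover have "real h * mean1 u \<ge> real h * g" using a by (intro mult_left_mono) auto
    moreover have "real h * (\<delta> * (1 + N0)) < real h * g" using gap h(3) by (intro mult_strict_left_mono) auto
    ultimately show "(\<Sum>j = 1..k. residual p \<theta> x j) < (\<Sum>j = 1..\<tau>. residual p \<theta> x j)"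
      by (simp add: algebra_simps)
  next
    fix k assume k: "k \<in> {1..n}" "\<tau> + R\<^sup>2 \<le> k"
    define h where "h = k - \<tau>"
    have h: "h \<in> {R\<^sup>2..n - \<tau>}" "k = \<tau> + h" "h \<ge> 1" "int k = int \<tau> + int h" using k R2 by (auto simp: h_def)
    have "(\<Sum>j = 1..k. residual p \<theta> x j) = (\<Sum>j = 1..\<tau>. residual p \<theta> x j) + (\<Sum>j\<in>{\<tau> + 1..k}. residual p \<theta> x j)"
    proof -
      have "{1..k} = {1..\<tau>} \<union> {\<tau> + 1..k}" using k by auto
      then show ?thesis by (simp add: sum.union_disjoint)
    qed
    moreover have "(\<Sum>j\<in>{\<tau> + 1..k}. residual p \<theta> x j) = (\<Sum>j\<in>{\<tau> + 1..k}. eps (int j)) + (\<Sum>j\<in>{\<tau> + 1..k}. lin u j - mean2 u) + real h * (mean2 u - \<Delta>)"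
    proof -
      have "(\<Sum>j\<in>{\<tau> + 1..k}. residual p \<theta> x j) = (\<Sum>j\<in>{\<tau> + 1..k}. eps (int j) + (lin u j - mean2 u) + (mean2 u - \<Delta>))"
        using res k tau by (intro sum.cong) auto
      also have "\<dots> = (\<Sum>j\<in>{\<tau> + 1..k}. eps (int j)) + (\<Sum>j\<in>{\<tau> + 1..k}. lin u j - mean2 u) + (\<Sum>j\<in>{\<tau> + 1..k}. (mean2 u - \<Delta>))"
        by (simp only: sum.distrib)
      also have "(\<Sum>j\<in>{\<tau> + 1..k}. (mean2 u - \<Delta>)) = real h * (mean2 u - \<Delta>)" using k by (simp add: h_def)
      finally show ?thesis .
    qed
    moreover have "\<bar>\<Sum>j\<in>{\<tau> + 1..k}. eps (int j)\<bar> \<le> \<delta> * real h"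
      using noise_after[OF h(1)] sum_nat_int'[of eps \<tau> k] h(4) by simp
    moreover have "\<bar>\<Sum>j\<in>{\<tau> + 1..k}. lin u j - mean2 u\<bar> \<le> (\<delta> * real h) * N0"
      unfolding mean2_def
    proof (rule linw)
      show "0 \<le> \<delta> * real h" using tolerance_nonneg by simp
      fix a assume "a \<le> p"
      then show "\<bar>\<Sum>j\<in>{\<tau> + 1..k}. y j a - m2 a\<bar> \<le> \<delta> * real h"
        unfolding m2_def using win_after[OF h(1)] tolerance_nonneg h(4) by (intro regressor_window) auto
    qed
    moreover have "real h * (mean2 u - \<Delta>) \<le> real h * (- g)" using b by (intro mult_left_mono) auto
    moreover have "real h * (\<delta> * (1 + N0)) < real h * g" using gap h(3) by (intro mult_strict_left_mono) auto
    ultimately show "(\<Sum>j = 1..k. residual p \<theta> x j) < (\<Sum>j = 1..\<tau>. residual p \<theta> x j)"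
      by (simp add: algebra_simps)
  qed
qed

end
end

section \<open>Orthogonal sums and a weak law uniform over windows\<close>

context prob_space
begin

lemma integrable_product:
  fixes f g :: "'a \<Rightarrow> real"
  assumes "f \<in> borel_measurable M" "g \<in> borel_measurable M"
    and "integrable M (\<lambda>x. (f x)\<^sup>2)" "integrable M (\<lambda>x. (g x)\<^sup>2)"
  shows "integrable M (\<lambda>x. f x * g x)"
proof (rule Bochner_Integration.integrable_bound)
  show "integrable M (\<lambda>x. (f x)\<^sup>2 + (g x)\<^sup>2)" using assms by simp
  show "(\<lambda>x. f x * g x) \<in> borel_measurable M" using assms by simp
  have "\<bar>f x * g x\<bar> \<le> (f x)\<^sup>2 + (g x)\<^sup>2" for x
  proof -
    have "2 * (\<bar>f x\<bar> * \<bar>g x\<bar>) \<le> (f x)\<^sup>2 + (g x)\<^sup>2"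
      using sum_squares_bound[of "\<bar>f x\<bar>" "\<bar>g x\<bar>"] by (simp only: power2_abs mult.assoc)
    moreover have "0 \<le> \<bar>f x\<bar> * \<bar>g x\<bar>" by simp
    ultimately show ?thesis unfolding abs_mult by linarith
  qed
  then show "AE x in M. norm (f x * g x) \<le> norm ((f x)\<^sup>2 + (g x)\<^sup>2)" by (intro AE_I2) simp
qed

lemma integrable_square_sum:
  fixes D :: "'i \<Rightarrow> 'a \<Rightarrow> real"
  assumes "finite I" "\<And>i. i \<in> I \<Longrightarrow> D i \<in> borel_measurable M"
    "\<And>i. i \<in> I \<Longrightarrow> integrable M (\<lambda>x. (D i x)\<^sup>2)"
  shows "integrable M (\<lambda>x. (\<Sum>i\<in>I. D i x)\<^sup>2)"
  unfolding power2_eq_square sum_product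
  using assms by (intro Bochner_Integration.integrable_sum integrable_product) auto

lemma orthogonal_sum_square:
  fixes D :: "'i \<Rightarrow> 'a \<Rightarrow> real"
  assumes fin: "finite I" and meas: "\<And>i. i \<in> I \<Longrightarrow> D i \<in> borel_measurable M"
    and sq: "\<And>i. i \<in> I \<Longrightarrow> integrable M (\<lambda>x. (D i x)\<^sup>2)"
    and bound: "\<And>i. i \<in> I \<Longrightarrow> expectation (\<lambda>x. (D i x)\<^sup>2) \<le> C"
    and orth: "\<And>i j. i \<in> I \<Longrightarrow> j \<in> I \<Longrightarrow> i \<noteq> j \<Longrightarrow> expectation (\<lambda>x. D i x * D j x) = 0"
  shows "expectation (\<lambda>x. (\<Sum>i\<in>I. D i x)\<^sup>2) \<le> C * real (card I)"
proof -
  have int: "integrable M (\<lambda>x. D i x * D j x)" if "i \<in> I" "j \<in> I" for i j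
    using that meas sq by (intro integrable_product) auto
  have "expectation (\<lambda>x. (\<Sum>i\<in>I. D i x)\<^sup>2) = (\<Sum>i\<in>I. \<Sum>j\<in>I. expectation (\<lambda>x. D i x * D j x))"
    unfolding power2_eq_square sum_product
    using int by (simp add: Bochner_Integration.integral_sum Bochner_Integration.integrable_sum)
  also have "\<dots> = (\<Sum>i\<in>I. \<Sum>j\<in>I. if j = i then expectation (\<lambda>x. (D i x)\<^sup>2) else 0)"
    using orth by (intro sum.cong refl) (auto simp: power2_eq_square)
  also have "\<dots> = (\<Sum>i\<in>I. expectation (\<lambda>x. (D i x)\<^sup>2))" using fin by simp
  also have "\<dots> \<le> (\<Sum>i\<in>I. C)" using bound by (rule sum_mono)
  finally show ?thesis by (simp add: mult.commute)
qed

lemma square_tail: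
  fixes f :: "'a \<Rightarrow> real"
  assumes [measurable]: "f \<in> borel_measurable M" and "integrable M (\<lambda>x. (f x)\<^sup>2)"
    and "expectation (\<lambda>x. (f x)\<^sup>2) \<le> C" and a: "a > 0"
  shows "prob {x \<in> space M. \<bar>f x\<bar> > a} \<le> C / a\<^sup>2"
proof -
  have "prob {x \<in> space M. \<bar>f x\<bar> > a} \<le> prob {x \<in> space M. (f x)\<^sup>2 \<ge> a\<^sup>2}"
    using a by (intro finite_measure_mono) (auto simp: abs_le_square_iff[symmetric])
  also have "\<dots> \<le> expectation (\<lambda>x. (f x)\<^sup>2) / a\<^sup>2"
    using assms by (intro integral_Markov_inequality_measure[where A = "{}", simplified]) auto
  also have "\<dots> \<le> C / a\<^sup>2" using assms by (intro divide_right_mono) auto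
  finally show ?thesis .
qed

lemma prob_UN_le:
  assumes "finite I" "\<And>i. i \<in> I \<Longrightarrow> A i \<in> events" "\<And>i. i \<in> I \<Longrightarrow> prob (A i) \<le> b i"
  shows "prob (\<Union>i\<in>I. A i) \<le> (\<Sum>i\<in>I. b i)"
proof -
  have "prob (\<Union>i\<in>I. A i) \<le> (\<Sum>i\<in>I. prob (A i))"
    using assms by (intro finite_measure_subadditive_finite) auto
  also have "\<dots> \<le> (\<Sum>i\<in>I. b i)" using assms by (intro sum_mono) auto
  finally show ?thesis .
qed

lemma sum_square_expectation_le:
  fixes Z :: "nat \<Rightarrow> 'a \<Rightarrow> real"
  assumes fin: "finite I" and meas: "\<And>i. i \<in> I \<Longrightarrow> Z i \<in> borel_measurable M"
    and sq: "\<And>i. i \<in> I \<Longrightarrow> integrable M (\<lambda>x. (Z i x)\<^sup>2)"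
    and bound: "\<And>i. i \<in> I \<Longrightarrow> expectation (\<lambda>x. (Z i x)\<^sup>2) \<le> C"
  shows "expectation (\<lambda>x. (\<Sum>i\<in>I. \<bar>Z i x\<bar>)\<^sup>2) \<le> C * (real (card I))\<^sup>2"
proof -
  have [measurable]: "Z i \<in> borel_measurable M" if "i \<in> I" for i by (rule meas[OF that])
  have "expectation (\<lambda>x. (\<Sum>i\<in>I. \<bar>Z i x\<bar>)\<^sup>2) \<le> expectation (\<lambda>x. real (card I) * (\<Sum>i\<in>I. (Z i x)\<^sup>2))"
  proof (rule integral_mono)
    show "integrable M (\<lambda>x. (\<Sum>i\<in>I. \<bar>Z i x\<bar>)\<^sup>2)"
      using fin meas sq by (intro integrable_square_sum) auto
    show "integrable M (\<lambda>x. real (card I) * (\<Sum>i\<in>I. (Z i x)\<^sup>2))" using sq by simp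
    show "(\<Sum>i\<in>I. \<bar>Z i x\<bar>)\<^sup>2 \<le> real (card I) * (\<Sum>i\<in>I. (Z i x)\<^sup>2)" for x
      using Cauchy_Schwarz_ineq_sum[of "\<lambda>_. 1" "\<lambda>i. \<bar>Z i x\<bar>" I] by simp
  qed
  also have "\<dots> = real (card I) * (\<Sum>i\<in>I. expectation (\<lambda>x. (Z i x)\<^sup>2))"
    using sq by (simp add: Bochner_Integration.integral_sum)
  also have "\<dots> \<le> real (card I) * (\<Sum>i\<in>I. C)" using bound by (intro mult_left_mono sum_mono) auto
  finally show ?thesis by (simp add: power2_eq_square mult_ac)
qed

lemma inverse_square_tail: "(\<Sum>r=R..m. 1 / (real r)\<^sup>2) \<le> 2 / real R" if R: "R \<ge> 1" for R m :: nat
proof (cases "R \<le> m")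
  case True
  then have "(\<Sum>r=R..m. 1 / (real r)\<^sup>2) \<le> 2 / real R - 1 / real m"
  proof (induction m rule: dec_induct)
    case base
    have "1 / (real R)\<^sup>2 \<le> 1 / real R" using R by (intro divide_left_mono) (auto simp: power2_eq_square)
    then show ?case using R by (simp add: field_simps)
  next
    case (step m)
    have "1 / (real (Suc m))\<^sup>2 \<le> 1 / (real m * real (Suc m))"
      using step R by (intro divide_left_mono) (auto simp: power2_eq_square)
    also have "\<dots> = 1 / real m - 1 / real (Suc m)" using step R by (simp add: field_simps)
    finally show ?case using step by simp
  qed
  moreover have "1 / real m \<ge> 0" by simp
  ultimately show ?thesis by linarith
qed (use R in simp)

text \<open>
  Between consecutive squares \<open>r\<^sup>2\<close> and \<open>(r + 1)\<^sup>2\<close> a partial sum changes by at most the sum \<open>T r\<close> of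
  \<open>2 r\<close> absolute values, whose second moment is of order \<open>r\<^sup>2\<close>, just as that of the partial sum at
  \<open>r\<^sup>2\<close>. Chebyshev's inequality at scale \<open>\<delta> r\<^sup>2\<close> therefore gives probabilities of order \<open>1 / r\<^sup>2\<close>, which
  are summable over \<open>r \<ge> R\<close>. Only second moments of sums enter, so \<open>Z\<close> may also enumerate
  variables backwards in time, where maximal inequalities for martingales do not apply.
\<close>

lemma uniform_weak_law:
  fixes Z :: "nat \<Rightarrow> 'a \<Rightarrow> real"
  assumes meas: "\<And>j. j \<in> {1..N} \<Longrightarrow> Z j \<in> borel_measurable M"
    and sq: "\<And>j. j \<in> {1..N} \<Longrightarrow> integrable M (\<lambda>x. (Z j x)\<^sup>2)"
    and single: "\<And>j. j \<in> {1..N} \<Longrightarrow> expectation (\<lambda>x. (Z j x)\<^sup>2) \<le> C"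
    and partial: "\<And>m. m \<in> {1..N} \<Longrightarrow> expectation (\<lambda>x. (\<Sum>j=1..m. Z j x)\<^sup>2) \<le> C * real m"
    and delta: "\<delta> > 0" and R: "R \<ge> 1" and C: "C \<ge> 0"
  shows "prob {x \<in> space M. \<exists>m\<in>{R\<^sup>2..N}. \<bar>\<Sum>j=1..m. Z j x\<bar> > \<delta> * real m} \<le> 40 * C / (\<delta>\<^sup>2 * real R)"
proof -
  have [measurable]: "Z j \<in> borel_measurable M" if "j \<in> {1..N}" for j by (rule meas[OF that])
  define W where "W = (\<lambda>r. {r\<^sup>2<..min N (r\<^sup>2 + 2 * r)})"
  define S where "S = (\<lambda>r x. \<Sum>j=1..r\<^sup>2. Z j x)"
  define T where "T = (\<lambda>r x. \<Sum>j\<in>W r. \<bar>Z j x\<bar>)"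
  define I where "I = {r\<in>{R..N}. r\<^sup>2 \<le> N}"
  define B where "B = (\<lambda>r. {x \<in> space M. \<bar>S r x\<bar> > \<delta> * (real r)\<^sup>2 / 2} \<union> {x \<in> space M. \<bar>T r x\<bar> > \<delta> * (real r)\<^sup>2 / 2})"
  have W: "W r \<subseteq> {1..N}" "finite (W r)" "card (W r) \<le> 2 * r" for r by (auto simp: W_def)
  have Tm: "T r \<in> borel_measurable M" for r
    unfolding T_def using W(1)[of r] by (intro borel_measurable_sum borel_measurable_abs meas) auto
  have Sm: "S r \<in> borel_measurable M" if "r \<in> I" for r
    unfolding S_def using that by (intro borel_measurable_sum meas) (auto simp: I_def)
  have Bm: "B r \<in> events" if "r \<in> I" for r
    unfolding B_def using borel_measurable_abs[OF Tm[of r]] borel_measurable_abs[OF Sm[OF that]]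
    by (intro sets.Un borel_measurable_less borel_measurable_const)
  have Bp: "prob (B r) \<le> 20 * C / \<delta>\<^sup>2 * (1 / (real r)\<^sup>2)" if r: "r \<in> I" for r
  proof -
    have r1: "r \<ge> 1" "r\<^sup>2 \<le> N" "r\<^sup>2 \<ge> 1" using r R by (auto simp: I_def)
    have a: "\<delta> * (real r)\<^sup>2 / 2 > 0" using delta r1 by simp
    have "expectation (\<lambda>x. (S r x)\<^sup>2) \<le> C * real (r\<^sup>2)"
      unfolding S_def using r1 by (intro partial) auto
    then have 1: "prob {x \<in> space M. \<bar>S r x\<bar> > \<delta> * (real r)\<^sup>2 / 2} \<le> C * real (r\<^sup>2) / (\<delta> * (real r)\<^sup>2 / 2)\<^sup>2"
      using r1 a Sm[OF r] by (intro square_tail) (auto simp: S_def intro!: integrable_square_sum meas sq)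
    have "expectation (\<lambda>x. (T r x)\<^sup>2) \<le> C * (real (card (W r)))\<^sup>2"
      unfolding T_def using W[of r] by (intro sum_square_expectation_le meas sq single) auto
    also have "\<dots> \<le> C * (real (2 * r))\<^sup>2" using W(3)[of r] C by (intro mult_left_mono power_mono) auto
    finally have 2: "prob {x \<in> space M. \<bar>T r x\<bar> > \<delta> * (real r)\<^sup>2 / 2} \<le> C * (real (2 * r))\<^sup>2 / (\<delta> * (real r)\<^sup>2 / 2)\<^sup>2"
      using r1 a Tm[of r] W(2)[of r]
      by (intro square_tail)
        (auto simp: T_def intro!: integrable_square_sum borel_measurable_abs meas[OF subsetD[OF W(1)]] sq[OF subsetD[OF W(1)]])
    have "prob (B r) \<le> C * real (r\<^sup>2) / (\<delta> * (real r)\<^sup>2 / 2)\<^sup>2 + C * (real (2 * r))\<^sup>2 / (\<delta> * (real r)\<^sup>2 / 2)\<^sup>2"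
      unfolding B_def using 1 2 Tm[of r] Sm[OF r]
      by (intro order_trans[OF measure_Un_le]) auto
    also have "\<dots> = 20 * C / \<delta>\<^sup>2 * (1 / (real r)\<^sup>2)"
      using r1 delta by (simp add: field_simps power2_eq_square)
    finally show ?thesis .
  qed
  have sub: "{x \<in> space M. \<exists>m\<in>{R\<^sup>2..N}. \<bar>\<Sum>j=1..m. Z j x\<bar> > \<delta> * real m} \<subseteq> (\<Union>r\<in>I. B r)"
  proof safe
    fix x m assume x: "x \<in> space M" and m: "m \<in> {R\<^sup>2..N}" and big: "\<bar>\<Sum>j=1..m. Z j x\<bar> > \<delta> * real m"
    define r where "r = floor_sqrt m"
    have r: "r\<^sup>2 \<le> m" "m < (Suc r)\<^sup>2" by (auto simp: r_def floor_sqrt_power2_le Suc_floor_sqrt_power2_gt)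
    have rR: "R \<le> r" using m by (simp add: r_def le_floor_sqrt_iff)
    have "r \<le> r\<^sup>2" by (simp add: power2_eq_square)
    then have rI: "r \<in> I" using r(1) m rR by (simp add: I_def)
    have sp: "{1..m} = {1..r\<^sup>2} \<union> {r\<^sup>2<..m}" using r by auto
    have sum_sp: "(\<Sum>j=1..m. Z j x) = S r x + (\<Sum>j\<in>{r\<^sup>2<..m}. Z j x)"
      unfolding S_def by (subst sp, rule sum.union_disjoint) auto
    have "\<bar>\<Sum>j\<in>{r\<^sup>2<..m}. Z j x\<bar> \<le> (\<Sum>j\<in>{r\<^sup>2<..m}. \<bar>Z j x\<bar>)" by (rule sum_abs)
    also have "\<dots> \<le> T r x" unfolding T_def using r(2) m W(2)
      by (intro sum_mono2) (auto simp: W_def power2_eq_square)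
    finally have "\<bar>\<Sum>j=1..m. Z j x\<bar> \<le> \<bar>S r x\<bar> + \<bar>T r x\<bar>" unfolding sum_sp by linarith
    moreover have "\<delta> * (real r)\<^sup>2 \<le> \<delta> * real m" using r(1) delta
      by (metis mult_le_cancel_left_pos of_nat_le_iff of_nat_power)
    ultimately have "x \<in> B r" using big x by (auto simp: B_def)
    with rI show "x \<in> (\<Union>r\<in>I. B r)" by auto
  qed
  have "prob {x \<in> space M. \<exists>m\<in>{R\<^sup>2..N}. \<bar>\<Sum>j=1..m. Z j x\<bar> > \<delta> * real m} \<le> prob (\<Union>r\<in>I. B r)"
    using sub Bm by (intro finite_measure_mono sets.finite_UN) (auto simp: I_def)
  also have "\<dots> \<le> (\<Sum>r\<in>I. 20 * C / \<delta>\<^sup>2 * (1 / (real r)\<^sup>2))"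
    using Bm Bp by (intro prob_UN_le) (auto simp: I_def)
  also have "\<dots> \<le> (\<Sum>r=R..N. 20 * C / \<delta>\<^sup>2 * (1 / (real r)\<^sup>2))"
    using C by (intro sum_mono2) (auto simp: I_def)
  also have "\<dots> \<le> 20 * C / \<delta>\<^sup>2 * (2 / real R)"
    unfolding sum_distrib_left[symmetric] using C inverse_square_tail[OF R] by (intro mult_left_mono) auto
  finally show ?thesis by simp
qed

end

section \<open>The past and the noise of the current step\<close>

lemma sets_vimage_algebra_factor:
  assumes "h \<in> measurable N N'" "f \<in> X \<rightarrow> space N" "\<And>x. x \<in> X \<Longrightarrow> g x = h (f x)"
  shows "sets (vimage_algebra X g N') \<subseteq> sets (vimage_algebra X f N)"
proof (rule sets_image_in_sets)
  have "(\<lambda>x. h (f x)) \<in> measurable (vimage_algebra X f N) N'"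
    by (rule measurable_compose[OF measurable_vimage_algebra1[OF assms(2)] assms(1)])
  then show "g \<in> measurable (vimage_algebra X f N) N'"
    by (rule measurable_cong[THEN iffD1, rotated]) (simp add: assms(3))
qed simp

context INAR_innovation_change
begin

definition init :: "'a \<Rightarrow> int \<Rightarrow> nat" where
  "init \<omega> = (\<lambda>k\<in>{1 - int p..0}. X k \<omega>)"

abbreviation init_space :: "(int \<Rightarrow> nat) measure" where
  "init_space \<equiv> (\<Pi>\<^sub>M k\<in>{1 - int p..0}. count_space UNIV)"

abbreviation noise_space :: "noise_index set \<Rightarrow> (noise_index \<Rightarrow> nat) measure" where
  "noise_space J \<equiv> (\<Pi>\<^sub>M s\<in>J. count_space UNIV)"

text \<open>
  The noise variables with index in \<open>J\<close> as one random element. Its values lie in the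
  product space that appears in the independence assumption on the initial values.
\<close>

definition noises :: "noise_index set \<Rightarrow> 'a \<Rightarrow> noise_index \<Rightarrow> nat" where
  "noises J \<omega> = (\<lambda>s\<in>J. noise \<xi> \<epsilon> s \<omega>)"

definition noise_at :: "int \<Rightarrow> noise_index set" where
  "noise_at t = noise_indices p (nat t) - noise_indices p (nat (t - 1))"

text \<open>
  Everything determined by the initial values and by the noise up to time \<open>t\<close>. The generator
  consists of intersections because independence is first checked on a system stable under
  intersection.
\<close>

definition past :: "int \<Rightarrow> 'a measure" where
  "past t = sigma (space M) {A \<inter> B |A B. A \<in> sets (vimage_algebra (space M) init init_space) \<and>
      B \<in> sets (vimage_algebra (space M) (noises (noise_indices p (nat t))) (noise_space (noise_indices p (nat t))))}"

lemma noise_indices_mono: "a \<le> b \<Longrightarrow> noise_indices p a \<subseteq> noise_indices p b"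
  by (auto simp: noise_indices_def)

lemma noise_at_eq:
  "1 \<le> t \<Longrightarrow> noise_at t = insert (Innovation (nat t)) {Thinning i (nat t) j |i j. i \<in> {1..p} \<and> j \<ge> 1}"
  by (auto simp: noise_at_def noise_indices_def)

lemma noise_at_subset: "t \<le> int n \<Longrightarrow> noise_at t \<subseteq> noise_indices p n"
  unfolding noise_at_def using noise_indices_mono[of "nat t" n] by (auto simp: nat_le_iff)

lemma noise_measurable: "s \<in> noise_indices p n \<Longrightarrow> noise \<xi> \<epsilon> s \<in> measurable M (count_space UNIV)"
  using noise_indep by (auto simp: indep_vars_def)

lemma init_measurable: "init \<in> measurable M init_space"
  unfolding init_def by (rule measurable_restrict) (rule initial_measurable)

lemma noises_measurable: "J \<subseteq> noise_indices p n \<Longrightarrow> noises J \<in> measurable M (noise_space J)"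
  unfolding noises_def by (rule measurable_restrict) (rule noise_measurable, blast)

lemma sets_noises_mono:
  assumes "I \<subseteq> J"
  shows "sets (vimage_algebra (space M) (noises I) (noise_space I)) \<subseteq> sets (vimage_algebra (space M) (noises J) (noise_space J))"
proof (rule sets_vimage_algebra_factor)
  show "(\<lambda>v. restrict v I) \<in> measurable (noise_space J) (noise_space I)"
    using assms by (rule measurable_restrict_subset)
  show "noises J \<in> space M \<rightarrow> space (noise_space J)" by (auto simp: noises_def space_PiM)
  show "noises I \<omega> = restrict (noises J \<omega>) I" for \<omega>
    using assms by (auto simp: noises_def restrict_def fun_eq_iff)
qed

lemma generator_subset:
  "{A \<inter> B |A B. A \<in> sets (vimage_algebra (space M) init init_space) \<and>
      B \<in> sets (vimage_algebra (space M) (noises J) (noise_space J))} \<subseteq> Pow (space M)"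
  using sets.sets_into_space[of _ "vimage_algebra (space M) init init_space"] by auto

lemma space_past [simp]: "space (past t) = space M"
  unfolding past_def using generator_subset by (rule space_measure_of)

lemma sets_past: "sets (past t) = sigma_sets (space M) {A \<inter> B |A B. A \<in> sets (vimage_algebra (space M) init init_space) \<and>
      B \<in> sets (vimage_algebra (space M) (noises (noise_indices p (nat t))) (noise_space (noise_indices p (nat t))))}"
  unfolding past_def using generator_subset by (rule sets_measure_of)

lemma sets_init_past: "sets (vimage_algebra (space M) init init_space) \<subseteq> sets (past t)"
proof
  fix A assume A: "A \<in> sets (vimage_algebra (space M) init init_space)"
  let ?N = "vimage_algebra (space M) (noises (noise_indices p (nat t))) (noise_space (noise_indices p (nat t)))"
  have "A \<inter> space M = A" using sets.sets_into_space[OF A] by auto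
  moreover have "space M \<in> sets ?N" using sets.top[of ?N] by simp
  ultimately show "A \<in> sets (past t)" unfolding sets_past using A by (intro sigma_sets.Basic) blast
qed

lemma sets_noises_past: "sets (vimage_algebra (space M) (noises (noise_indices p (nat t))) (noise_space (noise_indices p (nat t)))) \<subseteq> sets (past t)"
proof
  let ?N = "vimage_algebra (space M) (noises (noise_indices p (nat t))) (noise_space (noise_indices p (nat t)))"
  let ?I = "vimage_algebra (space M) init init_space"
  fix A assume A: "A \<in> sets ?N"
  have "space M \<inter> A = A" using sets.sets_into_space[OF A] by auto
  moreover have "space M \<in> sets ?I" using sets.top[of ?I] by simp
  ultimately show "A \<in> sets (past t)" unfolding sets_past using A by (intro sigma_sets.Basic) blast
qed

lemma past_mono: assumes "s \<le> t" shows "sets (past s) \<subseteq> sets (past t)"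
  unfolding sets_past
proof (rule sigma_sets_subseteq)
  have "noise_indices p (nat s) \<subseteq> noise_indices p (nat t)" using assms by (intro noise_indices_mono) simp
  from sets_noises_mono[OF this]
  show "{A \<inter> B |A B. A \<in> sets (vimage_algebra (space M) init init_space) \<and>
      B \<in> sets (vimage_algebra (space M) (noises (noise_indices p (nat s))) (noise_space (noise_indices p (nat s))))}
    \<subseteq> {A \<inter> B |A B. A \<in> sets (vimage_algebra (space M) init init_space) \<and>
      B \<in> sets (vimage_algebra (space M) (noises (noise_indices p (nat t))) (noise_space (noise_indices p (nat t))))}"
    by blast
qed

lemma sets_past_events: assumes "t \<le> int n" shows "sets (past t) \<subseteq> events"
  unfolding sets_past
proof (rule sets.sigma_sets_subset, safe)
  fix A B assume A: "A \<in> sets (vimage_algebra (space M) init init_space)"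
    and B: "B \<in> sets (vimage_algebra (space M) (noises (noise_indices p (nat t))) (noise_space (noise_indices p (nat t))))"
  have "noise_indices p (nat t) \<subseteq> noise_indices p n" using assms by (intro noise_indices_mono) simp
  then have "B \<in> events" using B sets_image_in_sets[OF refl noises_measurable] by blast
  moreover have "A \<in> events" using A sets_image_in_sets[OF refl init_measurable] by blast
  ultimately show "A \<inter> B \<in> events" by auto
qed

lemma measurable_past_mono:
  "f \<in> measurable (past s) N \<Longrightarrow> s \<le> t \<Longrightarrow> f \<in> measurable (past t) N"
  using past_mono[of s t] by (auto simp: measurable_def)

lemma measurable_past_events:
  "f \<in> measurable (past t) N \<Longrightarrow> t \<le> int n \<Longrightarrow> f \<in> measurable M N"
  using sets_past_events[of t] by (auto simp: measurable_def)

lemma noise_past: 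
  assumes "s \<in> noise_indices p (nat t)" shows "noise \<xi> \<epsilon> s \<in> measurable (past t) (count_space UNIV)"
proof -
  let ?J = "noise_indices p (nat t)"
  have "noises ?J \<in> measurable (vimage_algebra (space M) (noises ?J) (noise_space ?J)) (noise_space ?J)"
    by (rule measurable_vimage_algebra1) (auto simp: noises_def space_PiM)
  from measurable_compose[OF this measurable_component_singleton[OF assms]]
  have "(\<lambda>\<omega>. noises ?J \<omega> s) \<in> measurable (vimage_algebra (space M) (noises ?J) (noise_space ?J)) (count_space UNIV)" .
  then have "noise \<xi> \<epsilon> s \<in> measurable (vimage_algebra (space M) (noises ?J) (noise_space ?J)) (count_space UNIV)"
    using assms by (simp add: noises_def)
  then show ?thesis using sets_noises_past[of t] by (auto simp: measurable_def)
qed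

lemma noise_at_past: "s \<in> noise_at t \<Longrightarrow> noise \<xi> \<epsilon> s \<in> measurable (past t) (count_space UNIV)"
  by (rule noise_past) (simp add: noise_at_def)

lemma init_past:
  assumes "k \<in> {1 - int p..0}" shows "X k \<in> measurable (past t) (count_space UNIV)"
proof -
  have "init \<in> measurable (vimage_algebra (space M) init init_space) init_space"
    by (rule measurable_vimage_algebra1) (auto simp: init_def space_PiM)
  from measurable_compose[OF this measurable_component_singleton[OF assms]]
  have "(\<lambda>\<omega>. init \<omega> k) \<in> measurable (vimage_algebra (space M) init init_space) (count_space UNIV)" .
  then have "X k \<in> measurable (vimage_algebra (space M) init init_space) (count_space UNIV)"
    using assms by (simp add: init_def)
  then show ?thesis using sets_init_past[of t] by (auto simp: measurable_def)
qed

lemma random_sum_measurable: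
  fixes f :: "nat \<Rightarrow> 'b \<Rightarrow> 'c::{second_countable_topology, topological_comm_monoid_add}"
  assumes "N \<in> measurable Q (count_space UNIV)" "\<And>j. j \<ge> 1 \<Longrightarrow> f j \<in> borel_measurable Q"
  shows "(\<lambda>z. \<Sum>j = 1..N z. f j z) \<in> borel_measurable Q"
  by (rule measurable_compose_countable[where f = "\<lambda>m z. \<Sum>j = 1..m. f j z" and g = N])
    (use assms in \<open>auto intro!: borel_measurable_sum\<close>)

text \<open>
  Induction along the recursion; a sum with a random number of terms is measurable because the
  number takes countably many values.
\<close>

lemma X_past:
  assumes "1 - int p \<le> k" "k \<le> t" "t \<le> int n"
  shows "X k \<in> measurable (past t) (count_space UNIV)"
  using assms
proof (induction "nat (k + int p)" arbitrary: k t rule: less_induct)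
  case less
  show ?case
  proof (cases "k \<le> 0")
    case True then show ?thesis using less by (intro init_past) auto
  next
    case False
    then have k: "1 \<le> k" "k \<le> int n" using less by auto
    have "(\<lambda>\<omega>. (\<Sum>i = 1..p. \<Sum>j = 1..X (k - int i) \<omega>. real (\<xi> i (nat k) j \<omega>)) + real (\<epsilon> (nat k) \<omega>)) \<in> borel_measurable (past k)"
    proof (intro borel_measurable_add borel_measurable_sum random_sum_measurable)
      fix i assume i: "i \<in> {1..p}"
      show "X (k - int i) \<in> measurable (past k) (count_space UNIV)"
        using i k less.prems by (intro less.hyps) auto
      fix j :: nat assume j: "j \<ge> 1"
      have "noise \<xi> \<epsilon> (Thinning i (nat k) j) \<in> measurable (past k) (count_space UNIV)"
        using i j k by (intro noise_past) (auto simp: noise_indices_def)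
      then show "(\<lambda>\<omega>. real (\<xi> i (nat k) j \<omega>)) \<in> borel_measurable (past k)" by simp
    next
      have "noise \<xi> \<epsilon> (Innovation (nat k)) \<in> measurable (past k) (count_space UNIV)"
        using k by (intro noise_past) (auto simp: noise_indices_def)
      then show "(\<lambda>\<omega>. real (\<epsilon> (nat k) \<omega>)) \<in> borel_measurable (past k)" by simp
    qed
    moreover have "real (X k \<omega>) = (\<Sum>i = 1..p. \<Sum>j = 1..X (k - int i) \<omega>. real (\<xi> i (nat k) j \<omega>)) + real (\<epsilon> (nat k) \<omega>)"
      if "\<omega> \<in> space M" for \<omega>
    proof -
      have "nat k \<in> {1..n}" using k by (simp add: nat_le_iff le_nat_iff)
      from recursion[OF this that] show ?thesis using k by simp
    qed
    ultimately have "(\<lambda>\<omega>. real (X k \<omega>)) \<in> borel_measurable (past k)"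
      by (subst measurable_cong) auto
    from measurable_compose[OF measurable_compose[OF this measurable_real_floor], of nat "count_space UNIV"]
    have "X k \<in> measurable (past k) (count_space UNIV)" by simp
    then show ?thesis by (rule measurable_past_mono) (use less.prems in auto)
  qed
qed

text \<open>
  For \<open>A\<close> generated by the initial values, \<open>B\<close> by the earlier noise and \<open>C\<close> by the noise of step \<open>t\<close>,
  the probability of \<open>A \<inter> B \<inter> C\<close> factors in two steps: first \<open>A\<close> splits off, since \<open>B \<inter> C\<close> is a
  noise event, then \<open>B\<close> and \<open>C\<close> separate. Sets of the form \<open>A \<inter> B\<close> generate the past.
\<close>

lemma indep_past_noise:
  assumes t: "1 \<le> t" "t \<le> int n"
  shows "indep_set (sets (past (t - 1))) (sets (vimage_algebra (space M) (noises (noise_at t)) (noise_space (noise_at t))))"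
proof -
  define J where "J = noise_indices p (nat (t - 1))"
  define AI where "AI = sets (vimage_algebra (space M) init init_space)"
  define AJ where "AJ = sets (vimage_algebra (space M) (noises J) (noise_space J))"
  define AT where "AT = sets (vimage_algebra (space M) (noises (noise_at t)) (noise_space (noise_at t)))"
  define AN where "AN = sets (vimage_algebra (space M) (noises (noise_indices p n)) (noise_space (noise_indices p n)))"
  have J: "J \<subseteq> noise_indices p n" "noise_at t \<subseteq> noise_indices p n" "J \<inter> noise_at t = {}"
    using t noise_indices_mono[of "nat (t - 1)" n] noise_at_subset[of t] by (auto simp: J_def noise_at_def)
  have sub: "AJ \<subseteq> AN" "AT \<subseteq> AN" unfolding AJ_def AT_def AN_def by (rule sets_noises_mono[OF J(1)], rule sets_noises_mono[OF J(2)])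
  have ev: "AI \<subseteq> events" "AN \<subseteq> events"
    unfolding AI_def AN_def
    by (rule sets_image_in_sets[OF refl init_measurable], rule sets_image_in_sets[OF refl noises_measurable[OF order_refl]])
  have ind1: "prob (a \<inter> b) = prob a * prob b" if "a \<in> AI" "b \<in> AN" for a b
    using indep_setD[OF initial_indep_noise, of a b] that unfolding AI_def AN_def init_def[abs_def] noises_def[abs_def] by simp
  have "indep_var (noise_space J) (noises J) (noise_space (noise_at t)) (noises (noise_at t))"
    using indep_var_restrict[OF noise_indep J(3) J(1) J(2)] unfolding noises_def[abs_def] by simp
  then have "indep_set AJ AT"
    unfolding indep_var_eq AJ_def AT_def sets_vimage_algebra by blast
  then have ind2: "prob (a \<inter> b) = prob a * prob b" if "a \<in> AJ" "b \<in> AT" for a b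
    using indep_setD that by blast
  let ?G = "{A \<inter> B |A B. A \<in> AI \<and> B \<in> AJ}"
  have stab: "Int_stable ?G"
  proof (rule Int_stableI)
    fix a b assume "a \<in> ?G" "b \<in> ?G"
    then obtain A B A' B' where ab: "a = A \<inter> B" "b = A' \<inter> B'" "A \<in> AI" "B \<in> AJ" "A' \<in> AI" "B' \<in> AJ" by blast
    then have "a \<inter> b = (A \<inter> A') \<inter> (B \<inter> B')" "A \<inter> A' \<in> AI" "B \<inter> B' \<in> AJ" by (auto simp: AI_def AJ_def)
    then show "a \<inter> b \<in> ?G" by blast
  qed
  have "indep_set ?G AT"
    unfolding indep_sets2_eq
  proof safe
    fix A B x assume "A \<in> AI" "B \<in> AJ"
    then show "A \<inter> B \<in> events" using ev sub by blast
  next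
    fix x assume "x \<in> AT" then show "x \<in> events" using ev sub by blast
  next
    fix A B C assume *: "A \<in> AI" "B \<in> AJ" "C \<in> AT"
    have "B \<inter> C \<in> AN" "B \<in> AN" using * sub by (auto simp: AN_def)
    have "prob (A \<inter> B \<inter> C) = prob (A \<inter> (B \<inter> C))" by (simp add: Int_assoc)
    also have "\<dots> = prob A * (prob B * prob C)"
      using ind1[OF *(1) \<open>B \<inter> C \<in> AN\<close>] ind2[OF *(2,3)] by simp
    also have "\<dots> = prob (A \<inter> B) * prob C" using ind1[OF *(1) \<open>B \<in> AN\<close>] by simp
    finally show "prob (A \<inter> B \<inter> C) = prob (A \<inter> B) * prob C" .
  qed
  then have "indep_set (sigma_sets (space M) ?G) (sigma_sets (space M) AT)"
    by (rule indep_set_sigma_sets[OF _ stab]) (auto simp: AT_def intro: sets.Int_stable)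
  moreover have "sigma_sets (space M) AT = AT"
    unfolding AT_def by (metis sets.sigma_sets_eq space_vimage_algebra)
  moreover have "sigma_sets (space M) ?G = sets (past (t - 1))"
    unfolding sets_past AI_def AJ_def J_def ..
  ultimately show ?thesis by (simp add: AT_def)
qed

text \<open>
  Independence in the form needed for Fubini: the joint law of a past variable \<open>Y\<close> and the noise of
  step \<open>t\<close> is a product measure. The two components take values in different types, which is why the
  statement is about laws.
\<close>

lemma past_noise_product:
  assumes t: "1 \<le> t" "t \<le> int n" and Y: "Y \<in> measurable (past (t - 1)) S"
  shows "Y \<in> measurable M S" "noises (noise_at t) \<in> measurable M (noise_space (noise_at t))"
    and "distr M S Y \<Otimes>\<^sub>M distr M (noise_space (noise_at t)) (noises (noise_at t))
      = distr M (S \<Otimes>\<^sub>M noise_space (noise_at t)) (\<lambda>x. (Y x, noises (noise_at t) x))"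
proof -
  let ?V = "noises (noise_at t)" and ?T = "noise_space (noise_at t)"
  show Ym[measurable]: "Y \<in> measurable M S" using Y by (rule measurable_past_events) (use t in auto)
  show Vm[measurable]: "?V \<in> measurable M ?T" using t by (intro noises_measurable noise_at_subset)
  interpret C: prob_space "distr M S Y" by (rule prob_space_distr) measurable
  interpret D: prob_space "distr M ?T ?V" by (rule prob_space_distr) measurable
  show "distr M S Y \<Otimes>\<^sub>M distr M ?T ?V = distr M (S \<Otimes>\<^sub>M ?T) (\<lambda>x. (Y x, ?V x))"
  proof (rule pair_measure_eqI)
    show "sigma_finite_measure (distr M S Y)" "sigma_finite_measure (distr M ?T ?V)" ..
    show "sets (distr M S Y \<Otimes>\<^sub>M distr M ?T ?V) = sets (distr M (S \<Otimes>\<^sub>M ?T) (\<lambda>x. (Y x, ?V x)))"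
      by (simp cong: sets_pair_measure_cong)
    fix A B assume "A \<in> sets (distr M S Y)" "B \<in> sets (distr M ?T ?V)"
    then have [measurable]: "A \<in> sets S" "B \<in> sets ?T" by auto
    have 1: "Y -` A \<inter> space M \<in> sets (past (t - 1))" using measurable_sets[OF Y, of A] by simp
    have 2: "?V -` B \<inter> space M \<in> sets (vimage_algebra (space M) ?V ?T)" by (rule in_vimage_algebra) measurable
    have "(\<lambda>x. (Y x, ?V x)) -` (A \<times> B) \<inter> space M = (Y -` A \<inter> space M) \<inter> (?V -` B \<inter> space M)" by auto
    moreover have "prob ((Y -` A \<inter> space M) \<inter> (?V -` B \<inter> space M)) = prob (Y -` A \<inter> space M) * prob (?V -` B \<inter> space M)"
      by (rule indep_setD[OF indep_past_noise[OF t] 1 2])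
    ultimately show "emeasure (distr M S Y) A * emeasure (distr M ?T ?V) B
        = emeasure (distr M (S \<Otimes>\<^sub>M ?T) (\<lambda>x. (Y x, ?V x))) (A \<times> B)"
      by (simp add: emeasure_distr emeasure_eq_measure ennreal_mult)
  qed
qed

lemma past_integral_nonneg:
  assumes t: "1 \<le> t" "t \<le> int n" and Y: "Y \<in> measurable (past (t - 1)) S"
    and g[measurable]: "g \<in> borel_measurable (S \<Otimes>\<^sub>M noise_space (noise_at t))"
  shows "(\<integral>\<^sup>+\<omega>. g (Y \<omega>, noises (noise_at t) \<omega>) \<partial>M) = (\<integral>\<^sup>+\<omega>. (\<integral>\<^sup>+\<omega>'. g (Y \<omega>, noises (noise_at t) \<omega>') \<partial>M) \<partial>M)"
proof -
  let ?V = "noises (noise_at t)" and ?T = "noise_space (noise_at t)"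
  note iv = past_noise_product[OF t Y]
  note [measurable] = iv(1,2)
  interpret D: prob_space "distr M ?T ?V" by (rule prob_space_distr) measurable
  have "(\<integral>\<^sup>+\<omega>. g (Y \<omega>, ?V \<omega>) \<partial>M) = (\<integral>\<^sup>+z. g z \<partial>(distr M S Y \<Otimes>\<^sub>M distr M ?T ?V))"
    unfolding iv(3) by (subst nn_integral_distr) auto
  also have "\<dots> = (\<integral>\<^sup>+y. (\<integral>\<^sup>+v. g (y, v) \<partial>distr M ?T ?V) \<partial>distr M S Y)"
    by (subst D.nn_integral_fst[symmetric]) auto
  also have "\<dots> = (\<integral>\<^sup>+\<omega>. (\<integral>\<^sup>+v. g (Y \<omega>, v) \<partial>distr M ?T ?V) \<partial>M)"
    by (subst nn_integral_distr) auto
  also have "\<dots> = (\<integral>\<^sup>+\<omega>. (\<integral>\<^sup>+\<omega>'. g (Y \<omega>, ?V \<omega>') \<partial>M) \<partial>M)"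
    by (intro nn_integral_cong, subst nn_integral_distr)
      (auto intro: measurable_compose[OF measurable_Pair1' g] dest: measurable_space[OF iv(1)])
  finally show ?thesis .
qed

text \<open>
  A variable whose conditional expectation given the past vanishes has expectation zero. The
  conditional expectation is the integral over the noise with the past value \<open>y\<close> held fixed.
\<close>

lemma past_integral_zero:
  fixes g :: "_ \<Rightarrow> real"
  assumes t: "1 \<le> t" "t \<le> int n" and Y: "Y \<in> measurable (past (t - 1)) S"
    and g[measurable]: "g \<in> borel_measurable (S \<Otimes>\<^sub>M noise_space (noise_at t))"
    and int: "integrable M (\<lambda>\<omega>. g (Y \<omega>, noises (noise_at t) \<omega>))"
    and zero: "\<And>y. y \<in> space S \<Longrightarrow> expectation (\<lambda>\<omega>. g (y, noises (noise_at t) \<omega>)) = 0"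
  shows "expectation (\<lambda>\<omega>. g (Y \<omega>, noises (noise_at t) \<omega>)) = 0"
proof -
  let ?V = "noises (noise_at t)" and ?T = "noise_space (noise_at t)"
  note iv = past_noise_product[OF t Y]
  note [measurable] = iv(1,2)
  interpret C: prob_space "distr M S Y" by (rule prob_space_distr) measurable
  interpret D: prob_space "distr M ?T ?V" by (rule prob_space_distr) measurable
  interpret P: pair_sigma_finite "distr M S Y" "distr M ?T ?V" ..
  have int': "integrable (distr M S Y \<Otimes>\<^sub>M distr M ?T ?V) g"
    unfolding iv(3) by (subst integrable_distr_eq) (use int in auto)
  have "expectation (\<lambda>\<omega>. g (Y \<omega>, ?V \<omega>)) = (\<integral>z. g z \<partial>(distr M S Y \<Otimes>\<^sub>M distr M ?T ?V))"
    unfolding iv(3) by (subst integral_distr) auto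
  also have "\<dots> = (\<integral>y. (\<integral>v. g (y, v) \<partial>distr M ?T ?V) \<partial>distr M S Y)"
    using P.integral_fst'[OF int'] by simp
  also have "\<dots> = (\<integral>y. 0 \<partial>distr M S Y)"
  proof (rule Bochner_Integration.integral_cong)
    fix y assume "y \<in> space (distr M S Y)"
    then have y: "y \<in> space S" by simp
    then have "(\<integral>v. g (y, v) \<partial>distr M ?T ?V) = expectation (\<lambda>\<omega>. g (y, ?V \<omega>))"
      by (intro integral_distr measurable_compose[OF measurable_Pair1' g]) auto
    then show "(\<integral>v. g (y, v) \<partial>distr M ?T ?V) = 0" using zero[OF y] by simp
  qed simp
  finally show ?thesis by simp
qed

end

section \<open>Conditional moments of one step\<close>

context INAR_innovation_change
begin

primrec law :: "noise_index \<Rightarrow> nat pmf" where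
  "law (Innovation k) = (if k \<le> \<tau> then \<nu>1 else \<nu>2)"
| "law (Thinning i k j) = map_pmf of_bool (bernoulli_pmf (\<alpha> i))"

definition mean :: "noise_index \<Rightarrow> real" where
  "mean s = measure_pmf.expectation (law s) real"

definition noise_bound :: real where
  "noise_bound = 1 + measure_pmf.expectation \<nu>1 (\<lambda>x. (real x)\<^sup>2) + measure_pmf.expectation \<nu>2 (\<lambda>x. (real x)\<^sup>2)"

lemma noise_bound_ge_1: "noise_bound \<ge> 1"
  by (simp add: noise_bound_def)

lemma noise_law: "s \<in> noise_indices p n \<Longrightarrow> distr M (count_space UNIV) (noise \<xi> \<epsilon> s) = measure_pmf (law s)"
  by (cases s) (auto simp: noise_indices_def innovation_law_before innovation_law_after thinning_law)

lemma law_thinning: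
  assumes "i \<in> {1..p}"
  shows "finite (set_pmf (law (Thinning i k j)))" "mean (Thinning i k j) = \<alpha> i"
    "measure_pmf.expectation (law (Thinning i k j)) (\<lambda>x. (real x)\<^sup>2) = \<alpha> i"
    "measure_pmf.prob (law (Thinning i k j)) {0<..} = \<alpha> i"
proof -
  show "finite (set_pmf (law (Thinning i k j)))" by simp
  have *: "measure_pmf.expectation (law (Thinning i k j)) f = \<alpha> i * f 1 + (1 - \<alpha> i) * f 0" for f :: "nat \<Rightarrow> real"
    using coeff[OF assms] by (simp add: integral_bernoulli_pmf)
  show "mean (Thinning i k j) = \<alpha> i" unfolding mean_def * by simp
  show "measure_pmf.expectation (law (Thinning i k j)) (\<lambda>x. (real x)\<^sup>2) = \<alpha> i" unfolding * by simp
  have "measure_pmf.prob (law (Thinning i k j)) {0<..} = measure_pmf.expectation (law (Thinning i k j)) (indicator {0<..})"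
    by simp
  also have "\<dots> = \<alpha> i" unfolding * by simp
  finally show "measure_pmf.prob (law (Thinning i k j)) {0<..} = \<alpha> i" .
qed

lemma law_square:
  assumes "s \<in> noise_indices p n"
  shows "integrable (law s) (\<lambda>x. (real x)\<^sup>2)" "measure_pmf.expectation (law s) (\<lambda>x. (real x)\<^sup>2) \<le> noise_bound"
proof -
  have nn: "measure_pmf.expectation \<nu> (\<lambda>x. (real x)\<^sup>2) \<ge> 0" for \<nu> :: "nat pmf" by simp
  show "integrable (law s) (\<lambda>x. (real x)\<^sup>2)"
    using assms innovation_square_integrable law_thinning(1)
    by (cases s) (auto intro: integrable_measure_pmf_finite)
  show "measure_pmf.expectation (law s) (\<lambda>x. (real x)\<^sup>2) \<le> noise_bound"
  proof (cases s)
    case (Innovation k)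
    then show ?thesis using nn[of \<nu>1] nn[of \<nu>2] by (simp add: noise_bound_def)
  next
    case (Thinning i k j)
    then have i: "i \<in> {1..p}" using assms by (auto simp: noise_indices_def)
    show ?thesis using law_thinning(3)[OF i, of k j] coeff[OF i] noise_bound_ge_1 unfolding Thinning by simp
  qed
qed

lemma law_integrable: "s \<in> noise_indices p n \<Longrightarrow> integrable (law s) real"
  by (rule measure_pmf.square_integrable_imp_integrable[OF _ law_square(1)]) auto

lemma noise_integral:
  fixes f :: "nat \<Rightarrow> real"
  assumes "s \<in> noise_indices p n"
  shows "integrable M (\<lambda>\<omega>. f (noise \<xi> \<epsilon> s \<omega>)) \<longleftrightarrow> integrable (law s) f"
    "expectation (\<lambda>\<omega>. f (noise \<xi> \<epsilon> s \<omega>)) = measure_pmf.expectation (law s) f"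
proof -
  have "integrable (distr M (count_space UNIV) (noise \<xi> \<epsilon> s)) f \<longleftrightarrow> integrable M (\<lambda>\<omega>. f (noise \<xi> \<epsilon> s \<omega>))"
    by (rule integrable_distr_eq) (use noise_measurable[OF assms] in auto)
  then show "integrable M (\<lambda>\<omega>. f (noise \<xi> \<epsilon> s \<omega>)) \<longleftrightarrow> integrable (law s) f" by (simp add: noise_law[OF assms])
  have "integral\<^sup>L (distr M (count_space UNIV) (noise \<xi> \<epsilon> s)) f = expectation (\<lambda>\<omega>. f (noise \<xi> \<epsilon> s \<omega>))"
    by (rule integral_distr) (use noise_measurable[OF assms] in auto)
  then show "expectation (\<lambda>\<omega>. f (noise \<xi> \<epsilon> s \<omega>)) = measure_pmf.expectation (law s) f" by (simp add: noise_law[OF assms])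
qed

lemma noise_product:
  fixes f g :: "nat \<Rightarrow> real"
  assumes s: "s \<in> noise_indices p n" "s' \<in> noise_indices p n" "s \<noteq> s'"
    and int: "integrable (law s) f" "integrable (law s') g"
  shows "integrable M (\<lambda>\<omega>. f (noise \<xi> \<epsilon> s \<omega>) * g (noise \<xi> \<epsilon> s' \<omega>))"
    "expectation (\<lambda>\<omega>. f (noise \<xi> \<epsilon> s \<omega>) * g (noise \<xi> \<epsilon> s' \<omega>))
      = measure_pmf.expectation (law s) f * measure_pmf.expectation (law s') g"
proof -
  have 1: "indep_var (Pi\<^sub>M {s} (\<lambda>_. count_space UNIV)) (\<lambda>\<omega>. \<lambda>i\<in>{s}. noise \<xi> \<epsilon> i \<omega>)
    (Pi\<^sub>M {s'} (\<lambda>_. count_space UNIV)) (\<lambda>\<omega>. \<lambda>i\<in>{s'}. noise \<xi> \<epsilon> i \<omega>)"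
    using s by (intro indep_var_restrict[OF noise_indep]) auto
  have m: "(\<lambda>v. h (v s)) \<in> measurable (Pi\<^sub>M {s} (\<lambda>_. count_space UNIV)) borel" for h :: "nat \<Rightarrow> real" and s :: noise_index
    by (rule measurable_compose[OF measurable_component_singleton]) auto
  have "indep_var borel (\<lambda>\<omega>. f (noise \<xi> \<epsilon> s \<omega>)) borel (\<lambda>\<omega>. g (noise \<xi> \<epsilon> s' \<omega>))"
    using indep_var_compose[OF 1 m[of f s] m[of g s']] by (simp add: comp_def)
  then show "integrable M (\<lambda>\<omega>. f (noise \<xi> \<epsilon> s \<omega>) * g (noise \<xi> \<epsilon> s' \<omega>))"
    "expectation (\<lambda>\<omega>. f (noise \<xi> \<epsilon> s \<omega>) * g (noise \<xi> \<epsilon> s' \<omega>))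
      = measure_pmf.expectation (law s) f * measure_pmf.expectation (law s') g"
    using int s by (simp_all add: indep_var_lebesgue_integral indep_var_integrable noise_integral)
qed

definition centred :: "noise_index \<Rightarrow> nat \<Rightarrow> real" where
  "centred s x = real x - mean s"

text \<open>
  A centred indicator of the event that the noise variable \<open>s\<close> exceeds \<open>q\<close>. It is the bounded
  substitute for the variable itself, correlated with it through \<open>kappa\<close>.
\<close>

definition hit :: "noise_index \<Rightarrow> nat \<Rightarrow> nat \<Rightarrow> real" where
  "hit s q x = of_bool (x > q) - measure_pmf.prob (law s) {q<..}"

definition kappa :: "noise_index \<Rightarrow> nat \<Rightarrow> real" where
  "kappa s q = measure_pmf.expectation (law s) (\<lambda>x. hit s q x * centred s x)"

lemma centred_moments:
  assumes "s \<in> noise_indices p n"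
  shows "integrable (law s) (centred s)" "measure_pmf.expectation (law s) (centred s) = 0"
    "integrable (law s) (\<lambda>x. (centred s x)\<^sup>2)" "measure_pmf.expectation (law s) (\<lambda>x. (centred s x)\<^sup>2) \<le> noise_bound"
proof -
  note [simp] = law_integrable[OF assms] law_square(1)[OF assms]
  show "integrable (law s) (centred s)" unfolding centred_def by simp
  show "measure_pmf.expectation (law s) (centred s) = 0" unfolding centred_def by (simp add: mean_def)
  have sq: "(centred s x)\<^sup>2 = (real x)\<^sup>2 - 2 * mean s * real x + (mean s)\<^sup>2" for x
    by (simp add: centred_def power2_eq_square algebra_simps)
  show "integrable (law s) (\<lambda>x. (centred s x)\<^sup>2)" unfolding sq by simp
  have "measure_pmf.expectation (law s) (\<lambda>x. (centred s x)\<^sup>2) = measure_pmf.expectation (law s) (\<lambda>x. (real x)\<^sup>2) - (mean s)\<^sup>2"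
  proof -
    have "measure_pmf.expectation (law s) (\<lambda>x. (centred s x)\<^sup>2) =
      measure_pmf.expectation (law s) (\<lambda>x. (real x)\<^sup>2) - 2 * mean s * measure_pmf.expectation (law s) real + (mean s)\<^sup>2"
      unfolding sq by simp
    then show ?thesis by (simp add: mean_def[symmetric] power2_eq_square)
  qed
  also have "\<dots> \<le> measure_pmf.expectation (law s) (\<lambda>x. (real x)\<^sup>2)" by simp
  also have "\<dots> \<le> noise_bound" by (rule law_square(2)[OF assms])
  finally show "measure_pmf.expectation (law s) (\<lambda>x. (centred s x)\<^sup>2) \<le> noise_bound" .
qed

lemma hit_le_1: "\<bar>hit s q x\<bar> \<le> 1"
  unfolding hit_def of_bool_def
  using measure_pmf.prob_le_1[of "law s" "{q<..}"] measure_nonneg[of "law s" "{q<..}"] by (auto simp del: measure_nonneg)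

lemma hit_moments:
  "integrable (law s) (hit s q)" "measure_pmf.expectation (law s) (hit s q) = 0"
proof -
  show "integrable (law s) (hit s q)"
    by (rule measure_pmf.integrable_const_bound[where B = 1]) (auto simp: hit_le_1)
  have "hit s q = (\<lambda>x. indicator {q<..} x - measure_pmf.prob (law s) {q<..})"
    by (auto simp: hit_def indicator_def fun_eq_iff)
  moreover have "integrable (law s) (indicator {q<..} :: nat \<Rightarrow> real)"
    by (rule measure_pmf.integrable_const_bound[where B = 1]) (auto simp: indicator_def)
  ultimately show "measure_pmf.expectation (law s) (hit s q) = 0" by simp
qed

lemma hit_centred_integrable:
  assumes "s \<in> noise_indices p n" shows "integrable (law s) (\<lambda>x. hit s q x * centred s x)"
  by (rule Bochner_Integration.integrable_bound[OF centred_moments(1)[OF assms]])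
    (use hit_le_1[of s q] in \<open>auto simp: abs_mult mult_left_le_one_le\<close>)

text \<open>
  Since \<open>hit\<close> is centred, \<open>kappa\<close> is also its integral against \<open>x - (q + 1/2)\<close>. Both factors have
  the same sign; the first has absolute value \<open>P\<close> or \<open>1 - P\<close> with \<open>P\<close> the probability of a hit, and the
  second at least 1/2.
\<close>

lemma kappa_ge:
  assumes s: "s \<in> noise_indices p n"
  shows "kappa s q \<ge> min (measure_pmf.prob (law s) {q<..}) (1 - measure_pmf.prob (law s) {q<..}) / 2"
proof -
  define P where "P = measure_pmf.prob (law s) {q<..}"
  define d where "d = real q + 1/2 - mean s"
  have P: "0 \<le> P" "P \<le> 1" by (auto simp: P_def)
  have int: "integrable (law s) (\<lambda>x. hit s q x * (centred s x - d))"
    using hit_centred_integrable[OF s, of q] hit_moments(1)[of s q] by (simp add: right_diff_distrib)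
  have "min P (1 - P) / 2 = measure_pmf.expectation (law s) (\<lambda>_. min P (1 - P) / 2)" by (simp add: measure_pmf.prob_space)
  also have "\<dots> \<le> measure_pmf.expectation (law s) (\<lambda>x. hit s q x * (centred s x - d))"
  proof (rule integral_mono[OF _ int])
    fix x
    show "min P (1 - P) / 2 \<le> hit s q x * (centred s x - d)"
    proof (cases "x > q")
      case True
      then have "(1 - P) * (1/2) \<le> (1 - P) * (real x - (real q + 1/2))" using P by (intro mult_left_mono) auto
      moreover have "hit s q x * (centred s x - d) = (1 - P) * (real x - (real q + 1/2))"
        using True by (simp add: hit_def P_def[symmetric] centred_def d_def)
      moreover have "min P (1 - P) / 2 \<le> (1 - P) * (1/2)" by simp
      ultimately show ?thesis by (metis order_trans)
    next
      case False
      then have "P * (1/2) \<le> P * ((real q + 1/2) - real x)" using P by (intro mult_left_mono) auto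
      moreover have "hit s q x * (centred s x - d) = P * ((real q + 1/2) - real x)"
        using False by (simp add: hit_def P_def[symmetric] centred_def d_def algebra_simps)
      moreover have "min P (1 - P) / 2 \<le> P * (1/2)" by simp
      ultimately show ?thesis by (metis order_trans)
    qed
  qed simp
  also have "\<dots> = kappa s q"
    using hit_centred_integrable[OF s, of q] hit_moments[of s q]
    by (simp add: right_diff_distrib kappa_def)
  finally show ?thesis by (simp add: P_def)
qed

text \<open>
  The noise variables that enter step \<open>t\<close> when the lagged values are \<open>x 1, \<dots>, x p\<close>. With these values
  fixed, the martingale difference of the step is a finite sum of independent centred variables.
\<close>

definition active :: "int \<Rightarrow> (nat \<Rightarrow> nat) \<Rightarrow> noise_index set" where
  "active t x = insert (Innovation (nat t)) ((\<lambda>(i, j). Thinning i (nat t) j) ` (SIGMA i:{1..p}. {1..x i}))"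

definition incr :: "int \<Rightarrow> (nat \<Rightarrow> nat) \<Rightarrow> (noise_index \<Rightarrow> nat) \<Rightarrow> real" where
  "incr t x v = (\<Sum>s\<in>active t x. centred s (v s))"

lemma sum_active:
  fixes f :: "noise_index \<Rightarrow> real"
  shows "(\<Sum>s\<in>active t x. f s) = f (Innovation (nat t)) + (\<Sum>i = 1..p. \<Sum>j = 1..x i. f (Thinning i (nat t) j))"
proof -
  have inj: "inj_on (\<lambda>(i, j). Thinning i (nat t) j) (SIGMA i:{1..p}. {1..x i})" by (auto simp: inj_on_def)
  have "(\<Sum>s\<in>active t x. f s) = f (Innovation (nat t)) + (\<Sum>z\<in>(SIGMA i:{1..p}. {1..x i}). f ((\<lambda>(i, j). Thinning i (nat t) j) z))"
    unfolding active_def sum.reindex[OF inj, of f, unfolded comp_def, symmetric]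
    by (rule sum.insert) auto
  then show ?thesis by (simp add: sum.Sigma case_prod_beta)
qed

lemma finite_active: "finite (active t x)"
  by (simp add: active_def)

lemma card_active: "real (card (active t x)) = 1 + (\<Sum>i = 1..p. real (x i))"
  using sum_active[of "\<lambda>_. 1" t x] by simp

lemma active_noise_at: "1 \<le> t \<Longrightarrow> active t x \<subseteq> noise_at t"
  by (auto simp: active_def noise_at_eq)

lemma incr_moments:
  assumes t: "1 \<le> t" "t \<le> int n"
  shows "expectation (\<lambda>\<omega>. incr t x (noises (noise_at t) \<omega>)) = 0"
    "integrable M (\<lambda>\<omega>. (incr t x (noises (noise_at t) \<omega>))\<^sup>2)"
    "expectation (\<lambda>\<omega>. (incr t x (noises (noise_at t) \<omega>))\<^sup>2) \<le> noise_bound * (1 + (\<Sum>i = 1..p. real (x i)))"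
proof -
  have sub: "s \<in> noise_indices p n" if "s \<in> active t x" for s
    using that active_noise_at[OF t(1)] noise_at_subset[OF t(2)] by blast
  have eq: "incr t x (noises (noise_at t) \<omega>) = (\<Sum>s\<in>active t x. centred s (noise \<xi> \<epsilon> s \<omega>))" for \<omega>
    unfolding incr_def noises_def using active_noise_at[OF t(1)] by (intro sum.cong) auto
  have m: "(\<lambda>\<omega>. centred s (noise \<xi> \<epsilon> s \<omega>)) \<in> borel_measurable M" if "s \<in> active t x" for s
    by (rule measurable_compose[OF noise_measurable[OF sub[OF that]]]) simp
  show "expectation (\<lambda>\<omega>. incr t x (noises (noise_at t) \<omega>)) = 0"
    unfolding eq using sub by (simp add: Bochner_Integration.integral_sum noise_integral centred_moments)
  show "integrable M (\<lambda>\<omega>. (incr t x (noises (noise_at t) \<omega>))\<^sup>2)"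
    unfolding eq using sub m finite_active
    by (intro integrable_square_sum) (auto simp: noise_integral(1)[where f = "\<lambda>x. (centred s x)\<^sup>2" for s] centred_moments)
  have "expectation (\<lambda>\<omega>. (incr t x (noises (noise_at t) \<omega>))\<^sup>2) \<le> noise_bound * real (card (active t x))"
    unfolding eq using sub m finite_active
    by (intro orthogonal_sum_square) (auto simp: noise_integral[where f = "\<lambda>x. (centred s x)\<^sup>2" for s] centred_moments noise_product)
  then show "expectation (\<lambda>\<omega>. (incr t x (noises (noise_at t) \<omega>))\<^sup>2) \<le> noise_bound * (1 + (\<Sum>i = 1..p. real (x i)))"
    unfolding card_active .
qed

lemma hit_incr:
  assumes t: "1 \<le> t" "t \<le> int n" and s: "s \<in> active t x"
  shows "expectation (\<lambda>\<omega>. hit s q (noise \<xi> \<epsilon> s \<omega>) * incr t x (noises (noise_at t) \<omega>)) = kappa s q"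
proof -
  have sub: "s \<in> noise_indices p n" if "s \<in> active t x" for s
    using that active_noise_at[OF t(1)] noise_at_subset[OF t(2)] by blast
  have eq: "incr t x (noises (noise_at t) \<omega>) = (\<Sum>s\<in>active t x. centred s (noise \<xi> \<epsilon> s \<omega>))" for \<omega>
    unfolding incr_def noises_def using active_noise_at[OF t(1)] by (intro sum.cong) auto
  have int: "integrable M (\<lambda>\<omega>. hit s q (noise \<xi> \<epsilon> s \<omega>) * centred s' (noise \<xi> \<epsilon> s' \<omega>))" if "s' \<in> active t x" for s'
  proof (cases "s' = s")
    case True
    then show ?thesis using noise_integral(1)[OF sub[OF s], of "\<lambda>x. hit s q x * centred s x"] hit_centred_integrable[OF sub[OF s], of q] by simp
  next
    case False
    then show ?thesis using that s by (intro noise_product sub hit_moments centred_moments) auto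
  qed
  have "expectation (\<lambda>\<omega>. hit s q (noise \<xi> \<epsilon> s \<omega>) * incr t x (noises (noise_at t) \<omega>))
    = (\<Sum>s'\<in>active t x. expectation (\<lambda>\<omega>. hit s q (noise \<xi> \<epsilon> s \<omega>) * centred s' (noise \<xi> \<epsilon> s' \<omega>)))"
    unfolding eq sum_distrib_left using int by (rule Bochner_Integration.integral_sum)
  also have "\<dots> = (\<Sum>s'\<in>active t x. if s' = s then kappa s q else 0)"
  proof (rule sum.cong[OF refl])
    fix s' assume s': "s' \<in> active t x"
    show "expectation (\<lambda>\<omega>. hit s q (noise \<xi> \<epsilon> s \<omega>) * centred s' (noise \<xi> \<epsilon> s' \<omega>)) = (if s' = s then kappa s q else 0)"
    proof (cases "s' = s")
      case True
      then show ?thesis using noise_integral(2)[OF sub[OF s], of "\<lambda>x. hit s q x * centred s x"] by (simp add: kappa_def)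
    next
      case False
      then have "expectation (\<lambda>\<omega>. hit s q (noise \<xi> \<epsilon> s \<omega>) * centred s' (noise \<xi> \<epsilon> s' \<omega>))
        = measure_pmf.expectation (law s) (hit s q) * measure_pmf.expectation (law s') (centred s')"
        using s s' by (intro noise_product sub hit_moments centred_moments) auto
      then show ?thesis using False hit_moments by simp
    qed
  qed
  also have "\<dots> = kappa s q" using s finite_active by simp
  finally show ?thesis .
qed

definition mart :: "int \<Rightarrow> 'a \<Rightarrow> real" where
  "mart t \<omega> = real (X t \<omega>) - (\<Sum>i = 1..p. \<alpha> i * real (X (t - int i) \<omega>)) - mean (Innovation (nat t))"

definition lags :: "int \<Rightarrow> 'a \<Rightarrow> nat \<Rightarrow> nat" where
  "lags t \<omega> = (\<lambda>i\<in>{1..p}. X (t - int i) \<omega>)"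

lemma mart_incr:
  assumes t: "1 \<le> t" "t \<le> int n" and w: "\<omega> \<in> space M"
  shows "mart t \<omega> = incr t (lags t \<omega>) (noises (noise_at t) \<omega>)"
proof -
  have nt: "nat t \<in> {1..n}" using t by (simp add: nat_le_iff le_nat_iff)
  have mem: "Innovation (nat t) \<in> noise_at t" "\<And>i j. i \<in> {1..p} \<Longrightarrow> j \<in> {1..y} \<Longrightarrow> Thinning i (nat t) j \<in> noise_at t" for y
    using t by (auto simp: noise_at_eq)
  have "real (X t \<omega>) = (\<Sum>i = 1..p. \<Sum>j = 1..X (t - int i) \<omega>. real (\<xi> i (nat t) j \<omega>)) + real (\<epsilon> (nat t) \<omega>)"
    using recursion[OF nt w] t by simp
  moreover have "incr t (lags t \<omega>) (noises (noise_at t) \<omega>)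
    = real (\<epsilon> (nat t) \<omega>) - mean (Innovation (nat t)) + (\<Sum>i = 1..p. \<Sum>j = 1..X (t - int i) \<omega>. real (\<xi> i (nat t) j \<omega>) - \<alpha> i)"
    unfolding incr_def sum_active
    by (intro arg_cong2[where f = "(+)"] sum.cong)
      (use mem in \<open>auto simp: noises_def centred_def law_thinning(2) lags_def\<close>)
  ultimately show ?thesis by (simp add: mart_def sum_subtractf mult.commute)
qed

lemma lags_past:
  assumes t: "1 \<le> t" "t \<le> int n"
  shows "lags t \<in> measurable (past (t - 1)) (Pi\<^sub>M {1..p} (\<lambda>_. count_space UNIV))"
  unfolding lags_def by (intro measurable_restrict X_past) (use t in auto)

lemma mart_past:
  assumes t: "1 \<le> t" "t \<le> int n"
  shows "mart t \<in> borel_measurable (past t)"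
proof -
  have Xm: "(\<lambda>\<omega>. real (X k \<omega>)) \<in> borel_measurable (past t)" if "1 - int p \<le> k" "k \<le> t" for k
    using X_past[OF that t(2)] by simp
  show ?thesis unfolding mart_def[abs_def]
    by (intro borel_measurable_diff borel_measurable_sum borel_measurable_times borel_measurable_const Xm) (use t in auto)
qed

lemma incr_measurable:
  assumes t: "1 \<le> t" and x: "x \<in> measurable Q (Pi\<^sub>M {1..p} (\<lambda>_. count_space UNIV))"
    and v: "v \<in> measurable Q (noise_space (noise_at t))"
  shows "(\<lambda>z. incr t (x z) (v z)) \<in> borel_measurable Q"
proof -
  have 1: "(\<lambda>z. centred s (v z s)) \<in> borel_measurable Q" if "s \<in> noise_at t" for s
    by (rule measurable_compose[OF measurable_compose[OF v measurable_component_singleton[OF that]]]) simp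
  have 2: "(\<lambda>z. x z i) \<in> measurable Q (count_space UNIV)" if "i \<in> {1..p}" for i
    by (rule measurable_compose[OF x measurable_component_singleton[OF that]])
  show ?thesis unfolding incr_def sum_active
    by (intro borel_measurable_add borel_measurable_sum random_sum_measurable 1 2) (use t in \<open>auto simp: noise_at_eq\<close>)
qed

text \<open>
  Conditionally on the past the increment is \<open>incr t x\<close> with a fixed \<open>x\<close>, which is centred by
  \<open>incr_moments\<close>.
\<close>

lemma mart_orthogonal:
  assumes t: "1 \<le> t" "t \<le> int n" and G: "G \<in> borel_measurable (past (t - 1))"
    and int: "integrable M (\<lambda>\<omega>. G \<omega> * mart t \<omega>)"
  shows "expectation (\<lambda>\<omega>. G \<omega> * mart t \<omega>) = 0"
proof -
  let ?S = "borel \<Otimes>\<^sub>M Pi\<^sub>M {1..p} (\<lambda>_. count_space UNIV)"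
  let ?Y = "\<lambda>\<omega>. (G \<omega>, lags t \<omega>)"
  let ?g = "\<lambda>z. fst (fst z) * incr t (snd (fst z)) (snd z)"
  have Y: "?Y \<in> measurable (past (t - 1)) ?S" using G lags_past[OF t] by measurable
  have g: "?g \<in> borel_measurable (?S \<Otimes>\<^sub>M noise_space (noise_at t))"
    by (intro borel_measurable_times incr_measurable t) measurable
  have eq: "?g (?Y \<omega>, noises (noise_at t) \<omega>) = G \<omega> * mart t \<omega>" if "\<omega> \<in> space M" for \<omega>
    using mart_incr[OF t that] by simp
  have "expectation (\<lambda>\<omega>. ?g (?Y \<omega>, noises (noise_at t) \<omega>)) = 0"
  proof (rule past_integral_zero[OF t Y g])
    show "integrable M (\<lambda>\<omega>. ?g (?Y \<omega>, noises (noise_at t) \<omega>))"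
      using int by (subst Bochner_Integration.integrable_cong[OF refl eq])
    show "expectation (\<lambda>\<omega>. ?g (y, noises (noise_at t) \<omega>)) = 0" for y
      using incr_moments(1)[OF t, of "snd y"] by simp
  qed
  moreover have "expectation (\<lambda>\<omega>. ?g (?Y \<omega>, noises (noise_at t) \<omega>)) = expectation (\<lambda>\<omega>. G \<omega> * mart t \<omega>)"
    by (rule Bochner_Integration.integral_cong[OF refl eq])
  ultimately show ?thesis by simp
qed

text \<open>
  The conditional variance of step \<open>t\<close> is at most \<open>noise_bound\<close> times the number
  of active noise variables, hence linear in the lagged values.
\<close>

lemma mart_square:
  assumes t: "1 \<le> t" "t \<le> int n" and G: "G \<in> borel_measurable (past (t - 1))" and G0: "\<And>\<omega>. G \<omega> \<ge> 0"
    and int: "integrable M (\<lambda>\<omega>. G \<omega> * (1 + (\<Sum>i = 1..p. real (X (t - int i) \<omega>))))"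
  shows "integrable M (\<lambda>\<omega>. G \<omega> * (mart t \<omega>)\<^sup>2)"
    "expectation (\<lambda>\<omega>. G \<omega> * (mart t \<omega>)\<^sup>2) \<le> noise_bound * expectation (\<lambda>\<omega>. G \<omega> * (1 + (\<Sum>i = 1..p. real (X (t - int i) \<omega>))))"
proof -
  let ?S = "borel \<Otimes>\<^sub>M Pi\<^sub>M {1..p} (\<lambda>_. count_space UNIV)"
  let ?Y = "\<lambda>\<omega>. (G \<omega>, lags t \<omega>)"
  let ?g = "\<lambda>z. ennreal (fst (fst z) * (incr t (snd (fst z)) (snd z))\<^sup>2)"
  let ?H = "\<lambda>\<omega>. G \<omega> * (1 + (\<Sum>i = 1..p. real (X (t - int i) \<omega>)))"
  have Y: "?Y \<in> measurable (past (t - 1)) ?S" using G lags_past[OF t] by measurable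
  have g: "?g \<in> borel_measurable (?S \<Otimes>\<^sub>M noise_space (noise_at t))"
    by (intro measurable_compose[OF _ measurable_ennreal] borel_measurable_times borel_measurable_power incr_measurable t) measurable
  have [measurable]: "G \<in> borel_measurable M" by (rule measurable_past_events[OF G]) (use t in auto)
  have [measurable]: "mart t \<in> borel_measurable M" by (rule measurable_past_events[OF mart_past[OF t]]) (use t in auto)
  have H0: "?H \<omega> \<ge> 0" for \<omega> using G0 by (intro mult_nonneg_nonneg add_nonneg_nonneg sum_nonneg) auto
  have "(\<integral>\<^sup>+\<omega>. ennreal (G \<omega> * (mart t \<omega>)\<^sup>2) \<partial>M) = (\<integral>\<^sup>+\<omega>. ?g (?Y \<omega>, noises (noise_at t) \<omega>) \<partial>M)"
    by (intro nn_integral_cong) (simp add: mart_incr[OF t])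
  also have "\<dots> = (\<integral>\<^sup>+\<omega>. (\<integral>\<^sup>+\<omega>'. ?g (?Y \<omega>, noises (noise_at t) \<omega>') \<partial>M) \<partial>M)"
    by (rule past_integral_nonneg[OF t Y g])
  also have "\<dots> \<le> (\<integral>\<^sup>+\<omega>. ennreal (noise_bound * ?H \<omega>) \<partial>M)"
  proof (rule nn_integral_mono)
    fix \<omega>
    have "(\<integral>\<^sup>+\<omega>'. ?g (?Y \<omega>, noises (noise_at t) \<omega>') \<partial>M) = ennreal (G \<omega> * expectation (\<lambda>\<omega>'. (incr t (lags t \<omega>) (noises (noise_at t) \<omega>'))\<^sup>2))"
      using incr_moments(2)[OF t, of "lags t \<omega>"] G0 by (simp add: nn_integral_eq_integral)
    also have "\<dots> \<le> ennreal (G \<omega> * (noise_bound * (1 + (\<Sum>i = 1..p. real (lags t \<omega> i)))))"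
      using incr_moments(3)[OF t, of "lags t \<omega>"] G0 by (intro ennreal_leI mult_left_mono) auto
    also have "G \<omega> * (noise_bound * (1 + (\<Sum>i = 1..p. real (lags t \<omega> i)))) = noise_bound * ?H \<omega>"
      by (simp add: lags_def)
    finally show "(\<integral>\<^sup>+\<omega>'. ?g (?Y \<omega>, noises (noise_at t) \<omega>') \<partial>M) \<le> ennreal (noise_bound * ?H \<omega>)" .
  qed
  also have "\<dots> = ennreal (expectation (\<lambda>\<omega>. noise_bound * ?H \<omega>))"
    using int H0 noise_bound_ge_1 by (intro nn_integral_eq_integral) (auto intro!: AE_I2 mult_nonneg_nonneg)
  finally have le: "(\<integral>\<^sup>+\<omega>. ennreal (G \<omega> * (mart t \<omega>)\<^sup>2) \<partial>M) \<le> ennreal (noise_bound * expectation ?H)" by simp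
  show "integrable M (\<lambda>\<omega>. G \<omega> * (mart t \<omega>)\<^sup>2)"
    using le G0 by (intro integrableI_nonneg) (auto intro: le_less_trans)
  show "expectation (\<lambda>\<omega>. G \<omega> * (mart t \<omega>)\<^sup>2) \<le> noise_bound * expectation ?H"
    using le G0 noise_bound_ge_1 H0
    by (subst integral_eq_nn_integral) (auto intro!: enn2real_leI mult_nonneg_nonneg integral_nonneg)
qed

lemma hit_past: "s \<in> noise_at t \<Longrightarrow> (\<lambda>\<omega>. hit s q (noise \<xi> \<epsilon> s \<omega>)) \<in> borel_measurable (past t)"
  by (rule measurable_compose[OF noise_at_past]) auto

lemma hit_orthogonal:
  assumes t: "1 \<le> t" "t \<le> int n" and G: "G \<in> borel_measurable (past (t - 1))"
    and s: "s \<in> noise_at t"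
    and int: "integrable M (\<lambda>\<omega>. G \<omega> * hit s q (noise \<xi> \<epsilon> s \<omega>))"
  shows "expectation (\<lambda>\<omega>. G \<omega> * hit s q (noise \<xi> \<epsilon> s \<omega>)) = 0"
proof -
  let ?g = "\<lambda>z. fst z * hit s q (snd z s)"
  have g: "?g \<in> borel_measurable (borel \<Otimes>\<^sub>M noise_space (noise_at t))"
    by (intro borel_measurable_times measurable_compose[OF measurable_compose[OF measurable_snd measurable_component_singleton[OF s]]]) auto
  have sn: "s \<in> noise_indices p n" using s noise_at_subset[OF t(2)] by blast
  have eq: "?g (G \<omega>, noises (noise_at t) \<omega>) = G \<omega> * hit s q (noise \<xi> \<epsilon> s \<omega>)" for \<omega> using s by (simp add: noises_def)
  have "expectation (\<lambda>\<omega>. ?g (G \<omega>, noises (noise_at t) \<omega>)) = 0"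
  proof (rule past_integral_zero[OF t G g])
    show "integrable M (\<lambda>\<omega>. ?g (G \<omega>, noises (noise_at t) \<omega>))" unfolding eq by (rule int)
    show "expectation (\<lambda>\<omega>. ?g (y, noises (noise_at t) \<omega>)) = 0" for y
      using s noise_integral(2)[OF sn, of "hit s q"] by (simp add: noises_def hit_moments)
  qed
  then show ?thesis unfolding eq .
qed

text \<open>
  Conditionally on the past, \<open>hit\<close> has covariance \<open>kappa\<close> with its own variable \<open>s\<close> and none with the
  other summands of the increment. The covariance is present only where \<open>s\<close> is active, so the weight
  \<open>G\<close> must vanish elsewhere.
\<close>

lemma hit_mart_orthogonal:
  assumes t: "1 \<le> t" "t \<le> int n" and G: "G \<in> borel_measurable (past (t - 1))"
    and s: "s \<in> noise_at t" and act: "\<And>\<omega>. \<omega> \<in> space M \<Longrightarrow> G \<omega> \<noteq> 0 \<Longrightarrow> s \<in> active t (lags t \<omega>)"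
    and int: "integrable M (\<lambda>\<omega>. G \<omega> * (hit s q (noise \<xi> \<epsilon> s \<omega>) * mart t \<omega> - kappa s q))"
  shows "expectation (\<lambda>\<omega>. G \<omega> * (hit s q (noise \<xi> \<epsilon> s \<omega>) * mart t \<omega> - kappa s q)) = 0"
proof -
  let ?S0 = "borel \<Otimes>\<^sub>M Pi\<^sub>M {1..p} (\<lambda>_. count_space UNIV)"
  let ?c = "\<lambda>y. if s \<in> active t (snd y) then fst y else (0::real)"
  let ?Y = "\<lambda>\<omega>. (G \<omega>, lags t \<omega>)"
  let ?g = "\<lambda>z. ?c (fst z) * (hit s q (snd z s) * incr t (snd (fst z)) (snd z) - kappa s q)"
  have Y: "?Y \<in> measurable (past (t - 1)) ?S0" using G lags_past[OF t] by measurable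
  have sm: "(\<lambda>z. hit s q (snd z s)) \<in> borel_measurable (?S0 \<Otimes>\<^sub>M noise_space (noise_at t))"
    by (intro measurable_compose[OF measurable_compose[OF measurable_snd measurable_component_singleton[OF s]]]) auto
  have c: "?c \<in> borel_measurable ?S0"
  proof -
    have "Measurable.pred ?S0 (\<lambda>y. s \<in> active t (snd y))"
    proof (cases s)
      case (Innovation k)
      then show ?thesis using s t by (auto simp: noise_at_eq active_def)
    next
      case (Thinning i k j)
      then have i: "i \<in> {1..p}" "k = nat t" "j \<ge> 1" using s t by (auto simp: noise_at_eq)
      have eq: "s \<in> active t x \<longleftrightarrow> j \<le> x i" for x using i Thinning by (auto simp: active_def)
      have [measurable]: "(\<lambda>y. snd y i) \<in> measurable ?S0 (count_space UNIV)"
        by (rule measurable_compose[OF measurable_snd measurable_component_singleton[OF i(1)]])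
      show ?thesis unfolding eq by measurable
    qed
    then show ?thesis by measurable
  qed
  have g: "?g \<in> borel_measurable (?S0 \<Otimes>\<^sub>M noise_space (noise_at t))"
    by (intro borel_measurable_times borel_measurable_diff incr_measurable t sm measurable_compose[OF measurable_fst c]) measurable
  have sn: "s \<in> noise_indices p n" using s noise_at_subset[OF t(2)] by blast
  have eq: "?g (?Y \<omega>, noises (noise_at t) \<omega>) = G \<omega> * (hit s q (noise \<xi> \<epsilon> s \<omega>) * mart t \<omega> - kappa s q)" if "\<omega> \<in> space M" for \<omega>
    using mart_incr[OF t that] act[OF that] s by (auto simp: noises_def)
  have "expectation (\<lambda>\<omega>. ?g (?Y \<omega>, noises (noise_at t) \<omega>)) = 0"
  proof (rule past_integral_zero[OF t Y g])
    show "integrable M (\<lambda>\<omega>. ?g (?Y \<omega>, noises (noise_at t) \<omega>))"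
      using int by (subst Bochner_Integration.integrable_cong[OF refl eq])
    fix y
    show "expectation (\<lambda>\<omega>. ?g (y, noises (noise_at t) \<omega>)) = 0"
    proof (cases "s \<in> active t (snd y)")
      case True
      let ?f = "\<lambda>\<omega>. hit s q (noise \<xi> \<epsilon> s \<omega>) * incr t (snd y) (noises (noise_at t) \<omega>)"
      have "(\<lambda>\<omega>. ?g (y, noises (noise_at t) \<omega>)) = (\<lambda>\<omega>. fst y * (?f \<omega> - kappa s q))"
        using True s by (simp add: noises_def)
      moreover have "integrable M ?f"
      proof (rule integrable_product)
        have hm: "(\<lambda>\<omega>. hit s q (noise \<xi> \<epsilon> s \<omega>)) \<in> borel_measurable M"
          by (rule measurable_compose[OF noise_measurable[OF sn]]) simp
        then show "(\<lambda>\<omega>. hit s q (noise \<xi> \<epsilon> s \<omega>)) \<in> borel_measurable M" .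
        show "integrable M (\<lambda>\<omega>. (hit s q (noise \<xi> \<epsilon> s \<omega>))\<^sup>2)"
          by (rule integrable_const_bound[where B = 1]) (use hm hit_le_1[of s q] in \<open>auto simp: abs_square_le_1\<close>)
        show "(\<lambda>\<omega>. incr t (snd y) (noises (noise_at t) \<omega>)) \<in> borel_measurable M"
          unfolding incr_def noises_def using active_noise_at[OF t(1)] noise_at_subset[OF t(2)]
          by (intro borel_measurable_sum) (auto intro!: measurable_compose[OF noise_measurable])
        show "integrable M (\<lambda>\<omega>. (incr t (snd y) (noises (noise_at t) \<omega>))\<^sup>2)" by (rule incr_moments(2)[OF t])
      qed
      ultimately show ?thesis using hit_incr[OF t True, of q] by (simp add: prob_space)
    next
      case False then show ?thesis by simp
    qed
  qed
  moreover have "expectation (\<lambda>\<omega>. ?g (?Y \<omega>, noises (noise_at t) \<omega>))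
      = expectation (\<lambda>\<omega>. G \<omega> * (hit s q (noise \<xi> \<epsilon> s \<omega>) * mart t \<omega> - kappa s q))"
    by (rule Bochner_Integration.integral_cong[OF refl eq])
  ultimately show ?thesis by simp
qed

end

section \<open>Martingale differences and uniformly bounded second moments\<close>

lemma (in prob_space) const_plus_sum:
  fixes f :: "'i \<Rightarrow> 'a \<Rightarrow> real"
  assumes "\<And>i. i \<in> I \<Longrightarrow> integrable M (f i)"
  shows "integrable M (\<lambda>\<omega>. c + (\<Sum>i\<in>I. f i \<omega>))"
    "expectation (\<lambda>\<omega>. c + (\<Sum>i\<in>I. f i \<omega>)) = c + (\<Sum>i\<in>I. expectation (f i))"
proof -
  have s: "integrable M (\<lambda>\<omega>. \<Sum>i\<in>I. f i \<omega>)" using assms by (rule Bochner_Integration.integrable_sum)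
  then show "integrable M (\<lambda>\<omega>. c + (\<Sum>i\<in>I. f i \<omega>))" by simp
  have "expectation (\<lambda>\<omega>. \<Sum>i\<in>I. f i \<omega>) = (\<Sum>i\<in>I. expectation (f i))" using assms by (rule Bochner_Integration.integral_sum)
  then show "expectation (\<lambda>\<omega>. c + (\<Sum>i\<in>I. f i \<omega>)) = c + (\<Sum>i\<in>I. expectation (f i))" using s by (simp add: prob_space)
qed

lemma le_one_plus_square: "real x \<le> 1 + (real x)\<^sup>2"
proof -
  have "0 \<le> (real x - 1)\<^sup>2 + real x" by simp
  also have "\<dots> = 1 + (real x)\<^sup>2 - real x" by (simp add: power2_eq_square algebra_simps)
  finally show ?thesis by simp
qed

context INAR_innovation_change
begin

text \<open>
  A square integrable martingale difference at time \<open>t\<close>. Orthogonality is required against every past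
  variable with integrable product; this makes the notion stable under multiplication
  by unbounded past variables.
\<close>

definition mds :: "int \<Rightarrow> ('a \<Rightarrow> real) \<Rightarrow> bool" where
  "mds t D \<longleftrightarrow> D \<in> borel_measurable (past t) \<and> integrable M (\<lambda>\<omega>. (D \<omega>)\<^sup>2) \<and>
     (\<forall>G\<in>borel_measurable (past (t - 1)). integrable M (\<lambda>\<omega>. G \<omega> * D \<omega>) \<longrightarrow> expectation (\<lambda>\<omega>. G \<omega> * D \<omega>) = 0)"

lemma mdsD:
  assumes "mds t D"
  shows "D \<in> borel_measurable (past t)" "integrable M (\<lambda>\<omega>. (D \<omega>)\<^sup>2)"
    "G \<in> borel_measurable (past (t - 1)) \<Longrightarrow> integrable M (\<lambda>\<omega>. G \<omega> * D \<omega>) \<Longrightarrow> expectation (\<lambda>\<omega>. G \<omega> * D \<omega>) = 0"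
  using assms unfolding mds_def by blast+

lemma mds_measurable: "mds t D \<Longrightarrow> t \<le> int n \<Longrightarrow> D \<in> borel_measurable M"
  unfolding mds_def using measurable_past_events by blast

lemma mds_mult:
  assumes D: "mds t D" and G: "G \<in> borel_measurable (past (t - 1))" and int: "integrable M (\<lambda>\<omega>. (G \<omega> * D \<omega>)\<^sup>2)"
  shows "mds t (\<lambda>\<omega>. G \<omega> * D \<omega>)"
  unfolding mds_def
proof (intro conjI ballI impI int)
  have "G \<in> borel_measurable (past t)" by (rule measurable_past_mono[OF G]) simp
  then show "(\<lambda>\<omega>. G \<omega> * D \<omega>) \<in> borel_measurable (past t)" using mdsD(1)[OF D] by (rule borel_measurable_times)
  fix H assume H: "H \<in> borel_measurable (past (t - 1))" and i: "integrable M (\<lambda>\<omega>. H \<omega> * (G \<omega> * D \<omega>))"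
  have "(\<lambda>\<omega>. H \<omega> * G \<omega>) \<in> borel_measurable (past (t - 1))" using H G by (rule borel_measurable_times)
  moreover have "integrable M (\<lambda>\<omega>. H \<omega> * G \<omega> * D \<omega>)" using i by (simp add: mult.assoc)
  ultimately have "expectation (\<lambda>\<omega>. H \<omega> * G \<omega> * D \<omega>) = 0" by (rule mdsD(3)[OF D])
  then show "expectation (\<lambda>\<omega>. H \<omega> * (G \<omega> * D \<omega>)) = 0" by (simp add: mult.assoc)
qed

lemma mds_sum:
  assumes I: "finite I" "I \<subseteq> {1..int n}" and D: "\<And>t. t \<in> I \<Longrightarrow> mds t (D t)"
    and C: "\<And>t. t \<in> I \<Longrightarrow> expectation (\<lambda>\<omega>. (D t \<omega>)\<^sup>2) \<le> C"
  shows "integrable M (\<lambda>\<omega>. (\<Sum>t\<in>I. D t \<omega>)\<^sup>2)"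
    "expectation (\<lambda>\<omega>. (\<Sum>t\<in>I. D t \<omega>)\<^sup>2) \<le> C * real (card I)"
proof -
  have m: "D t \<in> borel_measurable M" and i: "integrable M (\<lambda>\<omega>. (D t \<omega>)\<^sup>2)" if "t \<in> I" for t
    using mdsD(2)[OF D[OF that]] mds_measurable[OF D[OF that]] that I by auto
  show "integrable M (\<lambda>\<omega>. (\<Sum>t\<in>I. D t \<omega>)\<^sup>2)" using I m i by (intro integrable_square_sum)
  have lt: "expectation (\<lambda>\<omega>. D s \<omega> * D t \<omega>) = 0" if "s \<in> I" "t \<in> I" "s < t" for s t
  proof -
    have "D s \<in> borel_measurable (past (t - 1))"
      by (rule measurable_past_mono[OF mdsD(1)[OF D[OF that(1)]]]) (use that in simp)
    moreover have "integrable M (\<lambda>\<omega>. D s \<omega> * D t \<omega>)" using that m i by (intro integrable_product) auto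
    ultimately show ?thesis by (rule mdsD(3)[OF D[OF that(2)]])
  qed
  show "expectation (\<lambda>\<omega>. (\<Sum>t\<in>I. D t \<omega>)\<^sup>2) \<le> C * real (card I)"
  proof (rule orthogonal_sum_square[OF I(1) m i C])
    fix s t assume "s \<in> I" "t \<in> I" "s \<noteq> t"
    then show "expectation (\<lambda>\<omega>. D s \<omega> * D t \<omega>) = 0"
      using lt[of s t] lt[of t s] by (cases "s < t") (auto simp: mult.commute)
  qed
qed

lemma mds_tail:
  assumes I: "finite I" "I \<subseteq> {1..int n}" and D: "\<And>t. t \<in> I \<Longrightarrow> mds t (D t)"
    and C: "\<And>t. t \<in> I \<Longrightarrow> expectation (\<lambda>\<omega>. (D t \<omega>)\<^sup>2) \<le> C" "C \<ge> 0" and delta: "\<delta> > 0" and n: "n \<ge> 1"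
  shows "prob {\<omega> \<in> space M. \<bar>\<Sum>t\<in>I. D t \<omega>\<bar> > \<delta> * real n} \<le> C / (\<delta>\<^sup>2 * real n)"
proof -
  have m: "D t \<in> borel_measurable M" if "t \<in> I" for t using mds_measurable[OF D[OF that]] that I by auto
  have "card I \<le> card {1..int n}" using I by (intro card_mono) auto
  then have "C * real (card I) \<le> C * real n" using C by (intro mult_left_mono) auto
  with mds_sum(2)[OF I D C(1)] have "expectation (\<lambda>\<omega>. (\<Sum>t\<in>I. D t \<omega>)\<^sup>2) \<le> C * real n" by linarith
  then have "prob {\<omega> \<in> space M. \<bar>\<Sum>t\<in>I. D t \<omega>\<bar> > \<delta> * real n} \<le> C * real n / (\<delta> * real n)\<^sup>2"
    using m delta n by (intro square_tail mds_sum(1)[OF I D C(1)]) auto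
  also have "\<dots> = C / (\<delta>\<^sup>2 * real n)" using n by (simp add: power2_eq_square)
  finally show ?thesis .
qed

end

text \<open>
  The bound \<open>B\<close> on the initial second moments is a parameter, so that the moment bounds below are
  functions of \<open>p\<close>, \<open>\<alpha>\<close>, \<open>\<nu>1\<close>, \<open>\<nu>2\<close> and \<open>B\<close> only and are shared by the processes for different \<open>n\<close>.
\<close>

locale INAR_stable = INAR_innovation_change +
  fixes B :: real
  assumes stable: "(\<Sum>i = 1..p. \<alpha> i) < 1"
    and initial_square_integrable: "\<And>k. k \<in> {1 - int p..0} \<Longrightarrow> integrable M (\<lambda>\<omega>. (real (X k \<omega>))\<^sup>2)"
    and initial_second_moment: "\<And>k. k \<in> {1 - int p..0} \<Longrightarrow> expectation (\<lambda>\<omega>. (real (X k \<omega>))\<^sup>2) \<le> B"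
begin

definition slack :: real where "slack = 1 - (\<Sum>i = 1..p. \<alpha> i)"

lemma slack: "0 < slack" "slack \<le> 1" "(\<Sum>i = 1..p. \<alpha> i) = 1 - slack"
  using stable coeff by (auto simp: slack_def intro!: sum_nonneg)

definition second_moment_bound :: real where
  "second_moment_bound = B + 2 / slack * (noise_bound / slack + noise_bound + noise_bound\<^sup>2 * (real p)\<^sup>2 / (2 * slack))"

lemma X_measurable: "1 - int p \<le> k \<Longrightarrow> k \<le> int n \<Longrightarrow> (\<lambda>\<omega>. real (X k \<omega>)) \<in> borel_measurable M"
  using measurable_past_events[OF X_past[of k k]] by simp

lemma B_nonneg: "B \<ge> 0"
proof -
  have "0 \<le> expectation (\<lambda>\<omega>. (real (X 0 \<omega>))\<^sup>2)" by simp
  also have "\<dots> \<le> B" using p_pos by (intro initial_second_moment) auto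
  finally show ?thesis .
qed

lemma mean_innovation_square:
  assumes "k \<in> {1..n}" shows "(mean (Innovation k))\<^sup>2 \<le> noise_bound"
proof -
  have s: "Innovation k \<in> noise_indices p n" using assms by (auto simp: noise_indices_def)
  have "0 \<le> measure_pmf.variance (law (Innovation k)) real" by simp
  also have "\<dots> = measure_pmf.expectation (law (Innovation k)) (\<lambda>x. (real x)\<^sup>2) - (mean (Innovation k))\<^sup>2"
    unfolding mean_def using law_integrable[OF s] law_square(1)[OF s] by (rule measure_pmf.variance_eq)
  finally show ?thesis using law_square(2)[OF s] by linarith
qed

text \<open>
  Jensen's inequality for the square with weights \<open>\<alpha> 1, \<dots>, \<alpha> p\<close> and \<open>slack\<close>, applied to
  \<open>x 1, \<dots>, x p\<close> and \<open>m / slack\<close>.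
\<close>

lemma convex_square:
  fixes x :: "nat \<Rightarrow> real"
  shows "((\<Sum>i = 1..p. \<alpha> i * x i) + m)\<^sup>2 \<le> (\<Sum>i = 1..p. \<alpha> i * (x i)\<^sup>2) + m\<^sup>2 / slack"
proof -
  define A where "A = (\<Sum>i = 1..p. \<alpha> i * x i)"
  define z where "z = A + m"
  have "0 \<le> (\<Sum>i = 1..p. \<alpha> i * (x i - z)\<^sup>2)" using coeff by (intro sum_nonneg) auto
  also have "\<dots> = (\<Sum>i = 1..p. \<alpha> i * (x i)\<^sup>2 - 2 * z * (\<alpha> i * x i) + \<alpha> i * z\<^sup>2)"
    by (intro sum.cong) (auto simp: power2_eq_square algebra_simps)
  also have "\<dots> = (\<Sum>i = 1..p. \<alpha> i * (x i)\<^sup>2) - 2 * z * A + (1 - slack) * z\<^sup>2"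
    by (simp add: sum.distrib sum_subtractf sum_distrib_left[symmetric] sum_distrib_right[symmetric] slack(3)[simplified] A_def)
  finally have 1: "0 \<le> (\<Sum>i = 1..p. \<alpha> i * (x i)\<^sup>2) - 2 * z * A + (1 - slack) * z\<^sup>2" .
  have "0 \<le> slack * (m / slack - z)\<^sup>2" using slack by simp
  also have "\<dots> = m\<^sup>2 / slack - 2 * z * m + slack * z\<^sup>2" using slack by (simp add: power2_eq_square field_simps)
  finally have 2: "0 \<le> m\<^sup>2 / slack - 2 * z * m + slack * z\<^sup>2" .
  have "z\<^sup>2 = 2 * z * A + 2 * z * m - z\<^sup>2" by (simp add: z_def power2_eq_square algebra_simps)
  moreover have "(1 - slack) * z\<^sup>2 + slack * z\<^sup>2 = z\<^sup>2" by (simp add: algebra_simps)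
  ultimately have "z\<^sup>2 \<le> (\<Sum>i = 1..p. \<alpha> i * (x i)\<^sup>2) + m\<^sup>2 / slack" using 1 2 by linarith
  then show ?thesis by (simp add: z_def A_def)
qed

text \<open>
  The second moment at time \<open>k\<close> is that of the conditional mean plus the mean conditional
  variance. By \<open>convex_square\<close> the former is at most \<open>1 - slack\<close> times the largest earlier second moment plus a
  constant. The latter is linear in the first moments, which are traded for \<open>slack / 2\<close> times a
  second moment plus a constant. So the recursion contracts with factor \<open>1 - slack / 2\<close>.
\<close>

lemma second_moment:
  assumes "1 - int p \<le> k" "k \<le> int n"
  shows "integrable M (\<lambda>\<omega>. (real (X k \<omega>))\<^sup>2) \<and> expectation (\<lambda>\<omega>. (real (X k \<omega>))\<^sup>2) \<le> second_moment_bound"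
  using assms
proof (induction "nat (k + int p)" arbitrary: k rule: less_induct)
  case less
  define K where "K = noise_bound / slack + noise_bound + noise_bound\<^sup>2 * (real p)\<^sup>2 / (2 * slack)"
  have K0: "K \<ge> 0" using slack noise_bound_ge_1 by (simp add: K_def)
  show ?case
  proof (cases "k \<le> 0")
    case True
    then have k: "k \<in> {1 - int p..0}" using less.prems by auto
    have "B \<le> second_moment_bound" unfolding second_moment_bound_def K_def[symmetric] using K0 slack by simp
    then show ?thesis using initial_square_integrable[OF k] initial_second_moment[OF k] by auto
  next
    case False
    then have t: "1 \<le> k" "k \<le> int n" using less.prems by auto
    have nk: "nat k \<in> {1..n}" using t by (simp add: nat_le_iff le_nat_iff)
    have IH: "integrable M (\<lambda>\<omega>. (real (X (k - int i) \<omega>))\<^sup>2)" "expectation (\<lambda>\<omega>. (real (X (k - int i) \<omega>))\<^sup>2) \<le> second_moment_bound"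
      if "i \<in> {1..p}" for i using less.hyps[of "k - int i"] that t by auto
    have Xm[measurable]: "(\<lambda>\<omega>. real (X (k - int i) \<omega>)) \<in> borel_measurable M" if "i \<in> {1..p}" for i
      using that t by (intro X_measurable) auto
    have Xi: "integrable M (\<lambda>\<omega>. real (X (k - int i) \<omega>))" if "i \<in> {1..p}" for i
      by (rule square_integrable_imp_integrable[OF Xm[OF that] IH(1)[OF that]])
    define m where "m = mean (Innovation (nat k))"
    define L where "L = (\<lambda>\<omega>. (\<Sum>i = 1..p. \<alpha> i * real (X (k - int i) \<omega>)) + m)"
    have Lp: "L \<in> borel_measurable (past (k - 1))"
      unfolding L_def by (intro borel_measurable_add borel_measurable_sum borel_measurable_times borel_measurable_const
        measurable_compose[OF X_past]) (use t in auto)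
    have Lm[measurable]: "L \<in> borel_measurable M" by (rule measurable_past_events[OF Lp]) (use t in auto)
    have Mm[measurable]: "mart k \<in> borel_measurable M" by (rule measurable_past_events[OF mart_past[OF t]]) (use t in auto)
    have XL: "real (X k \<omega>) = L \<omega> + mart k \<omega>" for \<omega> by (simp add: L_def mart_def m_def)
    have int1: "integrable M (\<lambda>\<omega>. 1 * (1 + (\<Sum>i = 1..p. real (X (k - int i) \<omega>))))"
      unfolding mult_1 by (rule const_plus_sum(1)[OF Xi])
    have M2: "integrable M (\<lambda>\<omega>. (mart k \<omega>)\<^sup>2)"
      "expectation (\<lambda>\<omega>. (mart k \<omega>)\<^sup>2) \<le> noise_bound * expectation (\<lambda>\<omega>. 1 + (\<Sum>i = 1..p. real (X (k - int i) \<omega>)))"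
      using mart_square[OF t _ _ int1] by simp_all
    let ?U = "\<lambda>\<omega>. m\<^sup>2 / slack + (\<Sum>i = 1..p. \<alpha> i * (real (X (k - int i) \<omega>))\<^sup>2)"
    have aX: "integrable M (\<lambda>\<omega>. \<alpha> i * (real (X (k - int i) \<omega>))\<^sup>2)" if "i \<in> {1..p}" for i
      by (rule integrable_mult_right) (rule IH(1)[OF that])
    have L2i: "integrable M ?U" by (rule const_plus_sum(1)[OF aX])
    have LU: "(L \<omega>)\<^sup>2 \<le> ?U \<omega>" for \<omega> unfolding L_def using convex_square[of "\<lambda>i. real (X (k - int i) \<omega>)" m] by linarith
    have L2: "integrable M (\<lambda>\<omega>. (L \<omega>)\<^sup>2)"
    proof (rule Bochner_Integration.integrable_bound[OF L2i])
      show "AE \<omega> in M. norm ((L \<omega>)\<^sup>2) \<le> norm (?U \<omega>)"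
      proof (rule AE_I2)
        fix \<omega>
        have "\<bar>(L \<omega>)\<^sup>2\<bar> = (L \<omega>)\<^sup>2" by simp
        also have "\<dots> \<le> \<bar>?U \<omega>\<bar>" using LU[of \<omega>] by linarith
        finally show "norm ((L \<omega>)\<^sup>2) \<le> norm (?U \<omega>)" unfolding real_norm_def .
      qed
    qed measurable
    have "expectation (\<lambda>\<omega>. (L \<omega>)\<^sup>2) \<le> expectation ?U" by (rule integral_mono[OF L2 L2i LU])
    also have "\<dots> = (\<Sum>i = 1..p. \<alpha> i * expectation (\<lambda>\<omega>. (real (X (k - int i) \<omega>))\<^sup>2)) + m\<^sup>2 / slack"
    proof -
      have "expectation ?U = m\<^sup>2 / slack + (\<Sum>i = 1..p. expectation (\<lambda>\<omega>. \<alpha> i * (real (X (k - int i) \<omega>))\<^sup>2))"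
        by (rule const_plus_sum(2)[OF aX])
      then show ?thesis by simp
    qed
    also have "\<dots> \<le> (\<Sum>i = 1..p. \<alpha> i * second_moment_bound) + noise_bound / slack"
      using IH coeff slack mean_innovation_square[OF nk] unfolding m_def
      by (intro add_mono sum_mono mult_left_mono divide_right_mono) auto
    finally have EL: "expectation (\<lambda>\<omega>. (L \<omega>)\<^sup>2) \<le> (1 - slack) * second_moment_bound + noise_bound / slack"
      by (simp add: sum_distrib_right[symmetric] slack(3)[simplified])
    have LMi: "integrable M (\<lambda>\<omega>. L \<omega> * mart k \<omega>)" by (intro integrable_product Lm Mm L2 M2)
    have LM: "expectation (\<lambda>\<omega>. L \<omega> * mart k \<omega>) = 0" by (rule mart_orthogonal[OF t Lp LMi])
    \<comment> \<open>This weight in \<open>x \<le> l x\<^sup>2 + 1 / (4 l)\<close> makes the quadratic part cost exactly \<open>slack / 2\<close>.\<close>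
    define l where "l = slack / (2 * noise_bound * real p)"
    have l0: "l > 0" using slack noise_bound_ge_1 p_pos by (simp add: l_def)
    have lin: "x \<le> l * x\<^sup>2 + 1 / (4 * l)" for x
    proof -
      have "0 \<le> l * (x - 1 / (2 * l))\<^sup>2" using l0 by simp
      also have "\<dots> = l * x\<^sup>2 + 1 / (4 * l) - x" using l0 by (simp add: power2_eq_square field_simps)
      finally show ?thesis by simp
    qed
    have EX: "expectation (\<lambda>\<omega>. real (X (k - int i) \<omega>)) \<le> l * second_moment_bound + 1 / (4 * l)" if i: "i \<in> {1..p}" for i
    proof -
      have "expectation (\<lambda>\<omega>. real (X (k - int i) \<omega>)) \<le> expectation (\<lambda>\<omega>. l * (real (X (k - int i) \<omega>))\<^sup>2 + 1 / (4 * l))"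
        using IH[OF i] Xi[OF i] lin by (intro integral_mono) auto
      also have "\<dots> = l * expectation (\<lambda>\<omega>. (real (X (k - int i) \<omega>))\<^sup>2) + 1 / (4 * l)"
        using IH[OF i] by (simp add: prob_space)
      also have "\<dots> \<le> l * second_moment_bound + 1 / (4 * l)" using IH[OF i] l0 by simp
      finally show ?thesis .
    qed
    have "expectation (\<lambda>\<omega>. 1 + (\<Sum>i = 1..p. real (X (k - int i) \<omega>))) = 1 + (\<Sum>i = 1..p. expectation (\<lambda>\<omega>. real (X (k - int i) \<omega>)))"
      by (rule const_plus_sum(2)[OF Xi])
    also have "\<dots> \<le> 1 + (\<Sum>i = 1..p. l * second_moment_bound + 1 / (4 * l))" using EX by (intro add_left_mono sum_mono)
    also have "\<dots> = 1 + real p * (l * second_moment_bound + 1 / (4 * l))" by simp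
    finally have "noise_bound * expectation (\<lambda>\<omega>. 1 + (\<Sum>i = 1..p. real (X (k - int i) \<omega>))) \<le>
      noise_bound * (1 + real p * (l * second_moment_bound + 1 / (4 * l)))" using noise_bound_ge_1 by (intro mult_left_mono) auto
    also have "\<dots> = noise_bound + slack / 2 * second_moment_bound + noise_bound\<^sup>2 * (real p)\<^sup>2 / (2 * slack)"
      using noise_bound_ge_1 p_pos slack by (simp add: l_def power2_eq_square field_simps)
    finally have EM: "expectation (\<lambda>\<omega>. (mart k \<omega>)\<^sup>2) \<le> noise_bound + slack / 2 * second_moment_bound + noise_bound\<^sup>2 * (real p)\<^sup>2 / (2 * slack)"
      using M2 by linarith
    have sq: "(real (X k \<omega>))\<^sup>2 = (L \<omega>)\<^sup>2 + 2 * (L \<omega> * mart k \<omega>) + (mart k \<omega>)\<^sup>2" for \<omega>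
      unfolding XL by (simp add: power2_sum)
    have "integrable M (\<lambda>\<omega>. (real (X k \<omega>))\<^sup>2)" unfolding sq using L2 LMi M2 by simp
    moreover have "expectation (\<lambda>\<omega>. (real (X k \<omega>))\<^sup>2) = expectation (\<lambda>\<omega>. (L \<omega>)\<^sup>2) + expectation (\<lambda>\<omega>. (mart k \<omega>)\<^sup>2)"
      unfolding sq using L2 LMi M2 LM by simp
    moreover have "(1 - slack) * second_moment_bound + noise_bound / slack
        + (noise_bound + slack / 2 * second_moment_bound + noise_bound\<^sup>2 * (real p)\<^sup>2 / (2 * slack))
        \<le> second_moment_bound"
    proof -
      have "slack / 2 * second_moment_bound = slack / 2 * B + K"
        unfolding second_moment_bound_def K_def[symmetric] using slack by (simp add: field_simps)
      moreover have "slack / 2 * B \<ge> 0" using slack B_nonneg by simp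
      ultimately have "K \<le> slack / 2 * second_moment_bound" by linarith
      then show ?thesis unfolding K_def by (simp add: algebra_simps)
    qed
    ultimately show ?thesis using EL EM by simp
  qed
qed

lemma X_square_integrable: "1 - int p \<le> k \<Longrightarrow> k \<le> int n \<Longrightarrow> integrable M (\<lambda>\<omega>. (real (X k \<omega>))\<^sup>2)"
  using second_moment by blast

lemma X_integrable: "1 - int p \<le> k \<Longrightarrow> k \<le> int n \<Longrightarrow> integrable M (\<lambda>\<omega>. real (X k \<omega>))"
  by (rule square_integrable_imp_integrable[OF X_measurable X_square_integrable])

lemma second_moment_bound_nonneg: "second_moment_bound \<ge> 0"
proof -
  have "0 \<le> expectation (\<lambda>\<omega>. (real (X 0 \<omega>))\<^sup>2)" by simp
  also have "\<dots> \<le> second_moment_bound" using p_pos second_moment[of 0] by auto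
  finally show ?thesis .
qed

lemma first_moment:
  assumes "1 - int p \<le> k" "k \<le> int n" shows "expectation (\<lambda>\<omega>. real (X k \<omega>)) \<le> 1 + second_moment_bound"
proof -
  have "expectation (\<lambda>\<omega>. real (X k \<omega>)) \<le> expectation (\<lambda>\<omega>. 1 + (real (X k \<omega>))\<^sup>2)"
    using X_integrable[OF assms] X_square_integrable[OF assms] le_one_plus_square by (intro integral_mono) auto
  also have "\<dots> = 1 + expectation (\<lambda>\<omega>. (real (X k \<omega>))\<^sup>2)"
    using X_square_integrable[OF assms] by (simp add: prob_space)
  finally show ?thesis using second_moment[OF assms] by linarith
qed

definition mart_bound :: real where
  "mart_bound = noise_bound * (1 + real p * (1 + second_moment_bound))"

lemma mart_bound_nonneg: "mart_bound \<ge> 0"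
  using noise_bound_ge_1 second_moment_bound_nonneg by (simp add: mart_bound_def)

lemma mart_mds:
  assumes t: "1 \<le> t" "t \<le> int n"
  shows "mds t (mart t)" "expectation (\<lambda>\<omega>. (mart t \<omega>)\<^sup>2) \<le> mart_bound"
proof -
  have Xi: "integrable M (\<lambda>\<omega>. real (X (t - int i) \<omega>))" "expectation (\<lambda>\<omega>. real (X (t - int i) \<omega>)) \<le> 1 + second_moment_bound"
    if "i \<in> {1..p}" for i using that t by (auto intro!: X_integrable first_moment)
  have int1: "integrable M (\<lambda>\<omega>. 1 * (1 + (\<Sum>i = 1..p. real (X (t - int i) \<omega>))))"
    unfolding mult_1 by (rule const_plus_sum(1)[OF Xi(1)])
  have M2: "integrable M (\<lambda>\<omega>. (mart t \<omega>)\<^sup>2)"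
    "expectation (\<lambda>\<omega>. (mart t \<omega>)\<^sup>2) \<le> noise_bound * expectation (\<lambda>\<omega>. 1 + (\<Sum>i = 1..p. real (X (t - int i) \<omega>)))"
    using mart_square[OF t _ _ int1] by simp_all
  show "mds t (mart t)" unfolding mds_def using mart_past[OF t] M2(1) mart_orthogonal[OF t] by blast
  have "expectation (\<lambda>\<omega>. 1 + (\<Sum>i = 1..p. real (X (t - int i) \<omega>))) = 1 + (\<Sum>i = 1..p. expectation (\<lambda>\<omega>. real (X (t - int i) \<omega>)))"
    by (rule const_plus_sum(2)[OF Xi(1)])
  also have "\<dots> \<le> 1 + (\<Sum>i = 1..p. 1 + second_moment_bound)" using Xi by (intro add_left_mono sum_mono)
  finally have "expectation (\<lambda>\<omega>. 1 + (\<Sum>i = 1..p. real (X (t - int i) \<omega>))) \<le> 1 + real p * (1 + second_moment_bound)" by simp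
  then have "noise_bound * expectation (\<lambda>\<omega>. 1 + (\<Sum>i = 1..p. real (X (t - int i) \<omega>))) \<le> mart_bound"
    unfolding mart_bound_def using noise_bound_ge_1 by (intro mult_left_mono) auto
  then show "expectation (\<lambda>\<omega>. (mart t \<omega>)\<^sup>2) \<le> mart_bound" using M2(2) by linarith
qed

end

section \<open>Averages over windows next to the change point\<close>

lemma sum_shift_one:
  fixes f :: "int \<Rightarrow> real"
  assumes "a \<le> b" shows "(\<Sum>t\<in>{a + 1..b}. f (t - 1)) = (\<Sum>t\<in>{a + 1..b}. f t) + f a - f b"
  using assms
proof (induction b rule: int_ge_induct)
  case (step b)
  then have "{a + 1..b + 1} = insert (b + 1) {a + 1..b}" by auto
  with step show ?case by simp
qed simp

lemma sum_shift:
  fixes f :: "int \<Rightarrow> real"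
  assumes "a \<le> b"
  shows "(\<Sum>t\<in>{a + 1..b}. f (t - int i)) = (\<Sum>t\<in>{a + 1..b}. f t) + (\<Sum>l<i. f (a - int l)) - (\<Sum>l<i. f (b - int l))"
proof (induction i)
  case (Suc i)
  have "(\<Sum>t\<in>{a + 1..b}. f (t - int (Suc i))) = (\<Sum>t\<in>{a + 1..b}. f ((t - 1) - int i))"
    by (intro sum.cong) (auto simp: algebra_simps)
  also have "\<dots> = (\<Sum>t\<in>{a + 1..b}. f (t - int i)) + f (a - int i) - f (b - int i)"
    by (rule sum_shift_one[OF assms, of "\<lambda>t. f (t - int i)"])
  finally show ?case using Suc by simp
qed simp

lemma sum_forward: "(\<Sum>j = 1..m. f (c + int j)) = (\<Sum>t\<in>{c + 1..c + int m}. f t)" for f :: "int \<Rightarrow> real"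
  by (rule sum.reindex_bij_witness[where i = "\<lambda>t. nat (t - c)" and j = "\<lambda>j. c + int j"]) auto

lemma sum_backward: "(\<Sum>j = 1..m. f (c + 1 - int j)) = (\<Sum>t\<in>{c - int m + 1..c}. f t)" for f :: "int \<Rightarrow> real"
  by (rule sum.reindex_bij_witness[where i = "\<lambda>t. nat (c + 1 - t)" and j = "\<lambda>j. c + 1 - int j"]) auto

context prob_space
begin

lemma uniform_forward:
  fixes f :: "int \<Rightarrow> 'a \<Rightarrow> real"
  assumes f: "\<And>t. t \<in> {c + 1..c + int N} \<Longrightarrow> f t \<in> borel_measurable M"
    "\<And>t. t \<in> {c + 1..c + int N} \<Longrightarrow> integrable M (\<lambda>x. (f t x)\<^sup>2)"
    "\<And>t. t \<in> {c + 1..c + int N} \<Longrightarrow> expectation (\<lambda>x. (f t x)\<^sup>2) \<le> C"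
    and w: "\<And>m. m \<in> {1..N} \<Longrightarrow> expectation (\<lambda>x. (\<Sum>t\<in>{c + 1..c + int m}. f t x)\<^sup>2) \<le> C * real m"
    and "\<delta> > 0" "R \<ge> 1" "C \<ge> 0"
  shows "prob {x \<in> space M. \<exists>m\<in>{R\<^sup>2..N}. \<bar>\<Sum>t\<in>{c + 1..c + int m}. f t x\<bar> > \<delta> * real m} \<le> 40 * C / (\<delta>\<^sup>2 * real R)"
proof -
  have eq: "(\<Sum>j = 1..m. f (c + int j) x) = (\<Sum>t\<in>{c + 1..c + int m}. f t x)" for m x
    by (rule sum_forward[where f = "\<lambda>t. f t x"])
  show ?thesis
    by (rule uniform_weak_law[of N "\<lambda>j. f (c + int j)" C \<delta> R, unfolded eq]) (use assms in auto)
qed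

lemma uniform_backward:
  fixes f :: "int \<Rightarrow> 'a \<Rightarrow> real"
  assumes f: "\<And>t. t \<in> {c - int N + 1..c} \<Longrightarrow> f t \<in> borel_measurable M"
    "\<And>t. t \<in> {c - int N + 1..c} \<Longrightarrow> integrable M (\<lambda>x. (f t x)\<^sup>2)"
    "\<And>t. t \<in> {c - int N + 1..c} \<Longrightarrow> expectation (\<lambda>x. (f t x)\<^sup>2) \<le> C"
    and w: "\<And>m. m \<in> {1..N} \<Longrightarrow> expectation (\<lambda>x. (\<Sum>t\<in>{c - int m + 1..c}. f t x)\<^sup>2) \<le> C * real m"
    and "\<delta> > 0" "R \<ge> 1" "C \<ge> 0"
  shows "prob {x \<in> space M. \<exists>m\<in>{R\<^sup>2..N}. \<bar>\<Sum>t\<in>{c - int m + 1..c}. f t x\<bar> > \<delta> * real m} \<le> 40 * C / (\<delta>\<^sup>2 * real R)"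
proof -
  have eq: "(\<Sum>j = 1..m. f (c + 1 - int j) x) = (\<Sum>t\<in>{c - int m + 1..c}. f t x)" for m x
    by (rule sum_backward[where f = "\<lambda>t. f t x"])
  show ?thesis
    by (rule uniform_weak_law[of N "\<lambda>j. f (c + 1 - int j)" C \<delta> R, unfolded eq]) (use assms in auto)
qed

end

context INAR_stable
begin

definition deviation_bound :: real where
  "deviation_bound = 2 * second_moment_bound + 2 * (noise_bound / slack\<^sup>2)"

definition window_bound :: real where
  "window_bound = deviation_bound + 3 * (2 * (deviation_bound * (real p)\<^sup>2) + mart_bound) / slack\<^sup>2"

lemma deviation_bound_nonneg: "deviation_bound \<ge> 0"
  using second_moment_bound_nonneg noise_bound_ge_1 by (simp add: deviation_bound_def)

lemma window_bound_ge: "window_bound \<ge> deviation_bound" "window_bound \<ge> 0"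
  using deviation_bound_nonneg mart_bound_nonneg by (auto simp: window_bound_def)

lemma deviation:
  assumes k: "1 - int p \<le> k" "k \<le> int n" and m: "m\<^sup>2 \<le> noise_bound"
  shows "integrable M (\<lambda>\<omega>. (real (X k \<omega>) - m / slack)\<^sup>2)"
    "expectation (\<lambda>\<omega>. (real (X k \<omega>) - m / slack)\<^sup>2) \<le> deviation_bound"
proof -
  have sq: "(real (X k \<omega>) - m / slack)\<^sup>2 = (real (X k \<omega>))\<^sup>2 - 2 * (m / slack) * real (X k \<omega>) + (m / slack)\<^sup>2" for \<omega>
    by (simp add: power2_diff)
  show int: "integrable M (\<lambda>\<omega>. (real (X k \<omega>) - m / slack)\<^sup>2)"
    unfolding sq using X_square_integrable[OF k] X_integrable[OF k] by simp
  have "(real (X k \<omega>) - m / slack)\<^sup>2 \<le> 2 * (real (X k \<omega>))\<^sup>2 + 2 * (m / slack)\<^sup>2" for \<omega>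
    using zero_le_power2[of "real (X k \<omega>) + m / slack"] by (simp add: power2_sum power2_diff)
  then have "expectation (\<lambda>\<omega>. (real (X k \<omega>) - m / slack)\<^sup>2) \<le> expectation (\<lambda>\<omega>. 2 * (real (X k \<omega>))\<^sup>2 + 2 * (m / slack)\<^sup>2)"
    using int X_square_integrable[OF k] by (intro integral_mono) auto
  also have "\<dots> = 2 * expectation (\<lambda>\<omega>. (real (X k \<omega>))\<^sup>2) + 2 * (m / slack)\<^sup>2"
    using X_square_integrable[OF k] by (simp add: prob_space)
  also have "\<dots> \<le> deviation_bound"
    unfolding deviation_bound_def power_divide using second_moment[OF k] m slack by (intro add_mono mult_left_mono divide_right_mono) auto
  finally show "expectation (\<lambda>\<omega>. (real (X k \<omega>) - m / slack)\<^sup>2) \<le> deviation_bound" .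
qed

text \<open>
  Summing the recursion over a window expresses the sum of the deviations through itself: shifting
  a window by \<open>i\<close> steps changes the sum by at most \<open>2 i\<close> terms at its ends. Solving for the sum
  leaves these end terms and the sum of the martingale differences. The values before the
  window enter only through the end terms, so the window may start right after the change.
\<close>

lemma window_pointwise:
  assumes ab: "a \<le> b" and m: "\<And>t. t \<in> {a + 1..b} \<Longrightarrow> mean (Innovation (nat t)) = m" and i: "i \<le> p"
  shows "slack * \<bar>\<Sum>t\<in>{a + 1..b}. real (X (t - int i) \<omega>) - m / slack\<bar>
    \<le> (\<Sum>l<p. \<bar>real (X (a - int l) \<omega>) - m / slack\<bar>) + (\<Sum>l<p. \<bar>real (X (b - int l) \<omega>) - m / slack\<bar>)
      + \<bar>\<Sum>t\<in>{a + 1..b}. mart t \<omega>\<bar>"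
proof -
  define d where "d = (\<lambda>t. real (X t \<omega>) - m / slack)"
  define W where "W = (\<lambda>i. \<Sum>t\<in>{a + 1..b}. d (t - int i))"
  define R where "R = (\<lambda>i. (\<Sum>l<i. d (a - int l)) - (\<Sum>l<i. d (b - int l)))"
  define A where "A = (\<Sum>l<p. \<bar>d (a - int l)\<bar>) + (\<Sum>l<p. \<bar>d (b - int l)\<bar>)"
  define S where "S = (\<Sum>t\<in>{a + 1..b}. mart t \<omega>)"
  have WR: "W i = W 0 + R i" for i unfolding W_def R_def using sum_shift[OF ab, of d i] by simp
  have RA: "\<bar>R i\<bar> \<le> A" if "i \<le> p" for i
  proof -
    have "\<bar>\<Sum>l<i. f l\<bar> \<le> (\<Sum>l<p. \<bar>f l\<bar>)" for f :: "nat \<Rightarrow> real"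
      using that by (intro order_trans[OF sum_abs] sum_mono2) auto
    from this[of "\<lambda>l. d (a - int l)"] this[of "\<lambda>l. d (b - int l)"] show ?thesis unfolding R_def A_def by linarith
  qed
  have "d t = (\<Sum>i = 1..p. \<alpha> i * d (t - int i)) + mart t \<omega>" if "t \<in> {a + 1..b}" for t
  proof -
    have "(\<Sum>i = 1..p. \<alpha> i * d (t - int i)) = (\<Sum>i = 1..p. \<alpha> i * real (X (t - int i) \<omega>)) - (1 - slack) * (m / slack)"
      unfolding d_def slack(3)[symmetric] sum_distrib_right right_diff_distrib sum_subtractf ..
    moreover have "(1 - slack) * (m / slack) = m / slack - m" using slack by (simp add: field_simps)
    ultimately show ?thesis using m[OF that] by (simp add: d_def mart_def)
  qed
  then have "W 0 = (\<Sum>t\<in>{a + 1..b}. (\<Sum>i = 1..p. \<alpha> i * d (t - int i)) + mart t \<omega>)"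
    unfolding W_def by simp
  also have "\<dots> = (\<Sum>i = 1..p. \<alpha> i * W i) + S"
    unfolding W_def S_def sum.distrib by (subst sum.swap) (simp add: sum_distrib_left)
  also have "(\<Sum>i = 1..p. \<alpha> i * W i) = (1 - slack) * W 0 + (\<Sum>i = 1..p. \<alpha> i * R i)"
  proof -
    have "\<alpha> i * W i = \<alpha> i * W 0 + \<alpha> i * R i" for i using WR[of i] by (metis distrib_left)
    then have "(\<Sum>i = 1..p. \<alpha> i * W i) = (\<Sum>i = 1..p. \<alpha> i * W 0 + \<alpha> i * R i)" by simp
    also have "\<dots> = (\<Sum>i = 1..p. \<alpha> i) * W 0 + (\<Sum>i = 1..p. \<alpha> i * R i)" by (simp only: sum.distrib sum_distrib_right)
    finally show ?thesis by (simp only: slack(3))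
  qed
  finally have W0: "slack * W 0 = (\<Sum>i = 1..p. \<alpha> i * R i) + S" by (simp add: algebra_simps)
  have "\<bar>\<Sum>i = 1..p. \<alpha> i * R i\<bar> \<le> (\<Sum>i = 1..p. \<alpha> i * A)"
    using RA coeff by (intro order_trans[OF sum_abs] sum_mono) (auto simp: abs_mult intro!: mult_left_mono)
  also have "\<dots> = (1 - slack) * A" by (simp only: sum_distrib_right[symmetric] slack(3))
  finally have 1: "\<bar>\<Sum>i = 1..p. \<alpha> i * R i\<bar> \<le> (1 - slack) * A" .
  have "slack * \<bar>W i\<bar> = \<bar>slack * W i\<bar>" using slack by (simp add: abs_mult)
  also have "slack * W i = slack * W 0 + slack * R i" using WR[of i] by (metis distrib_left)
  finally have "slack * \<bar>W i\<bar> = \<bar>slack * W 0 + slack * R i\<bar>" .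
  also have "\<dots> \<le> (1 - slack) * A + \<bar>S\<bar> + slack * \<bar>R i\<bar>" using W0 1 slack abs_mult[of slack "R i"] by linarith
  also have "\<dots> \<le> (1 - slack) * A + \<bar>S\<bar> + slack * A" using RA[OF i] slack by simp
  also have "\<dots> = A + \<bar>S\<bar>" by (simp add: algebra_simps)
  finally show ?thesis by (simp add: W_def A_def S_def d_def)
qed

lemma mart_window:
  assumes "0 \<le> a" "b \<le> int n"
  shows "integrable M (\<lambda>\<omega>. (\<Sum>t\<in>{a + 1..b}. mart t \<omega>)\<^sup>2)"
    "expectation (\<lambda>\<omega>. (\<Sum>t\<in>{a + 1..b}. mart t \<omega>)\<^sup>2) \<le> mart_bound * real (nat (b - a))"
  using mds_sum[of "{a + 1..b}" mart mart_bound] mart_mds assms by auto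

text \<open>
  The end terms in \<open>window_pointwise\<close> have bounded second moments, and the martingale differences are
  orthogonal, so the second moment grows linearly in the length of the window.
\<close>

lemma window_moment:
  assumes ab: "0 \<le> a" "a < b" "b \<le> int n" and m: "\<And>t. t \<in> {a + 1..b} \<Longrightarrow> mean (Innovation (nat t)) = m" and i: "i \<le> p"
  shows "expectation (\<lambda>\<omega>. (\<Sum>t\<in>{a + 1..b}. real (X (t - int i) \<omega>) - m / slack)\<^sup>2) \<le> window_bound * real (nat (b - a))"
proof -
  define Da where "Da = (\<lambda>c \<omega>. \<Sum>l<p. \<bar>real (X (c - int l) \<omega>) - m / slack\<bar>)"
  define S where "S = (\<lambda>\<omega>. \<Sum>t\<in>{a + 1..b}. mart t \<omega>)"
  have "nat b \<in> {1..n}" using ab by (simp add: nat_le_iff le_nat_iff)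
  from mean_innovation_square[OF this] have m2: "m\<^sup>2 \<le> noise_bound" using m[of b] ab by simp
  have Xm: "(\<lambda>\<omega>. real (X k \<omega>) - m / slack) \<in> borel_measurable M" if "1 - int p \<le> k" "k \<le> int n" for k
    using X_measurable[OF that] by simp
  have ED: "integrable M (\<lambda>\<omega>. (Da c \<omega>)\<^sup>2)" "expectation (\<lambda>\<omega>. (Da c \<omega>)\<^sup>2) \<le> deviation_bound * (real p)\<^sup>2" if c: "0 \<le> c" "c \<le> int n" for c
  proof -
    have k: "1 - int p \<le> c - int l" "c - int l \<le> int n" if "l < p" for l using that c by auto
    show "integrable M (\<lambda>\<omega>. (Da c \<omega>)\<^sup>2)" unfolding Da_def
      using deviation(1)[OF k m2] Xm[OF k] by (intro integrable_square_sum) auto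
    have "expectation (\<lambda>\<omega>. (Da c \<omega>)\<^sup>2) \<le> deviation_bound * (real (card {..<p}))\<^sup>2" unfolding Da_def
      using deviation[OF k m2] Xm[OF k] by (intro sum_square_expectation_le) auto
    then show "expectation (\<lambda>\<omega>. (Da c \<omega>)\<^sup>2) \<le> deviation_bound * (real p)\<^sup>2" by simp
  qed
  have Wm: "(\<lambda>\<omega>. \<Sum>t\<in>{a + 1..b}. real (X (t - int i) \<omega>) - m / slack) \<in> borel_measurable M"
    using ab i by (intro borel_measurable_sum Xm) auto
  have Wi: "integrable M (\<lambda>\<omega>. (\<Sum>t\<in>{a + 1..b}. real (X (t - int i) \<omega>) - m / slack)\<^sup>2)"
    using ab i by (intro integrable_square_sum Xm deviation(1) m2) auto
  have Ri: "integrable M (\<lambda>\<omega>. 3 * ((Da a \<omega>)\<^sup>2 + (Da b \<omega>)\<^sup>2 + (S \<omega>)\<^sup>2) / slack\<^sup>2)"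
    unfolding S_def using ED(1)[of a] ED(1)[of b] mart_window(1)[OF ab(1,3)] ab by simp
  have "expectation (\<lambda>\<omega>. (\<Sum>t\<in>{a + 1..b}. real (X (t - int i) \<omega>) - m / slack)\<^sup>2)
    \<le> expectation (\<lambda>\<omega>. 3 * ((Da a \<omega>)\<^sup>2 + (Da b \<omega>)\<^sup>2 + (S \<omega>)\<^sup>2) / slack\<^sup>2)"
  proof (rule integral_mono[OF Wi Ri])
    fix \<omega>
    define w where "w = \<bar>\<Sum>t\<in>{a + 1..b}. real (X (t - int i) \<omega>) - m / slack\<bar>"
    have "slack * w \<le> Da a \<omega> + Da b \<omega> + \<bar>S \<omega>\<bar>"
      unfolding w_def Da_def S_def using window_pointwise[OF _ m i, of a b \<omega>] ab by simp
    then have "(slack * w)\<^sup>2 \<le> (Da a \<omega> + Da b \<omega> + \<bar>S \<omega>\<bar>)\<^sup>2"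
      using slack by (intro power_mono) (auto simp: w_def)
    also have "\<dots> \<le> 3 * ((Da a \<omega>)\<^sup>2 + (Da b \<omega>)\<^sup>2 + (S \<omega>)\<^sup>2)"
      using sum_squares_bound[of "Da a \<omega>" "Da b \<omega>"] sum_squares_bound[of "Da a \<omega>" "\<bar>S \<omega>\<bar>"] sum_squares_bound[of "Da b \<omega>" "\<bar>S \<omega>\<bar>"]
      by (simp add: power2_eq_square algebra_simps)
    finally have "w\<^sup>2 \<le> 3 * ((Da a \<omega>)\<^sup>2 + (Da b \<omega>)\<^sup>2 + (S \<omega>)\<^sup>2) / slack\<^sup>2"
      using slack by (simp add: power_mult_distrib pos_le_divide_eq mult.commute)
    then show "(\<Sum>t\<in>{a + 1..b}. real (X (t - int i) \<omega>) - m / slack)\<^sup>2 \<le> 3 * ((Da a \<omega>)\<^sup>2 + (Da b \<omega>)\<^sup>2 + (S \<omega>)\<^sup>2) / slack\<^sup>2"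
      by (simp add: w_def)
  qed
  also have "\<dots> = 3 * (expectation (\<lambda>\<omega>. (Da a \<omega>)\<^sup>2) + expectation (\<lambda>\<omega>. (Da b \<omega>)\<^sup>2) + expectation (\<lambda>\<omega>. (S \<omega>)\<^sup>2)) / slack\<^sup>2"
    unfolding S_def using ED(1)[of a] ED(1)[of b] mart_window(1)[OF ab(1,3)] ab by simp
  also have "\<dots> \<le> 3 * (deviation_bound * (real p)\<^sup>2 + deviation_bound * (real p)\<^sup>2 + mart_bound * real (nat (b - a))) / slack\<^sup>2"
    unfolding S_def using ED(2)[of a] ED(2)[of b] mart_window(2)[OF ab(1,3)] ab
    by (intro divide_right_mono mult_left_mono add_mono) auto
  also have "\<dots> \<le> 3 * (2 * (deviation_bound * (real p)\<^sup>2) + mart_bound) / slack\<^sup>2 * real (nat (b - a))"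
  proof -
    have "deviation_bound * (real p)\<^sup>2 * 1 \<le> deviation_bound * (real p)\<^sup>2 * real (nat (b - a))"
      using ab deviation_bound_nonneg by (intro mult_left_mono) auto
    then show ?thesis using slack by (simp add: divide_simps) (simp add: algebra_simps)
  qed
  also have "\<dots> \<le> window_bound * real (nat (b - a))"
    unfolding window_bound_def using deviation_bound_nonneg by (intro mult_right_mono) auto
  finally show ?thesis .
qed

lemma mart_events: "1 \<le> t \<Longrightarrow> t \<le> int n \<Longrightarrow> mart t \<in> borel_measurable M"
  using measurable_past_events[OF mart_past] by blast

lemma X_window_after:
  assumes c: "0 \<le> c" and m: "\<And>t. t \<in> {c + 1..int n} \<Longrightarrow> mean (Innovation (nat t)) = m"
    and i: "i \<le> p" and N: "c + int N \<le> int n" and "\<delta> > 0" "R \<ge> 1"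
  shows "prob {\<omega> \<in> space M. \<exists>k\<in>{R\<^sup>2..N}. \<bar>\<Sum>t\<in>{c + 1..c + int k}. real (X (t - int i) \<omega>) - m / slack\<bar> > \<delta> * real k}
    \<le> 40 * window_bound / (\<delta>\<^sup>2 * real R)"
proof (cases "N = 0")
  case True
  then have "{R\<^sup>2..N} = {}" using assms by simp
  then show ?thesis using window_bound_ge by simp
next
  case False
  have m2: "m\<^sup>2 \<le> noise_bound" using mean_innovation_square[of n] m[of "int n"] False N c by simp
  show ?thesis
  proof (rule uniform_forward[OF _ _ _ _ \<open>\<delta> > 0\<close> \<open>R \<ge> 1\<close> window_bound_ge(2)])
    fix t assume t: "t \<in> {c + 1..c + int N}"
    then have k: "1 - int p \<le> t - int i" "t - int i \<le> int n" using c i N by auto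
    show "(\<lambda>\<omega>. real (X (t - int i) \<omega>) - m / slack) \<in> borel_measurable M" using X_measurable[OF k] by simp
    show "integrable M (\<lambda>\<omega>. (real (X (t - int i) \<omega>) - m / slack)\<^sup>2)" by (rule deviation(1)[OF k m2])
    show "expectation (\<lambda>\<omega>. (real (X (t - int i) \<omega>) - m / slack)\<^sup>2) \<le> window_bound"
      using deviation(2)[OF k m2] window_bound_ge(1) by linarith
  next
    fix k assume k: "k \<in> {1..N}"
    show "expectation (\<lambda>\<omega>. (\<Sum>t\<in>{c + 1..c + int k}. real (X (t - int i) \<omega>) - m / slack)\<^sup>2) \<le> window_bound * real k"
      using window_moment[OF c, of "c + int k" m i] k N i m by simp
  qed
qed

lemma X_window_before:
  assumes c: "c \<le> int n" and m: "\<And>t. t \<in> {1..c} \<Longrightarrow> mean (Innovation (nat t)) = m"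
    and i: "i \<le> p" and N: "int N \<le> c" and "\<delta> > 0" "R \<ge> 1"
  shows "prob {\<omega> \<in> space M. \<exists>k\<in>{R\<^sup>2..N}. \<bar>\<Sum>t\<in>{c - int k + 1..c}. real (X (t - int i) \<omega>) - m / slack\<bar> > \<delta> * real k}
    \<le> 40 * window_bound / (\<delta>\<^sup>2 * real R)"
proof (cases "N = 0")
  case True
  then have "{R\<^sup>2..N} = {}" using assms by simp
  then show ?thesis using window_bound_ge by simp
next
  case False
  have "nat c \<in> {1..n}" using False N c by (simp add: nat_le_iff le_nat_iff)
  from mean_innovation_square[OF this] have m2: "m\<^sup>2 \<le> noise_bound" using m[of c] False N by simp
  show ?thesis
  proof (rule uniform_backward[OF _ _ _ _ \<open>\<delta> > 0\<close> \<open>R \<ge> 1\<close> window_bound_ge(2)])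
    fix t assume t: "t \<in> {c - int N + 1..c}"
    then have k: "1 - int p \<le> t - int i" "t - int i \<le> int n" using c i N by auto
    show "(\<lambda>\<omega>. real (X (t - int i) \<omega>) - m / slack) \<in> borel_measurable M" using X_measurable[OF k] by simp
    show "integrable M (\<lambda>\<omega>. (real (X (t - int i) \<omega>) - m / slack)\<^sup>2)" by (rule deviation(1)[OF k m2])
    show "expectation (\<lambda>\<omega>. (real (X (t - int i) \<omega>) - m / slack)\<^sup>2) \<le> window_bound"
      using deviation(2)[OF k m2] window_bound_ge(1) by linarith
  next
    fix k assume k: "k \<in> {1..N}"
    show "expectation (\<lambda>\<omega>. (\<Sum>t\<in>{c - int k + 1..c}. real (X (t - int i) \<omega>) - m / slack)\<^sup>2) \<le> window_bound * real k"
      using window_moment[of "c - int k" c m i] k N i m c by simp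
  qed
qed

lemma mart_window_after:
  assumes c: "0 \<le> c" and N: "c + int N \<le> int n" and "\<delta> > 0" "R \<ge> 1"
  shows "prob {\<omega> \<in> space M. \<exists>k\<in>{R\<^sup>2..N}. \<bar>\<Sum>t\<in>{c + 1..c + int k}. mart t \<omega>\<bar> > \<delta> * real k}
    \<le> 40 * mart_bound / (\<delta>\<^sup>2 * real R)"
proof (rule uniform_forward[OF _ _ _ _ \<open>\<delta> > 0\<close> \<open>R \<ge> 1\<close> mart_bound_nonneg])
  fix t assume "t \<in> {c + 1..c + int N}"
  then have t: "1 \<le> t" "t \<le> int n" using c N by auto
  show "mart t \<in> borel_measurable M" by (rule mart_events[OF t])
  show "integrable M (\<lambda>\<omega>. (mart t \<omega>)\<^sup>2)" by (rule mdsD(2)[OF mart_mds(1)[OF t]])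
  show "expectation (\<lambda>\<omega>. (mart t \<omega>)\<^sup>2) \<le> mart_bound" by (rule mart_mds(2)[OF t])
next
  fix k assume k: "k \<in> {1..N}"
  show "expectation (\<lambda>\<omega>. (\<Sum>t\<in>{c + 1..c + int k}. mart t \<omega>)\<^sup>2) \<le> mart_bound * real k"
    using mart_window(2)[OF c, of "c + int k"] k N by simp
qed

lemma mart_window_before:
  assumes c: "c \<le> int n" and N: "int N \<le> c" and "\<delta> > 0" "R \<ge> 1"
  shows "prob {\<omega> \<in> space M. \<exists>k\<in>{R\<^sup>2..N}. \<bar>\<Sum>t\<in>{c - int k + 1..c}. mart t \<omega>\<bar> > \<delta> * real k}
    \<le> 40 * mart_bound / (\<delta>\<^sup>2 * real R)"
proof (rule uniform_backward[OF _ _ _ _ \<open>\<delta> > 0\<close> \<open>R \<ge> 1\<close> mart_bound_nonneg])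
  fix t assume "t \<in> {c - int N + 1..c}"
  then have t: "1 \<le> t" "t \<le> int n" using c N by auto
  show "mart t \<in> borel_measurable M" by (rule mart_events[OF t])
  show "integrable M (\<lambda>\<omega>. (mart t \<omega>)\<^sup>2)" by (rule mdsD(2)[OF mart_mds(1)[OF t]])
  show "expectation (\<lambda>\<omega>. (mart t \<omega>)\<^sup>2) \<le> mart_bound" by (rule mart_mds(2)[OF t])
next
  fix k assume k: "k \<in> {1..N}"
  show "expectation (\<lambda>\<omega>. (\<Sum>t\<in>{c - int k + 1..c}. mart t \<omega>)\<^sup>2) \<le> mart_bound * real k"
    using mart_window(2)[of "c - int k" c] k N c by simp
qed

definition truncated_bound :: real where
  "truncated_bound = noise_bound * (1 + (2 * real p + 1) * second_moment_bound)"

lemma truncated_bound_nonneg: "truncated_bound \<ge> 0"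
  using noise_bound_ge_1 second_moment_bound_nonneg by (simp add: truncated_bound_def)

text \<open>
  Truncation brings the product of noise and lagged value within reach of second moments of the
  process: the square of the truncated value is at most \<open>b\<close> times the value, and the conditional variance of
  the noise is linear in the lagged values.
\<close>

lemma truncated_mds:
  assumes t: "1 \<le> t" "t \<le> int n" and i: "i \<in> {1..p}" and b: "b \<ge> 1"
  defines "f \<equiv> (\<lambda>\<omega>. real (X (t - int i) \<omega>) * of_bool (real (X (t - int i) \<omega>) \<le> b))"
  shows "mds t (\<lambda>\<omega>. f \<omega> * mart t \<omega>)" "expectation (\<lambda>\<omega>. (f \<omega> * mart t \<omega>)\<^sup>2) \<le> truncated_bound * b"
proof -
  have k: "1 - int p \<le> t - int l" "t - int l \<le> int n" if "l \<in> {1..p}" for l using that t by auto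
  have fp: "f \<in> borel_measurable (past (t - 1))"
    unfolding f_def by (rule measurable_compose[OF X_past[of _ "t - 1"]]) (use i t in auto)
  then have f2p: "(\<lambda>\<omega>. (f \<omega>)\<^sup>2) \<in> borel_measurable (past (t - 1))" by simp
  have f0: "0 \<le> f \<omega>" for \<omega> by (simp add: f_def)
  have fle: "f \<omega> \<le> b" "f \<omega> \<le> real (X (t - int i) \<omega>)" for \<omega> using b by (auto simp: f_def)
  have f2m: "(\<lambda>\<omega>. (f \<omega>)\<^sup>2) \<in> borel_measurable M" by (rule measurable_past_events[OF f2p]) (use t in auto)
  let ?x = "\<lambda>l \<omega>. real (X (t - int l) \<omega>)"
  let ?U = "\<lambda>\<omega>. b * (1 + (?x i \<omega>)\<^sup>2 + (\<Sum>l = 1..p. (?x i \<omega>)\<^sup>2 + (?x l \<omega>)\<^sup>2))"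
  have dom: "(f \<omega>)\<^sup>2 * (1 + (\<Sum>l = 1..p. ?x l \<omega>)) \<le> ?U \<omega>" for \<omega>
  proof -
    have "(f \<omega>)\<^sup>2 \<le> b * ?x i \<omega>" unfolding power2_eq_square using fle f0 b by (intro mult_mono) auto
    then have "(f \<omega>)\<^sup>2 * (1 + (\<Sum>l = 1..p. ?x l \<omega>)) \<le> b * ?x i \<omega> * (1 + (\<Sum>l = 1..p. ?x l \<omega>))"
      by (intro mult_right_mono add_nonneg_nonneg sum_nonneg) auto
    also have "\<dots> = b * (?x i \<omega> + (\<Sum>l = 1..p. ?x i \<omega> * ?x l \<omega>))" by (simp add: distrib_left sum_distrib_left mult.assoc)
    also have "\<dots> \<le> b * ((1 + (?x i \<omega>)\<^sup>2) + (\<Sum>l = 1..p. (?x i \<omega>)\<^sup>2 + (?x l \<omega>)\<^sup>2))"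
    proof (intro mult_left_mono add_mono sum_mono)
      show "?x i \<omega> \<le> 1 + (?x i \<omega>)\<^sup>2" by (rule le_one_plus_square)
      fix l
      have "2 * (?x i \<omega> * ?x l \<omega>) \<le> (?x i \<omega>)\<^sup>2 + (?x l \<omega>)\<^sup>2" using sum_squares_bound[of "?x i \<omega>" "?x l \<omega>"] by (simp only: mult.assoc)
      moreover have "0 \<le> ?x i \<omega> * ?x l \<omega>" by simp
      ultimately show "?x i \<omega> * ?x l \<omega> \<le> (?x i \<omega>)\<^sup>2 + (?x l \<omega>)\<^sup>2" by linarith
    qed (use b in auto)
    finally show ?thesis .
  qed
  have x2: "integrable M (\<lambda>\<omega>. (?x l \<omega>)\<^sup>2)" if "l \<in> {1..p}" for l by (rule X_square_integrable[OF k[OF that]])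
  have x2s: "integrable M (\<lambda>\<omega>. (?x i \<omega>)\<^sup>2 + (?x l \<omega>)\<^sup>2)" if "l \<in> {1..p}" for l
    by (rule Bochner_Integration.integrable_add[OF x2[OF i] x2[OF that]])
  have x2sum: "integrable M (\<lambda>\<omega>. \<Sum>l = 1..p. (?x i \<omega>)\<^sup>2 + (?x l \<omega>)\<^sup>2)"
    by (rule Bochner_Integration.integrable_sum[OF x2s])
  have Ui: "integrable M ?U"
    by (intro integrable_mult_right Bochner_Integration.integrable_add x2sum x2[OF i]) simp
  have int: "integrable M (\<lambda>\<omega>. (f \<omega>)\<^sup>2 * (1 + (\<Sum>l = 1..p. ?x l \<omega>)))"
  proof (rule Bochner_Integration.integrable_bound[OF Ui])
    show "(\<lambda>\<omega>. (f \<omega>)\<^sup>2 * (1 + (\<Sum>l = 1..p. ?x l \<omega>))) \<in> borel_measurable M"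
      using X_measurable[OF k] by (intro borel_measurable_times borel_measurable_add borel_measurable_sum f2m borel_measurable_const) auto
    have nn: "0 \<le> (f \<omega>)\<^sup>2 * (1 + (\<Sum>l = 1..p. ?x l \<omega>))" for \<omega> by (intro mult_nonneg_nonneg add_nonneg_nonneg sum_nonneg) auto
    show "AE \<omega> in M. norm ((f \<omega>)\<^sup>2 * (1 + (\<Sum>l = 1..p. ?x l \<omega>))) \<le> norm (?U \<omega>)"
    proof (rule AE_I2)
      fix \<omega> show "norm ((f \<omega>)\<^sup>2 * (1 + (\<Sum>l = 1..p. ?x l \<omega>))) \<le> norm (?U \<omega>)"
        using dom[of \<omega>] nn[of \<omega>] by (simp only: real_norm_def)
    qed
  qed
  note sq = mart_square[OF t f2p zero_le_power2 int]
  have "integrable M (\<lambda>\<omega>. (f \<omega> * mart t \<omega>)\<^sup>2)" using sq(1) by (simp add: power_mult_distrib)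
  then show "mds t (\<lambda>\<omega>. f \<omega> * mart t \<omega>)" by (rule mds_mult[OF mart_mds(1)[OF t] fp])
  have "expectation (\<lambda>\<omega>. (f \<omega> * mart t \<omega>)\<^sup>2) \<le> noise_bound * expectation (\<lambda>\<omega>. (f \<omega>)\<^sup>2 * (1 + (\<Sum>l = 1..p. ?x l \<omega>)))"
    using sq(2) by (simp add: power_mult_distrib)
  also have "\<dots> \<le> noise_bound * expectation ?U" using noise_bound_ge_1 by (intro mult_left_mono integral_mono int Ui dom) auto
  also have "expectation ?U = b * (1 + expectation (\<lambda>\<omega>. (?x i \<omega>)\<^sup>2) + (\<Sum>l = 1..p. expectation (\<lambda>\<omega>. (?x i \<omega>)\<^sup>2) + expectation (\<lambda>\<omega>. (?x l \<omega>)\<^sup>2)))"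
  proof -
    have "expectation (\<lambda>\<omega>. \<Sum>l = 1..p. (?x i \<omega>)\<^sup>2 + (?x l \<omega>)\<^sup>2) = (\<Sum>l = 1..p. expectation (\<lambda>\<omega>. (?x i \<omega>)\<^sup>2 + (?x l \<omega>)\<^sup>2))"
      by (rule Bochner_Integration.integral_sum[OF x2s])
    also have "\<dots> = (\<Sum>l = 1..p. expectation (\<lambda>\<omega>. (?x i \<omega>)\<^sup>2) + expectation (\<lambda>\<omega>. (?x l \<omega>)\<^sup>2))"
      by (rule sum.cong[OF refl], rule Bochner_Integration.integral_add[OF x2[OF i] x2])
    finally show ?thesis using x2sum x2[OF i] by (simp add: prob_space)
  qed
  also have "\<dots> \<le> b * (1 + second_moment_bound + (\<Sum>l = 1..p. second_moment_bound + second_moment_bound))"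
    using second_moment[OF k] i b by (intro mult_left_mono add_mono sum_mono) auto
  also have "\<dots> = b * (1 + (2 * real p + 1) * second_moment_bound)" by (simp add: algebra_simps)
  finally show "expectation (\<lambda>\<omega>. (f \<omega> * mart t \<omega>)\<^sup>2) \<le> truncated_bound * b"
    using noise_bound_ge_1 by (simp add: truncated_bound_def mult_ac)
qed

text \<open>
  Either some lagged value exceeds \<open>b\<close>, or the truncated sum of orthogonal terms is large. The choice
  \<open>b = n powr (3/4)\<close> makes both contributions vanish.
\<close>

lemma mart_lag_tail:
  assumes i: "i \<in> {1..p}" and b: "b \<ge> 1" and delta: "\<delta> > 0" and n: "n \<ge> 1"
  shows "prob {\<omega> \<in> space M. \<bar>\<Sum>t\<in>{1..int n}. real (X (t - int i) \<omega>) * mart t \<omega>\<bar> > \<delta> * real n}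
    \<le> real n * (second_moment_bound / b\<^sup>2) + truncated_bound * b / (\<delta>\<^sup>2 * real n)"
proof -
  define f where "f = (\<lambda>t \<omega>. real (X (t - int i) \<omega>) * of_bool (real (X (t - int i) \<omega>) \<le> b))"
  define E1 where "E1 = {\<omega> \<in> space M. \<bar>\<Sum>t\<in>{1..int n}. f t \<omega> * mart t \<omega>\<bar> > \<delta> * real n}"
  define E2 where "E2 = (\<lambda>t. {\<omega> \<in> space M. \<bar>real (X (t - int i) \<omega>)\<bar> > b})"
  have k: "1 - int p \<le> t - int i" "t - int i \<le> int n" if "t \<in> {1..int n}" for t using that i by auto
  have md: "mds t (\<lambda>\<omega>. f t \<omega> * mart t \<omega>)" "expectation (\<lambda>\<omega>. (f t \<omega> * mart t \<omega>)\<^sup>2) \<le> truncated_bound * b"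
    if "t \<in> {1..int n}" for t
    unfolding f_def using truncated_mds[OF _ _ i b, of t] that by auto
  have "(\<lambda>\<omega>. \<Sum>t\<in>{1..int n}. f t \<omega> * mart t \<omega>) \<in> borel_measurable M"
    by (intro borel_measurable_sum mds_measurable[OF md(1)]) auto
  then have E1m: "E1 \<in> events" unfolding E1_def by measurable
  have E2m: "E2 t \<in> events" if "t \<in> {1..int n}" for t
    unfolding E2_def using X_measurable[OF k[OF that]] by measurable
  have E1p: "prob E1 \<le> truncated_bound * b / (\<delta>\<^sup>2 * real n)"
    unfolding E1_def by (rule mds_tail) (use md truncated_bound_nonneg b delta n in auto)
  have E2p: "prob (E2 t) \<le> second_moment_bound / b\<^sup>2" if "t \<in> {1..int n}" for t
    unfolding E2_def using X_measurable[OF k[OF that]] second_moment[OF k[OF that]] b by (intro square_tail) auto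
  have "{\<omega> \<in> space M. \<bar>\<Sum>t\<in>{1..int n}. real (X (t - int i) \<omega>) * mart t \<omega>\<bar> > \<delta> * real n} \<subseteq> E1 \<union> (\<Union>t\<in>{1..int n}. E2 t)"
  proof (rule subsetI, rule ccontr)
    fix \<omega> assume w: "\<omega> \<in> {\<omega> \<in> space M. \<bar>\<Sum>t\<in>{1..int n}. real (X (t - int i) \<omega>) * mart t \<omega>\<bar> > \<delta> * real n}"
      and no: "\<omega> \<notin> E1 \<union> (\<Union>t\<in>{1..int n}. E2 t)"
    have "f t \<omega> = real (X (t - int i) \<omega>)" if "t \<in> {1..int n}" for t
      using no w that by (auto simp: E2_def f_def not_less)
    then have "(\<Sum>t\<in>{1..int n}. real (X (t - int i) \<omega>) * mart t \<omega>) = (\<Sum>t\<in>{1..int n}. f t \<omega> * mart t \<omega>)"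
      by (intro sum.cong) auto
    then show False using no w by (auto simp: E1_def)
  qed
  then have "prob {\<omega> \<in> space M. \<bar>\<Sum>t\<in>{1..int n}. real (X (t - int i) \<omega>) * mart t \<omega>\<bar> > \<delta> * real n} \<le> prob (E1 \<union> (\<Union>t\<in>{1..int n}. E2 t))"
    using E1m E2m by (intro finite_measure_mono sets.Un sets.finite_UN) auto
  also have "\<dots> \<le> prob E1 + prob (\<Union>t\<in>{1..int n}. E2 t)" using E1m E2m by (intro measure_Un_le sets.finite_UN) auto
  also have "prob (\<Union>t\<in>{1..int n}. E2 t) \<le> (\<Sum>t\<in>{1..int n}. second_moment_bound / b\<^sup>2)"
    using E2m E2p by (intro prob_UN_le) auto
  finally show ?thesis using E1p by simp
qed

end

section \<open>Bounded test variables\<close>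

context INAR_stable
begin

lemma hit_mds:
  assumes t: "1 \<le> t" "t \<le> int n" and s: "s \<in> noise_at t"
  shows "mds t (\<lambda>\<omega>. hit s q (noise \<xi> \<epsilon> s \<omega>))" "expectation (\<lambda>\<omega>. (hit s q (noise \<xi> \<epsilon> s \<omega>))\<^sup>2) \<le> 1"
proof -
  have m: "(\<lambda>\<omega>. hit s q (noise \<xi> \<epsilon> s \<omega>)) \<in> borel_measurable M"
    by (rule measurable_past_events[OF hit_past[OF s] t(2)])
  have le: "(hit s q k)\<^sup>2 \<le> 1" for k using hit_le_1[of s q k] by (simp add: abs_square_le_1)
  have i: "integrable M (\<lambda>\<omega>. (hit s q (noise \<xi> \<epsilon> s \<omega>))\<^sup>2)"
    by (rule integrable_const_bound[where B = 1]) (use m le in auto)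
  then show "mds t (\<lambda>\<omega>. hit s q (noise \<xi> \<epsilon> s \<omega>))"
    unfolding mds_def using hit_past[OF s] hit_orthogonal[OF t _ s] by blast
  have "expectation (\<lambda>\<omega>. (hit s q (noise \<xi> \<epsilon> s \<omega>))\<^sup>2) \<le> expectation (\<lambda>\<omega>. 1)"
    by (rule integral_mono[OF i]) (use le in auto)
  then show "expectation (\<lambda>\<omega>. (hit s q (noise \<xi> \<epsilon> s \<omega>))\<^sup>2) \<le> 1" by (simp add: prob_space)
qed

lemma kappa_le: 
  assumes s: "s \<in> noise_indices p n" shows "\<bar>kappa s q\<bar> \<le> 1 + noise_bound"
proof -
  have "\<bar>kappa s q\<bar> \<le> measure_pmf.expectation (law s) (\<lambda>x. \<bar>hit s q x * centred s x\<bar>)"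
    unfolding kappa_def by (rule integral_abs_bound)
  also have "\<dots> \<le> measure_pmf.expectation (law s) (\<lambda>x. 1 + (centred s x)\<^sup>2)"
  proof (rule integral_mono)
    show "integrable (law s) (\<lambda>x. \<bar>hit s q x * centred s x\<bar>)" using hit_centred_integrable[OF s] by simp
    show "integrable (law s) (\<lambda>x. 1 + (centred s x)\<^sup>2)" using centred_moments(3)[OF s] by simp
    fix x
    have "\<bar>hit s q x * centred s x\<bar> \<le> 1 * \<bar>centred s x\<bar>" unfolding abs_mult using hit_le_1 by (intro mult_right_mono) auto
    also have "\<dots> \<le> 1 + (centred s x)\<^sup>2"
    proof -
      have "2 * \<bar>centred s x\<bar> * 1 \<le> \<bar>centred s x\<bar>\<^sup>2 + 1\<^sup>2" by (rule sum_squares_bound)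
      then show ?thesis using abs_ge_zero[of "centred s x"] by simp
    qed
    finally show "\<bar>hit s q x * centred s x\<bar> \<le> 1 + (centred s x)\<^sup>2" .
  qed
  also have "\<dots> = 1 + measure_pmf.expectation (law s) (\<lambda>x. (centred s x)\<^sup>2)" using centred_moments(3)[OF s] by simp
  also have "\<dots> \<le> 1 + noise_bound" using centred_moments(4)[OF s] by simp
  finally show ?thesis .
qed

definition product_bound :: real where
  "product_bound = 2 * mart_bound + 2 * (1 + noise_bound)\<^sup>2"

lemma product_bound_nonneg: "product_bound \<ge> 0"
  using mart_bound_nonneg by (simp add: product_bound_def)

end

text \<open>
  A noise variable \<open>src t\<close> for each step, with a weight that is known one step before and vanishes unless the
  variable takes part in the step.
\<close>

locale INAR_test = INAR_stable +
  fixes src :: "int \<Rightarrow> noise_index" and q :: nat and weight :: "int \<Rightarrow> 'a \<Rightarrow> real"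
  assumes tau_less: "\<tau> < n"
    and weight_past: "\<And>t. t \<in> {int p + 1..int \<tau> - int p} \<Longrightarrow> weight t \<in> borel_measurable (past (t - 1))"
    and weight_range: "\<And>t \<omega>. 0 \<le> weight t \<omega>" "\<And>t \<omega>. weight t \<omega> \<le> 1"
    and src: "\<And>t. t \<in> {int p + 1..int \<tau> - int p} \<Longrightarrow> src t \<in> noise_at t"
    and src_active: "\<And>t \<omega>. t \<in> {int p + 1..int \<tau> - int p} \<Longrightarrow> \<omega> \<in> space M \<Longrightarrow> weight t \<omega> \<noteq> 0 \<Longrightarrow> src t \<in> active t (lags t \<omega>)"
begin

abbreviation "core \<equiv> {int p + 1..int \<tau> - int p}"

definition test :: "int \<Rightarrow> 'a \<Rightarrow> real" where
  "test t \<omega> = (if t \<in> core then weight t \<omega> * hit (src t) q (noise \<xi> \<epsilon> (src t) \<omega>) else 0)"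

lemma core: "t \<in> core \<Longrightarrow> 1 \<le> t \<and> t \<le> int n"
  using tau_less by auto

lemma test_le_1: "\<bar>test t \<omega>\<bar> \<le> 1"
proof -
  have "\<bar>weight t \<omega> * hit (src t) q (noise \<xi> \<epsilon> (src t) \<omega>)\<bar> \<le> 1 * 1"
    unfolding abs_mult using weight_range hit_le_1 by (intro mult_mono) (auto simp: abs_of_nonneg)
  then show ?thesis by (simp add: test_def)
qed

lemma test_eq: "t \<in> core \<Longrightarrow> test t = (\<lambda>\<omega>. weight t \<omega> * hit (src t) q (noise \<xi> \<epsilon> (src t) \<omega>))"
  by (auto simp: test_def)

lemma test_past:
  assumes t: "t \<in> core" shows "test t \<in> borel_measurable (past t)"
  unfolding test_eq[OF t]
  by (intro borel_measurable_times hit_past src t measurable_past_mono[OF weight_past[OF t]]) simp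

lemma test_events: "t \<in> core \<Longrightarrow> test t \<in> borel_measurable M"
  using measurable_past_events[OF test_past] core by auto

lemma test_square_le: "(test t \<omega>)\<^sup>2 \<le> 1"
  using test_le_1[of t \<omega>] by (simp add: abs_square_le_1)

lemma test_mds:
  assumes t: "t \<in> core"
  shows "mds t (test t)" "expectation (\<lambda>\<omega>. (test t \<omega>)\<^sup>2) \<le> 1"
proof -
  have t': "1 \<le> t" "t \<le> int n" using core[OF t] by auto
  have i: "integrable M (\<lambda>\<omega>. (test t \<omega>)\<^sup>2)"
    by (rule integrable_const_bound[where B = 1]) (use test_events[OF t] test_square_le in auto)
  then show "mds t (test t)" unfolding test_eq[OF t]
    by (intro mds_mult hit_mds[OF t' src[OF t]] weight_past[OF t])
  have "expectation (\<lambda>\<omega>. (test t \<omega>)\<^sup>2) \<le> expectation (\<lambda>\<omega>. 1)"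
    by (rule integral_mono[OF i]) (use test_square_le in auto)
  then show "expectation (\<lambda>\<omega>. (test t \<omega>)\<^sup>2) \<le> 1" by (simp add: prob_space)
qed

lemma bounded_times_mart:
  assumes f: "f \<in> borel_measurable M" "\<And>\<omega>. \<bar>f \<omega>\<bar> \<le> 1" and s: "1 \<le> s" "s \<le> int n"
  shows "integrable M (\<lambda>\<omega>. (f \<omega> * mart s \<omega>)\<^sup>2)" "expectation (\<lambda>\<omega>. (f \<omega> * mart s \<omega>)\<^sup>2) \<le> mart_bound"
proof -
  have m2: "integrable M (\<lambda>\<omega>. (mart s \<omega>)\<^sup>2)" by (rule mdsD(2)[OF mart_mds(1)[OF s]])
  have le: "(f \<omega> * mart s \<omega>)\<^sup>2 \<le> (mart s \<omega>)\<^sup>2" for \<omega>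
  proof -
    have "(f \<omega>)\<^sup>2 * (mart s \<omega>)\<^sup>2 \<le> 1 * (mart s \<omega>)\<^sup>2" using f(2)[of \<omega>] by (intro mult_right_mono) (auto simp: abs_square_le_1)
    then show ?thesis by (simp add: power_mult_distrib)
  qed
  show i: "integrable M (\<lambda>\<omega>. (f \<omega> * mart s \<omega>)\<^sup>2)"
    by (rule Bochner_Integration.integrable_bound[OF m2]) (use f(1) mart_events[OF s] le in auto)
  have "expectation (\<lambda>\<omega>. (f \<omega> * mart s \<omega>)\<^sup>2) \<le> expectation (\<lambda>\<omega>. (mart s \<omega>)\<^sup>2)" by (rule integral_mono[OF i m2 le])
  also have "\<dots> \<le> mart_bound" by (rule mart_mds(2)[OF s])
  finally show "expectation (\<lambda>\<omega>. (f \<omega> * mart s \<omega>)\<^sup>2) \<le> mart_bound" .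
qed

lemma test_sum_tail:
  assumes "\<delta> > 0"
  shows "prob {\<omega> \<in> space M. \<bar>\<Sum>t\<in>core. test t \<omega>\<bar> > \<delta> * real n} \<le> 1 / (\<delta>\<^sup>2 * real n)"
  by (rule mds_tail) (use test_mds core assms tau_less in auto)

lemma test_mart_earlier_tail:
  assumes delta: "\<delta> > 0" and r: "1 \<le> r" "r \<le> int p"
  shows "prob {\<omega> \<in> space M. \<bar>\<Sum>t\<in>core. test t \<omega> * mart (t - r) \<omega>\<bar> > \<delta> * real n} \<le> mart_bound / (\<delta>\<^sup>2 * real n)"
proof -
  have 1: "mds t (\<lambda>\<omega>. test t \<omega> * mart (t - r) \<omega>)" and 2: "expectation (\<lambda>\<omega>. (test t \<omega> * mart (t - r) \<omega>)\<^sup>2) \<le> mart_bound" if t: "t \<in> core" for t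
  proof -
    have s: "1 \<le> t - r" "t - r \<le> int n" using t r tau_less by auto
    note b = bounded_times_mart[OF test_events[OF t] test_le_1 s]
    show "expectation (\<lambda>\<omega>. (test t \<omega> * mart (t - r) \<omega>)\<^sup>2) \<le> mart_bound" by (rule b(2))
    have "mart (t - r) \<in> borel_measurable (past (t - 1))" by (rule measurable_past_mono[OF mart_past[OF s]]) (use r in simp)
    then have "mds t (\<lambda>\<omega>. mart (t - r) \<omega> * test t \<omega>)" using b(1) by (intro mds_mult test_mds(1)[OF t]) (simp_all add: mult.commute)
    then show "mds t (\<lambda>\<omega>. test t \<omega> * mart (t - r) \<omega>)" by (simp add: mult.commute)
  qed
  show ?thesis by (rule mds_tail) (use 1 2 core mart_bound_nonneg delta tau_less in auto)
qed

lemma test_mart_later_tail: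
  assumes delta: "\<delta> > 0" and r: "1 \<le> r" "r \<le> int p"
  shows "prob {\<omega> \<in> space M. \<bar>\<Sum>t\<in>core. test t \<omega> * mart (t + r) \<omega>\<bar> > \<delta> * real n} \<le> mart_bound / (\<delta>\<^sup>2 * real n)"
proof -
  let ?I = "{int p + 1 + r..int \<tau> - int p + r}"
  have 1: "mds t (\<lambda>\<omega>. test (t - r) \<omega> * mart t \<omega>)" and 2: "expectation (\<lambda>\<omega>. (test (t - r) \<omega> * mart t \<omega>)\<^sup>2) \<le> mart_bound" if t: "t \<in> ?I" for t
  proof -
    have s: "1 \<le> t" "t \<le> int n" "t - r \<in> core" using t r tau_less by auto
    note b = bounded_times_mart[OF test_events[OF s(3)] test_le_1 s(1,2)]
    show "expectation (\<lambda>\<omega>. (test (t - r) \<omega> * mart t \<omega>)\<^sup>2) \<le> mart_bound" by (rule b(2))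
    have "test (t - r) \<in> borel_measurable (past (t - 1))" by (rule measurable_past_mono[OF test_past[OF s(3)]]) (use r in simp)
    then show "mds t (\<lambda>\<omega>. test (t - r) \<omega> * mart t \<omega>)" using b(1) by (intro mds_mult mart_mds(1)[OF s(1,2)])
  qed
  have "(\<Sum>t\<in>core. test t \<omega> * mart (t + r) \<omega>) = (\<Sum>t\<in>?I. test (t - r) \<omega> * mart t \<omega>)" for \<omega>
    by (rule sum.reindex_bij_witness[where i = "\<lambda>t. t - r" and j = "\<lambda>t. t + r"]) auto
  moreover have "prob {\<omega> \<in> space M. \<bar>\<Sum>t\<in>?I. test (t - r) \<omega> * mart t \<omega>\<bar> > \<delta> * real n} \<le> mart_bound / (\<delta>\<^sup>2 * real n)"
    by (rule mds_tail) (use 1 2 r mart_bound_nonneg delta tau_less in auto)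
  ultimately show ?thesis by simp
qed

text \<open>
  The product of test variable and noise of the same step has conditional mean \<open>kappa\<close> times
  the weight, by \<open>hit_mart_orthogonal\<close>; the differences are orthogonal.
\<close>

lemma test_mart_same_tail:
  assumes delta: "\<delta> > 0"
  shows "prob {\<omega> \<in> space M. \<bar>\<Sum>t\<in>core. test t \<omega> * mart t \<omega> - kappa (src t) q * weight t \<omega>\<bar> > \<delta> * real n} \<le> product_bound / (\<delta>\<^sup>2 * real n)"
proof -
  have 1: "mds t (\<lambda>\<omega>. test t \<omega> * mart t \<omega> - kappa (src t) q * weight t \<omega>)"
    and 2: "expectation (\<lambda>\<omega>. (test t \<omega> * mart t \<omega> - kappa (src t) q * weight t \<omega>)\<^sup>2) \<le> product_bound" if t: "t \<in> core" for t
  proof -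
    have s: "1 \<le> t" "t \<le> int n" using core[OF t] by auto
    have sn: "src t \<in> noise_indices p n" using src[OF t] noise_at_subset[OF s(2)] by blast
    let ?D = "\<lambda>\<omega>. test t \<omega> * mart t \<omega> - kappa (src t) q * weight t \<omega>"
    have D_eq: "?D \<omega> = weight t \<omega> * (hit (src t) q (noise \<xi> \<epsilon> (src t) \<omega>) * mart t \<omega> - kappa (src t) q)" for \<omega>
      using t by (simp add: test_def algebra_simps)
    note b = bounded_times_mart[OF test_events[OF t] test_le_1 s]
    have wp: "weight t \<in> borel_measurable (past t)" by (rule measurable_past_mono[OF weight_past[OF t]]) simp
    have Dp: "?D \<in> borel_measurable (past t)"
      by (intro borel_measurable_diff borel_measurable_times test_past[OF t] mart_past[OF s] wp borel_measurable_const)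
    have Dm: "?D \<in> borel_measurable M" by (rule measurable_past_events[OF Dp s(2)])
    let ?U = "\<lambda>\<omega>. 2 * (test t \<omega> * mart t \<omega>)\<^sup>2 + 2 * (1 + noise_bound)\<^sup>2"
    have Ui: "integrable M ?U" using b(1) by simp
    have le: "(?D \<omega>)\<^sup>2 \<le> ?U \<omega>" for \<omega>
    proof -
      have "(?D \<omega>)\<^sup>2 \<le> 2 * (test t \<omega> * mart t \<omega>)\<^sup>2 + 2 * (kappa (src t) q * weight t \<omega>)\<^sup>2"
        using zero_le_power2[of "test t \<omega> * mart t \<omega> + kappa (src t) q * weight t \<omega>"] by (simp add: power2_sum power2_diff)
      moreover have "\<bar>kappa (src t) q * weight t \<omega>\<bar> \<le> (1 + noise_bound) * 1"
        unfolding abs_mult using kappa_le[OF sn] weight_range noise_bound_ge_1 by (intro mult_mono) (auto simp: abs_of_nonneg)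
      then have "(kappa (src t) q * weight t \<omega>)\<^sup>2 \<le> (1 + noise_bound)\<^sup>2"
        by (metis abs_ge_zero mult_1_right power2_abs power_mono)
      ultimately show ?thesis by linarith
    qed
    have Di: "integrable M (\<lambda>\<omega>. (?D \<omega>)\<^sup>2)"
      by (rule Bochner_Integration.integrable_bound[OF Ui]) (use Dm le in \<open>auto intro!: AE_I2 order_trans[OF le]\<close>)
    have "expectation (\<lambda>\<omega>. (?D \<omega>)\<^sup>2) \<le> expectation ?U" by (rule integral_mono[OF Di Ui le])
    also have "\<dots> = 2 * expectation (\<lambda>\<omega>. (test t \<omega> * mart t \<omega>)\<^sup>2) + 2 * (1 + noise_bound)\<^sup>2" using b(1) by (simp add: prob_space)
    also have "\<dots> \<le> product_bound" using b(2) by (simp add: product_bound_def)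
    finally show "expectation (\<lambda>\<omega>. (?D \<omega>)\<^sup>2) \<le> product_bound" .
    show "mds t ?D"
      unfolding mds_def
    proof (intro conjI ballI impI Dp Di)
      fix G assume G: "G \<in> borel_measurable (past (t - 1))" and int: "integrable M (\<lambda>\<omega>. G \<omega> * ?D \<omega>)"
      let ?H = "\<lambda>\<omega>. G \<omega> * weight t \<omega>"
      have eq: "G \<omega> * ?D \<omega> = ?H \<omega> * (hit (src t) q (noise \<xi> \<epsilon> (src t) \<omega>) * mart t \<omega> - kappa (src t) q)" for \<omega>
        unfolding D_eq by simp
      have "?H \<in> borel_measurable (past (t - 1))" using G weight_past[OF t] by (rule borel_measurable_times)
      then show "expectation (\<lambda>\<omega>. G \<omega> * ?D \<omega>) = 0"
        using int unfolding eq by (intro hit_mart_orthogonal[OF s _ src[OF t]]) (auto intro: src_active[OF t])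
    qed
  qed
  show ?thesis by (rule mds_tail) (use 1 2 core product_bound_nonneg delta tau_less in auto)
qed

end

section \<open>Good paths are likely\<close>

context INAR_stable
begin

text \<open>
  A bound for the probability that a path with sufficient weights is not good, with truncation level
  \<open>b\<close> as in \<open>mart_lag_tail\<close>. The first two terms do not vanish as \<open>n\<close> grows; they are of order \<open>1 / R\<close>.
\<close>

definition failure_bound :: "real \<Rightarrow> nat \<Rightarrow> real \<Rightarrow> real \<Rightarrow> real" where
  "failure_bound \<delta> R \<kappa> b =
     2 * (real p * (40 * window_bound / (\<delta>\<^sup>2 * real R))) + 2 * (40 * mart_bound / (\<delta>\<^sup>2 * real R))
     + real p * (real n * (second_moment_bound / b\<^sup>2) + truncated_bound * b / (\<delta>\<^sup>2 * real n))
     + 1 / (\<delta>\<^sup>2 * real n) + 2 * (real p * (mart_bound / (\<delta>\<^sup>2 * real n)))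
     + product_bound / (\<kappa>\<^sup>2 * real n)"

end

context INAR_test
begin

lemma window_event:
  fixes f :: "int \<Rightarrow> 'a \<Rightarrow> real"
  assumes "\<And>k t. k \<in> {a..b} \<Longrightarrow> t \<in> I k \<Longrightarrow> f t \<in> borel_measurable M"
  shows "{\<omega> \<in> space M. \<exists>k\<in>{a..b::nat}. \<bar>\<Sum>t\<in>I k. f t \<omega>\<bar> > c k} \<in> events"
proof -
  have "{\<omega> \<in> space M. \<bar>\<Sum>t\<in>I k. f t \<omega>\<bar> > c k} \<in> events" if "k \<in> {a..b}" for k
    using borel_measurable_sum[of "I k" f M] assms[OF that] by measurable
  moreover have "{\<omega> \<in> space M. \<exists>k\<in>{a..b::nat}. \<bar>\<Sum>t\<in>I k. f t \<omega>\<bar> > c k} = (\<Union>k\<in>{a..b}. {\<omega> \<in> space M. \<bar>\<Sum>t\<in>I k. f t \<omega>\<bar> > c k})"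
    by auto
  ultimately show ?thesis by auto
qed

lemma sum_event:
  fixes f :: "int \<Rightarrow> 'a \<Rightarrow> real"
  assumes "\<And>t. t \<in> I \<Longrightarrow> f t \<in> borel_measurable M"
  shows "{\<omega> \<in> space M. \<bar>\<Sum>t\<in>I. f t \<omega>\<bar> > c} \<in> events"
  using borel_measurable_sum[of I f M] assms by measurable

text \<open>
  Each requirement on a good path fails with a probability bounded by one of the tail estimates.
  The sum of the weights remains a hypothesis, because the reason for it depends on how the test variables are chosen.
\<close>

lemma good_path_likely:
  assumes delta: "\<delta> > 0" and R: "R \<ge> 1" "R\<^sup>2 \<le> \<tau>" "R\<^sup>2 \<le> n - \<tau>" and kappa: "\<kappa> > 0" and b: "b \<ge> 1"
    and mu1: "measure_pmf.expectation \<nu>1 real = \<mu>1" and mu2: "measure_pmf.expectation \<nu>2 real = \<mu>2"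
    and small: "\<mu>1 * \<delta> \<le> \<kappa>"
  obtains Bad where "Bad \<in> events" "prob Bad \<le> failure_bound \<delta> R \<kappa> b"
    "\<And>\<omega>. \<omega> \<in> space M \<Longrightarrow> \<omega> \<notin> Bad \<Longrightarrow> (\<Sum>t\<in>core. kappa (src t) q * weight t \<omega>) \<ge> 3 * \<kappa> * real n \<Longrightarrow>
       good_path p n \<tau> R \<alpha> (\<lambda>t. mean (Innovation (nat t))) \<mu>1 \<mu>2 (\<Sum>i = 1..p. \<alpha> i) \<delta> \<kappa> (\<lambda>t. test t \<omega>) (\<lambda>k. X k \<omega>)"
proof -
  define c where "c = int \<tau>"
  define N where "N = n - \<tau>"
  have cN: "0 \<le> c" "c \<le> int n" "c + int N \<le> int n" "int \<tau> \<le> c" using tau_less by (auto simp: c_def N_def)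
  have tau1: "1 \<le> \<tau>" using R by (metis le_trans one_le_power)
  have m_before: "mean (Innovation (nat t)) = \<mu>1" if "t \<in> {1..c}" for t
    using that by (simp add: mean_def c_def nat_le_iff mu1)
  have m_after: "mean (Innovation (nat t)) = \<mu>2" if "t \<in> {c + 1..int n}" for t
    using that by (auto simp: mean_def c_def mu2)
  define W1 where "W1 = (\<lambda>i. {\<omega> \<in> space M. \<exists>k\<in>{R\<^sup>2..\<tau>}. \<bar>\<Sum>t\<in>{c - int k + 1..c}. real (X (t - int i) \<omega>) - \<mu>1 / slack\<bar> > \<delta> * real k})"
  define W2 where "W2 = (\<lambda>i. {\<omega> \<in> space M. \<exists>k\<in>{R\<^sup>2..N}. \<bar>\<Sum>t\<in>{c + 1..c + int k}. real (X (t - int i) \<omega>) - \<mu>2 / slack\<bar> > \<delta> * real k})"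
  define W3 where "W3 = {\<omega> \<in> space M. \<exists>k\<in>{R\<^sup>2..\<tau>}. \<bar>\<Sum>t\<in>{c - int k + 1..c}. mart t \<omega>\<bar> > \<delta> * real k}"
  define W4 where "W4 = {\<omega> \<in> space M. \<exists>k\<in>{R\<^sup>2..N}. \<bar>\<Sum>t\<in>{c + 1..c + int k}. mart t \<omega>\<bar> > \<delta> * real k}"
  define L where "L = (\<lambda>i. {\<omega> \<in> space M. \<bar>\<Sum>t\<in>{1..int n}. real (X (t - int i) \<omega>) * mart t \<omega>\<bar> > \<delta> * real n})"
  define T0 where "T0 = {\<omega> \<in> space M. \<bar>\<Sum>t\<in>core. test t \<omega>\<bar> > \<delta> * real n}"
  define T1 where "T1 = (\<lambda>r. {\<omega> \<in> space M. \<bar>\<Sum>t\<in>core. test t \<omega> * mart (t - int r) \<omega>\<bar> > \<delta> * real n})"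
  define T2 where "T2 = (\<lambda>r. {\<omega> \<in> space M. \<bar>\<Sum>t\<in>core. test t \<omega> * mart (t + int r) \<omega>\<bar> > \<delta> * real n})"
  define T3 where "T3 = {\<omega> \<in> space M. \<bar>\<Sum>t\<in>core. test t \<omega> * mart t \<omega> - kappa (src t) q * weight t \<omega>\<bar> > \<kappa> * real n}"
  define I where "I = {1..p}"
  have fin: "finite I" "card I = p" by (auto simp: I_def)
  have Xm: "(\<lambda>\<omega>. real (X (t - int i) \<omega>) - m) \<in> borel_measurable M" if "i \<in> I" "1 \<le> t" "t \<le> int n" for i t m
    using X_measurable[of "t - int i"] that by (simp add: I_def)
  have W1m: "W1 i \<in> events" if "i \<in> I" for i
    unfolding W1_def using that tau_less by (intro window_event Xm) (auto simp: c_def)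
  have W2m: "W2 i \<in> events" if "i \<in> I" for i
    unfolding W2_def using that tau_less by (intro window_event Xm) (auto simp: c_def N_def)
  have W3m: "W3 \<in> events" unfolding W3_def using tau_less by (intro window_event mart_events) (auto simp: c_def)
  have W4m: "W4 \<in> events" unfolding W4_def using tau_less by (intro window_event mart_events) (auto simp: c_def N_def)
  have Lm: "L i \<in> events" if "i \<in> I" for i
    unfolding L_def using that by (intro sum_event borel_measurable_times mart_events X_measurable) (auto simp: I_def)
  have T0m: "T0 \<in> events" unfolding T0_def by (intro sum_event test_events)
  have T1m: "T1 r \<in> events" if "r \<in> I" for r
    unfolding T1_def using that tau_less by (intro sum_event borel_measurable_times test_events mart_events) (auto simp: I_def)
  have T2m: "T2 r \<in> events" if "r \<in> I" for r
    unfolding T2_def using that tau_less by (intro sum_event borel_measurable_times test_events mart_events) (auto simp: I_def)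
  have wm: "weight t \<in> borel_measurable M" if "t \<in> core" for t
    by (rule measurable_past_events[OF weight_past[OF that]]) (use core[OF that] in auto)
  have T3m: "T3 \<in> events" unfolding T3_def
    using core by (intro sum_event borel_measurable_diff borel_measurable_times test_events mart_events wm borel_measurable_const) auto
  define G1 where "G1 = (\<Union>i\<in>I. W1 i)" define G2 where "G2 = (\<Union>i\<in>I. W2 i)" define GL where "GL = (\<Union>i\<in>I. L i)"
  define GT1 where "GT1 = (\<Union>r\<in>I. T1 r)" define GT2 where "GT2 = (\<Union>r\<in>I. T2 r)"
  have Gm: "G1 \<in> events" "G2 \<in> events" "GL \<in> events" "GT1 \<in> events" "GT2 \<in> events"
    unfolding G1_def G2_def GL_def GT1_def GT2_def using W1m W2m Lm T1m T2m fin by (auto intro!: sets.finite_UN)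
  have union: "prob (\<Union>i\<in>I. A i) \<le> real p * d" if "\<And>i. i \<in> I \<Longrightarrow> A i \<in> events" "\<And>i. i \<in> I \<Longrightarrow> prob (A i) \<le> d" for A d
    using prob_UN_le[where I = I and A = A and b = "\<lambda>_. d", OF fin(1) that] fin(2) by simp
  have p1: "prob G1 \<le> real p * (40 * window_bound / (\<delta>\<^sup>2 * real R))" unfolding G1_def
  proof (rule union)
    fix i assume i: "i \<in> I"
    show "prob (W1 i) \<le> 40 * window_bound / (\<delta>\<^sup>2 * real R)" unfolding W1_def
      by (rule X_window_before) (use i cN m_before delta R in \<open>auto simp: I_def\<close>)
  qed (rule W1m)
  have p2: "prob G2 \<le> real p * (40 * window_bound / (\<delta>\<^sup>2 * real R))" unfolding G2_def
  proof (rule union)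
    fix i assume i: "i \<in> I"
    show "prob (W2 i) \<le> 40 * window_bound / (\<delta>\<^sup>2 * real R)" unfolding W2_def
      by (rule X_window_after) (use i cN m_after delta R in \<open>auto simp: I_def\<close>)
  qed (rule W2m)
  have p3: "prob W3 \<le> 40 * mart_bound / (\<delta>\<^sup>2 * real R)" unfolding W3_def
    by (rule mart_window_before) (use cN delta R in auto)
  have p4: "prob W4 \<le> 40 * mart_bound / (\<delta>\<^sup>2 * real R)" unfolding W4_def
    by (rule mart_window_after) (use cN delta R in auto)
  have n1: "n \<ge> 1" using tau_less by simp
  have pL: "prob GL \<le> real p * (real n * (second_moment_bound / b\<^sup>2) + truncated_bound * b / (\<delta>\<^sup>2 * real n))" unfolding GL_def
  proof (rule union)
    fix i assume i: "i \<in> I"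
    show "prob (L i) \<le> real n * (second_moment_bound / b\<^sup>2) + truncated_bound * b / (\<delta>\<^sup>2 * real n)" unfolding L_def
      by (rule mart_lag_tail) (use i b delta n1 in \<open>auto simp: I_def\<close>)
  qed (rule Lm)
  have p0: "prob T0 \<le> 1 / (\<delta>\<^sup>2 * real n)" unfolding T0_def by (rule test_sum_tail[OF delta])
  have pT1: "prob GT1 \<le> real p * (mart_bound / (\<delta>\<^sup>2 * real n))" unfolding GT1_def
    by (rule union[OF T1m]) (auto simp: T1_def I_def intro!: test_mart_earlier_tail delta)
  have pT2: "prob GT2 \<le> real p * (mart_bound / (\<delta>\<^sup>2 * real n))" unfolding GT2_def
    by (rule union[OF T2m]) (auto simp: T2_def I_def intro!: test_mart_later_tail delta)
  have pT3: "prob T3 \<le> product_bound / (\<kappa>\<^sup>2 * real n)" unfolding T3_def by (rule test_mart_same_tail[OF kappa])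
  define Bad where "Bad = G1 \<union> (G2 \<union> (W3 \<union> (W4 \<union> (GL \<union> (T0 \<union> (GT1 \<union> (GT2 \<union> T3)))))))"
  have "Bad \<in> events" unfolding Bad_def using Gm W3m W4m T0m T3m by auto
  moreover have "prob Bad \<le> prob G1 + (prob G2 + (prob W3 + (prob W4 + (prob GL + (prob T0 + (prob GT1 + (prob GT2 + prob T3)))))))"
    unfolding Bad_def using Gm W3m W4m T0m T3m
    by (intro order_trans[OF measure_Un_le] add_left_mono sets.Un order_refl)
  then have "prob Bad \<le> 2 * a1 + 2 * a3 + aL + a0 + 2 * aT + a5"
    if "prob G1 \<le> a1" "prob G2 \<le> a1" "prob W3 \<le> a3" "prob W4 \<le> a3" "prob GL \<le> aL" "prob T0 \<le> a0"
      "prob GT1 \<le> aT" "prob GT2 \<le> aT" "prob T3 \<le> a5" for a1 a3 aL a0 aT a5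
    using that by linarith
  from this[OF p1 p2 p3 p4 pL p0 pT1 pT2 pT3] have "prob Bad \<le> failure_bound \<delta> R \<kappa> b"
    unfolding failure_bound_def .
  moreover have "good_path p n \<tau> R \<alpha> (\<lambda>t. mean (Innovation (nat t))) \<mu>1 \<mu>2 (\<Sum>i = 1..p. \<alpha> i) \<delta> \<kappa> (\<lambda>t. test t \<omega>) (\<lambda>k. X k \<omega>)"
    if w: "\<omega> \<in> space M" and nb: "\<omega> \<notin> Bad" and wt: "(\<Sum>t\<in>core. kappa (src t) q * weight t \<omega>) \<ge> 3 * \<kappa> * real n" for \<omega>
  proof
    have np: "noise_part p \<alpha> (\<lambda>t. mean (Innovation (nat t))) (\<lambda>k. X k \<omega>) t = mart t \<omega>" for t
      by (simp add: noise_part_def mart_def)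
    have sl: "1 - (\<Sum>i = 1..p. \<alpha> i) = slack" by (simp add: slack_def)
    show "1 \<le> p" by (rule p_pos)
    show "R\<^sup>2 \<le> \<tau>" "R\<^sup>2 \<le> n - \<tau>" "\<tau> < n" "1 \<le> \<tau>" using R tau_less tau1 by auto
    show "0 \<le> \<alpha> i" if "i \<in> {1..p}" for i using coeff[OF that] by simp
    show "(\<Sum>i = 1..p. \<alpha> i) = (\<Sum>i = 1..p. \<alpha> i)" "(\<Sum>i = 1..p. \<alpha> i) < 1" using stable by auto
    show "mean (Innovation (nat t)) = \<mu>1" if "t \<in> {1..int \<tau>}" for t using m_before that by (simp add: c_def)
    show "mean (Innovation (nat t)) = \<mu>2" if "t \<in> {int \<tau> + 1..int n}" for t using m_after that by (simp add: c_def)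
    show "0 \<le> \<mu>1" "0 \<le> \<mu>2" unfolding mu1[symmetric] mu2[symmetric] by simp_all
    show "0 \<le> \<delta>" using delta by simp
    show "test t \<omega> = 0" if "t \<notin> core" for t unfolding test_def using that by (rule if_not_P)
    show "\<bar>test t \<omega>\<bar> \<le> 1" for t by (rule test_le_1)
    show "\<mu>1 * \<delta> \<le> \<kappa>" "0 < \<kappa>" using small kappa by auto
    show "\<bar>\<Sum>t = int \<tau> - int k + 1..int \<tau>. real (X (t - int i) \<omega>) - \<mu>1 / (1 - (\<Sum>i = 1..p. \<alpha> i))\<bar> \<le> \<delta> * real k"
      if "k \<in> {R\<^sup>2..\<tau>}" "i \<in> {1..p}" for k i
      using nb w that unfolding sl by (auto simp: Bad_def G1_def W1_def I_def c_def not_less)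
    show "\<bar>\<Sum>t = int \<tau> + 1..int \<tau> + int k. real (X (t - int i) \<omega>) - \<mu>2 / (1 - (\<Sum>i = 1..p. \<alpha> i))\<bar> \<le> \<delta> * real k"
      if "k \<in> {R\<^sup>2..n - \<tau>}" "i \<in> {1..p}" for k i
      using nb w that unfolding sl by (auto simp: Bad_def G2_def W2_def I_def c_def N_def not_less)
    show "\<bar>\<Sum>t = int \<tau> - int k + 1..int \<tau>. noise_part p \<alpha> (\<lambda>t. mean (Innovation (nat t))) (\<lambda>k. X k \<omega>) t\<bar> \<le> \<delta> * real k"
      if "k \<in> {R\<^sup>2..\<tau>}" for k
      unfolding np using nb w that by (auto simp: Bad_def W3_def c_def not_less)
    show "\<bar>\<Sum>t = int \<tau> + 1..int \<tau> + int k. noise_part p \<alpha> (\<lambda>t. mean (Innovation (nat t))) (\<lambda>k. X k \<omega>) t\<bar> \<le> \<delta> * real k"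
      if "k \<in> {R\<^sup>2..n - \<tau>}" for k
      unfolding np using nb w that by (auto simp: Bad_def W4_def c_def N_def not_less)
    show "\<bar>\<Sum>t = 1..int n. real (X (t - int i) \<omega>) * noise_part p \<alpha> (\<lambda>t. mean (Innovation (nat t))) (\<lambda>k. X k \<omega>) t\<bar> \<le> \<delta> * real n"
      if "i \<in> {1..p}" for i
      unfolding np using nb w that by (auto simp: Bad_def GL_def L_def I_def not_less)
    show "\<bar>\<Sum>t\<in>core. test t \<omega>\<bar> \<le> \<delta> * real n"
      using nb w by (auto simp: Bad_def T0_def not_less)
    show "\<bar>\<Sum>t\<in>core. test t \<omega> * noise_part p \<alpha> (\<lambda>t. mean (Innovation (nat t))) (\<lambda>k. X k \<omega>) (t + r)\<bar> \<le> \<delta> * real n"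
      if r: "r \<noteq> 0" "\<bar>r\<bar> < int p" for r
    proof (cases "r > 0")
      case True
      then have "nat r \<in> I" "t + int (nat r) = t + r" for t using r by (auto simp: I_def)
      then show ?thesis unfolding np using nb w by (auto simp: Bad_def GT2_def T2_def not_less)
    next
      case False
      then have rI: "nat (- r) \<in> I" and e: "int (nat (- r)) = - r" using r by (auto simp: I_def)
      have "\<omega> \<notin> T1 (nat (- r))" using nb rI by (auto simp: Bad_def GT1_def)
      then have "\<bar>\<Sum>t\<in>core. test t \<omega> * mart (t - int (nat (- r))) \<omega>\<bar> \<le> \<delta> * real n" using w by (auto simp: T1_def not_less)
      then show ?thesis unfolding np e by simp
    qed
    have "\<bar>\<Sum>t\<in>core. test t \<omega> * mart t \<omega> - kappa (src t) q * weight t \<omega>\<bar> \<le> \<kappa> * real n"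
      using nb w by (auto simp: Bad_def T3_def not_less)
    then show "2 * \<kappa> * real n \<le> (\<Sum>t\<in>core. test t \<omega> * noise_part p \<alpha> (\<lambda>t. mean (Innovation (nat t))) (\<lambda>k. X k \<omega>) t)"
      unfolding np using wt by (simp add: sum_subtractf)
  qed
  ultimately show ?thesis by (rule that)
qed

end

context INAR_stable
begin

text \<open>
  The innovations before the change serve as test variables with weight 1. If their law is not
  concentrated at one point, a suitable threshold \<open>q\<close> makes \<open>kappa\<close> positive.
\<close>

lemma innovation_test:
  assumes "\<tau> < n"
  shows "INAR_test M p \<alpha> \<nu>1 \<nu>2 \<pi> \<tau> n X \<xi> \<epsilon> B (\<lambda>t. Innovation (nat t)) (\<lambda>_ _. 1)"
    "\<And>t. t \<in> {int p + 1..int \<tau> - int p} \<Longrightarrow>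
      kappa (Innovation (nat t)) q \<ge> min (measure_pmf.prob \<nu>1 {q<..}) (1 - measure_pmf.prob \<nu>1 {q<..}) / 2"
proof -
  show "INAR_test M p \<alpha> \<nu>1 \<nu>2 \<pi> \<tau> n X \<xi> \<epsilon> B (\<lambda>t. Innovation (nat t)) (\<lambda>_ _. 1)"
    by unfold_locales (use assms in \<open>auto simp: noise_at_eq active_def\<close>)
  fix t assume t: "t \<in> {int p + 1..int \<tau> - int p}"
  then have s: "Innovation (nat t) \<in> noise_indices p n" using assms by (auto simp: noise_indices_def)
  have "law (Innovation (nat t)) = \<nu>1" using t by (simp add: nat_le_iff)
  with kappa_ge[OF s, of q] show "kappa (Innovation (nat t)) q \<ge> min (measure_pmf.prob \<nu>1 {q<..}) (1 - measure_pmf.prob \<nu>1 {q<..}) / 2" by simp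
qed

text \<open>
  If \<open>0 < \<alpha> i < 1\<close>, one thinning variable per step serves as test variable. It takes part in step \<open>t\<close> when
  \<open>X\<^sub>t\<^sub>-\<^sub>i\<close> is positive. The weight asks for the stronger event that the innovation at time \<open>t - i\<close> is
  positive, because these events are independent and their frequency obeys a weak law.
\<close>

lemma thinning_test:
  assumes "\<tau> < n" and i: "i \<in> {1..p}"
  defines "w \<equiv> (\<lambda>t \<omega>. of_bool (\<epsilon> (nat (t - int i)) \<omega> > 0) :: real)"
  shows "INAR_test M p \<alpha> \<nu>1 \<nu>2 \<pi> \<tau> n X \<xi> \<epsilon> B (\<lambda>t. Thinning i (nat t) 1) w"
    "\<And>t. t \<in> {int p + 1..int \<tau> - int p} \<Longrightarrow> kappa (Thinning i (nat t) 1) 0 \<ge> min (\<alpha> i) (1 - \<alpha> i) / 2"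
    "\<delta> > 0 \<Longrightarrow> prob {\<omega> \<in> space M. \<bar>\<Sum>t\<in>{int p + 1..int \<tau> - int p}. w t \<omega> - measure_pmf.prob \<nu>1 {0<..}\<bar> > \<delta> * real n} \<le> 1 / (\<delta>\<^sup>2 * real n)"
proof -
  show "INAR_test M p \<alpha> \<nu>1 \<nu>2 \<pi> \<tau> n X \<xi> \<epsilon> B (\<lambda>t. Thinning i (nat t) 1) w"
  proof unfold_locales
    fix t assume t: "t \<in> {int p + 1..int \<tau> - int p}"
    have "Innovation (nat (t - int i)) \<in> noise_indices p (nat (t - 1))" using t i by (auto simp: noise_indices_def)
    from noise_past[OF this] have "(\<lambda>\<omega>. \<epsilon> (nat (t - int i)) \<omega>) \<in> measurable (past (t - 1)) (count_space UNIV)" by simp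
    then show "w t \<in> borel_measurable (past (t - 1))" unfolding w_def by measurable
    show "Thinning i (nat t) 1 \<in> noise_at t" using t i by (auto simp: noise_at_eq)
    fix \<omega> assume w: "\<omega> \<in> space M" "w t \<omega> \<noteq> 0"
    have "nat (t - int i) \<in> {1..n}" using t i assms(1) by auto
    from recursion[OF this w(1)] have "X (t - int i) \<omega> \<ge> \<epsilon> (nat (t - int i)) \<omega>" using t i by simp
    then show "Thinning i (nat t) 1 \<in> active t (lags t \<omega>)" using w(2) i by (auto simp: active_def lags_def w_def image_iff)
  qed (use assms in auto)
  show "kappa (Thinning i (nat t) 1) 0 \<ge> min (\<alpha> i) (1 - \<alpha> i) / 2" if t: "t \<in> {int p + 1..int \<tau> - int p}" for t
  proof -
    have s: "Thinning i (nat t) 1 \<in> noise_indices p n" using assms t i by (auto simp: noise_indices_def)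
    show ?thesis using kappa_ge[OF s, of 0] law_thinning(4)[OF i, of "nat t" 1] by simp
  qed
  assume delta: "\<delta> > 0"
  let ?I = "{int p + 1 - int i..int \<tau> - int p - int i}"
  have eq: "(\<Sum>t\<in>{int p + 1..int \<tau> - int p}. w t \<omega> - measure_pmf.prob \<nu>1 {0<..})
    = (\<Sum>t\<in>?I. hit (Innovation (nat t)) 0 (noise \<xi> \<epsilon> (Innovation (nat t)) \<omega>))" for \<omega>
  proof (rule sum.reindex_bij_witness[where i = "\<lambda>t. t + int i" and j = "\<lambda>t. t - int i"])
    fix t assume t: "t \<in> {int p + 1..int \<tau> - int p}"
    then have "law (Innovation (nat (t - int i))) = \<nu>1" by (simp add: nat_le_iff)
    then show "hit (Innovation (nat (t - int i))) 0 (noise \<xi> \<epsilon> (Innovation (nat (t - int i))) \<omega>) = w t \<omega> - measure_pmf.prob \<nu>1 {0<..}"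
      by (simp add: hit_def w_def)
  qed auto
  show "prob {\<omega> \<in> space M. \<bar>\<Sum>t\<in>{int p + 1..int \<tau> - int p}. w t \<omega> - measure_pmf.prob \<nu>1 {0<..}\<bar> > \<delta> * real n} \<le> 1 / (\<delta>\<^sup>2 * real n)"
    unfolding eq
  proof (rule mds_tail)
    fix t assume t: "t \<in> ?I"
    then have t': "1 \<le> t" "t \<le> int n" "Innovation (nat t) \<in> noise_at t" using i assms(1) by (auto simp: noise_at_eq)
    show "mds t (\<lambda>\<omega>. hit (Innovation (nat t)) 0 (noise \<xi> \<epsilon> (Innovation (nat t)) \<omega>))"
      "expectation (\<lambda>\<omega>. (hit (Innovation (nat t)) 0 (noise \<xi> \<epsilon> (Innovation (nat t)) \<omega>))\<^sup>2) \<le> 1"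
      by (rule hit_mds[OF t'])+
  qed (use i assms(1) delta in auto)
qed

lemma core_sum:
  fixes c :: real
  assumes "r * real n \<le> real \<tau> - 2 * real p" "r \<ge> 0"
  shows "(\<Sum>t\<in>{int p + 1..int \<tau> - int p}. c) = c * (real \<tau> - 2 * real p)"
proof -
  have "0 \<le> real \<tau> - 2 * real p" using mult_nonneg_nonneg[OF assms(2), of "real n"] assms(1) by linarith
  then have "2 * int p \<le> int \<tau>" by linarith
  then have "real (card {int p + 1..int \<tau> - int p}) = real \<tau> - 2 * real p" by (simp add: of_nat_diff)
  then show ?thesis by (simp add: mult.commute)
qed

lemma innovation_richness:
  assumes tau: "\<tau> < n" and r: "r \<ge> 0" "r * real n \<le> real \<tau> - 2 * real p"
    and P: "0 < measure_pmf.prob \<nu>1 {q<..}" "measure_pmf.prob \<nu>1 {q<..} < 1"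
  shows "min (measure_pmf.prob \<nu>1 {q<..}) (1 - measure_pmf.prob \<nu>1 {q<..}) / 2 * r * real n
    \<le> (\<Sum>t\<in>{int p + 1..int \<tau> - int p}. kappa (Innovation (nat t)) q * 1)"
proof -
  define c where "c = min (measure_pmf.prob \<nu>1 {q<..}) (1 - measure_pmf.prob \<nu>1 {q<..}) / 2"
  have "c * (r * real n) \<le> c * (real \<tau> - 2 * real p)" using r P by (intro mult_left_mono) (auto simp: c_def)
  also have "\<dots> = (\<Sum>t\<in>{int p + 1..int \<tau> - int p}. c)" by (rule core_sum[OF r(2,1), symmetric])
  also have "\<dots> \<le> (\<Sum>t\<in>{int p + 1..int \<tau> - int p}. kappa (Innovation (nat t)) q * 1)"
    using innovation_test(2)[OF tau, of _ q] by (intro sum_mono) (simp add: c_def)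
  finally show ?thesis by (simp add: c_def mult.assoc)
qed

lemma thinning_richness:
  assumes tau: "\<tau> < n" and i: "i \<in> {1..p}" and r: "r > 0" "r * real n \<le> real \<tau> - 2 * real p"
    and alpha: "0 < \<alpha> i" "\<alpha> i < 1" and P: "P = measure_pmf.prob \<nu>1 {0<..}" "P > 0"
  defines "w \<equiv> (\<lambda>t \<omega>. of_bool (\<epsilon> (nat (t - int i)) \<omega> > 0) :: real)"
  obtains Bad where "Bad \<in> events" "prob Bad \<le> 1 / ((P * r / 2)\<^sup>2 * real n)"
    "\<And>\<omega>. \<omega> \<in> space M \<Longrightarrow> \<omega> \<notin> Bad \<Longrightarrow>
      min (\<alpha> i) (1 - \<alpha> i) / 2 * (P * r / 2) * real n \<le> (\<Sum>t\<in>{int p + 1..int \<tau> - int p}. kappa (Thinning i (nat t) 1) 0 * w t \<omega>)"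
proof -
  let ?core = "{int p + 1..int \<tau> - int p}"
  define d where "d = P * r / 2"
  have d: "d > 0" using P r by (simp add: d_def)
  define Bad where "Bad = {\<omega> \<in> space M. \<bar>\<Sum>t\<in>?core. w t \<omega> - P\<bar> > d * real n}"
  define c where "c = min (\<alpha> i) (1 - \<alpha> i) / 2"
  have wm: "w t \<in> borel_measurable M" if t: "t \<in> ?core" for t
  proof -
    have "Innovation (nat (t - int i)) \<in> noise_indices p n" using t i tau by (auto simp: noise_indices_def)
    from noise_measurable[OF this] have "(\<lambda>\<omega>. \<epsilon> (nat (t - int i)) \<omega>) \<in> measurable M (count_space UNIV)" by simp
    then show ?thesis unfolding w_def by measurable
  qed
  have "(\<lambda>\<omega>. \<Sum>t\<in>?core. w t \<omega> - P) \<in> borel_measurable M" using wm by (intro borel_measurable_sum borel_measurable_diff) auto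
  then have 1: "Bad \<in> events" unfolding Bad_def by measurable
  have 2: "prob Bad \<le> 1 / (d\<^sup>2 * real n)"
    unfolding Bad_def P(1) w_def by (rule thinning_test(3)[OF tau i d])
  have 3: "c * d * real n \<le> (\<Sum>t\<in>?core. kappa (Thinning i (nat t) 1) 0 * w t \<omega>)"
    if w: "\<omega> \<in> space M" "\<omega> \<notin> Bad" for \<omega>
  proof -
    have "\<bar>\<Sum>t\<in>?core. w t \<omega> - P\<bar> \<le> d * real n" using w by (auto simp: Bad_def not_less)
    moreover have "(\<Sum>t\<in>?core. w t \<omega> - P) = (\<Sum>t\<in>?core. w t \<omega>) - P * (real \<tau> - 2 * real p)"
      using core_sum[OF r(2), of P] r(1) by (simp add: sum_subtractf)
    moreover have "P * (r * real n) \<le> P * (real \<tau> - 2 * real p)" using r P by (intro mult_left_mono) auto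
    moreover have "P * (r * real n) = 2 * (d * real n)" by (simp add: d_def)
    ultimately have "d * real n \<le> (\<Sum>t\<in>?core. w t \<omega>)" by linarith
    then have "c * (d * real n) \<le> c * (\<Sum>t\<in>?core. w t \<omega>)" using alpha by (intro mult_left_mono) (auto simp: c_def)
    also have "\<dots> \<le> (\<Sum>t\<in>?core. kappa (Thinning i (nat t) 1) 0 * w t \<omega>)"
      unfolding sum_distrib_left using thinning_test(2)[OF tau i]
      by (intro sum_mono mult_right_mono) (auto simp: c_def w_def)
    finally show ?thesis by (simp add: mult.assoc)
  qed
  show ?thesis using that[of Bad] 1 2 3 unfolding d_def c_def by blast
qed

text \<open>
  The estimator is the least time at which the partial sum is maximal; least numbers with measurable
  properties are measurable.
\<close>

lemma change_estimator_measurable: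
  assumes theta: "cls_estimator M p n X \<theta>"
  shows "(\<lambda>\<omega>. change_estimator p n (\<theta> \<omega>) (\<lambda>k. X k \<omega>)) \<in> measurable M (count_space UNIV)"
proof -
  define S where "S = (\<lambda>k \<omega>. \<Sum>j = 1..k. residual p (\<theta> \<omega>) (\<lambda>k. X k \<omega>) j)"
  have Sm[measurable]: "S k \<in> borel_measurable M" if "k \<in> {1..n}" for k
  proof -
    have "(\<lambda>\<omega>. real (X (int j) \<omega>) - (\<Sum>a\<le>p. \<theta> \<omega> $ a * regressor p (\<lambda>k. X k \<omega>) j $ a)) \<in> borel_measurable M" if j: "j \<in> {1..n}" for j
    proof (intro borel_measurable_diff borel_measurable_sum borel_measurable_times)
      show "(\<lambda>\<omega>. real (X (int j) \<omega>)) \<in> borel_measurable M" using j by (intro X_measurable) auto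
      fix a assume a: "a \<in> {..p}"
      then show "(\<lambda>\<omega>. \<theta> \<omega> $ a) \<in> borel_measurable M" using theta by (auto simp: cls_estimator_def)
      show "(\<lambda>\<omega>. regressor p (\<lambda>k. X k \<omega>) j $ a) \<in> borel_measurable M"
      proof (cases "a < p")
        case True
        then have "(\<lambda>\<omega>. real (X (int j - 1 - int a) \<omega>)) \<in> borel_measurable M" using j by (intro X_measurable) auto
        then show ?thesis using True by (simp add: regressor_index)
      next
        case False then show ?thesis using a by (simp add: regressor_index)
      qed
    qed
    then show ?thesis unfolding S_def residual_def scalar_prod_regressor using that by (intro borel_measurable_sum) auto
  qed
  have eq: "change_estimator p n (\<theta> \<omega>) (\<lambda>k. X k \<omega>) = (LEAST k. k \<in> {1..n} \<and> (\<forall>m\<in>{1..n}. S m \<omega> \<le> S k \<omega>))" if n: "n \<ge> 1" for \<omega>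
  proof -
    have mx: "S k \<omega> = Max ((\<lambda>m. S m \<omega>) ` {1..n}) \<longleftrightarrow> (\<forall>m\<in>{1..n}. S m \<omega> \<le> S k \<omega>)" if "k \<in> {1..n}" for k
      using that by (subst eq_commute, subst Max_eq_iff) auto
    define A where "A = {k \<in> {1..n}. S k \<omega> = Max ((\<lambda>m. S m \<omega>) ` {1..n})}"
    have "Max ((\<lambda>m. S m \<omega>) ` {1..n}) \<in> (\<lambda>m. S m \<omega>) ` {1..n}" using n by (intro Max_in) auto
    then have "A \<noteq> {}" by (auto simp: A_def)
    moreover have "finite A" by (simp add: A_def)
    ultimately have "(LEAST k. k \<in> A) = Min A" using Least_Min[of "\<lambda>k. k \<in> A"] by (simp add: ex_in_conv)
    moreover have "change_estimator p n (\<theta> \<omega>) (\<lambda>k. X k \<omega>) = Min A" by (simp add: change_estimator_def A_def S_def)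
    moreover have "k \<in> A \<longleftrightarrow> k \<in> {1..n} \<and> (\<forall>m\<in>{1..n}. S m \<omega> \<le> S k \<omega>)" for k using mx by (auto simp: A_def)
    ultimately show ?thesis by simp
  qed
  show ?thesis
  proof (cases "n \<ge> 1")
    case True
    have P: "Measurable.pred M (\<lambda>\<omega>. k \<in> {1..n} \<and> (\<forall>m\<in>{1..n}. S m \<omega> \<le> S k \<omega>))" for k
    proof (cases "k \<in> {1..n}")
      case True
      have "Measurable.pred M (\<lambda>\<omega>. S m \<omega> \<le> S k \<omega>)" if "m \<in> {1..n}" for m
        using Sm[OF that] Sm[OF True] by measurable
      then have "Measurable.pred M (\<lambda>\<omega>. \<forall>m\<in>{1..n}. S m \<omega> \<le> S k \<omega>)" by (intro pred_intros_finite) auto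
      then show ?thesis using True by simp
    next
      case False
      then have "(\<lambda>\<omega>. k \<in> {1..n} \<and> (\<forall>m\<in>{1..n}. S m \<omega> \<le> S k \<omega>)) = (\<lambda>_. False)" by auto
      then show ?thesis by simp
    qed
    show ?thesis unfolding eq[OF True] by (rule measurable_Least[OF P])
  next
    case False
    then have "change_estimator p n (\<theta> \<omega>) (\<lambda>k. X k \<omega>) = Min {}" for \<omega> by (simp add: change_estimator_def)
    then show ?thesis by simp
  qed
qed

end

section \<open>Boundedness in probability\<close>

text \<open>
  The least element of the support is not the only one; it serves as \<open>q\<close>.
\<close>

lemma pmf_split_of_variance_pos:
  fixes \<nu> :: "nat pmf"
  assumes "measure_pmf.variance \<nu> real > 0"
  obtains q where "0 < measure_pmf.prob \<nu> {q<..}" "measure_pmf.prob \<nu> {q<..} < 1"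
proof -
  define a where "a = (LEAST k. k \<in> set_pmf \<nu>)"
  have "\<exists>k. k \<in> set_pmf \<nu>" using set_pmf_not_empty[of \<nu>] by blast
  then have a: "a \<in> set_pmf \<nu>" unfolding a_def by (rule LeastI_ex)
  have "\<exists>b\<in>set_pmf \<nu>. b > a"
  proof (rule ccontr)
    assume "\<not> ?thesis"
    moreover have "a \<le> b" if "b \<in> set_pmf \<nu>" for b unfolding a_def using that by (rule Least_le)
    ultimately have "set_pmf \<nu> \<subseteq> {a}" by (auto simp: not_less intro: le_antisym)
    then have "\<nu> = return_pmf a" by (simp add: set_pmf_subset_singleton)
    then show False using assms by simp
  qed
  then obtain b where b: "b \<in> set_pmf \<nu>" "b > a" by blast
  have "0 < measure_pmf.prob \<nu> {a<..}" using b by (intro measure_pmf_posI) auto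
  moreover have "0 < measure_pmf.prob \<nu> {..a}" using a by (intro measure_pmf_posI) auto
  moreover have "measure_pmf.prob \<nu> {..a} = 1 - measure_pmf.prob \<nu> {a<..}"
    using measure_pmf.prob_compl[of "{a<..}" \<nu>] by (simp add: Compl_eq_Diff_UNIV[symmetric])
  ultimately show ?thesis using that[of a] by simp
qed

lemma pmf_prob_pos_of_expectation_pos:
  fixes \<nu> :: "nat pmf"
  assumes "measure_pmf.expectation \<nu> real > 0"
  shows "measure_pmf.prob \<nu> {0<..} > 0"
proof -
  have "\<exists>b\<in>set_pmf \<nu>. b > 0"
  proof (rule ccontr)
    assume "\<not> ?thesis"
    then have "set_pmf \<nu> \<subseteq> {0}" by auto
    then have "\<nu> = return_pmf 0" by (simp add: set_pmf_subset_singleton)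
    then show False using assms by simp
  qed
  then obtain b where "b \<in> set_pmf \<nu>" "b > 0" by blast
  then show ?thesis by (intro measure_pmf_posI) auto
qed

lemma obtain_tolerance:
  fixes a :: real
  assumes "a > 0" "b > 0" "c > 0" "d > 0" "e > 0"
  obtains x where "x > 0" "x \<le> 1" "x \<le> a" "x * E2 \<le> b" "x * E2 \<le> c" "x * E3 < d" "x * F < e"
proof -
  have lim: "((\<lambda>x. x * C) \<longlongrightarrow> 0) (at_right 0)" for C :: real
    by (auto intro!: tendsto_eq_intros)
  have "\<forall>\<^sub>F x in at_right 0. x > (0::real) \<and> x < 1 \<and> x < a \<and> x * E2 < b \<and> x * E2 < c \<and> x * E3 < d \<and> x * F < e"
    using order_tendstoD(2)[OF lim[of 1], of 1] order_tendstoD(2)[OF lim[of 1] assms(1)]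
      order_tendstoD(2)[OF lim[of E2] assms(2)] order_tendstoD(2)[OF lim[of E2] assms(3)]
      order_tendstoD(2)[OF lim[of E3] assms(4)] order_tendstoD(2)[OF lim[of F] assms(5)] eventually_at_right_less[of 0]
    by (auto intro: eventually_elim2 simp: eventually_conj_iff)
  then obtain x where "x > 0 \<and> x < 1 \<and> x < a \<and> x * E2 < b \<and> x * E2 < c \<and> x * E3 < d \<and> x * F < e"
    using eventually_happens'[OF trivial_limit_at_right_real] by blast
  then show ?thesis by (intro that[of x]) auto
qed

lemma vanishing_terms:
  "(\<lambda>n. p * (real n * (s / (real n powr (3/4))\<^sup>2) + t * real n powr (3/4) / (d * real n)) + 1 / (d * real n)
     + 2 * (p * (m / (d * real n))) + k / (e * real n) + f / (g * real n)) \<longlonglongrightarrow> 0"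
proof -
  have 1: "(\<lambda>n. real n * (1 / (real n powr (3/4))\<^sup>2)) \<longlonglongrightarrow> 0" by real_asymp
  have 2: "(\<lambda>n. real n powr (3/4) / real n) \<longlonglongrightarrow> 0" by real_asymp
  have 3: "(\<lambda>n. 1 / real n) \<longlonglongrightarrow> 0" by real_asymp
  have "(\<lambda>n. p * (s * (real n * (1 / (real n powr (3/4))\<^sup>2)) + t / d * (real n powr (3/4) / real n)) + 1 / d * (1 / real n)
     + 2 * (p * (m / d * (1 / real n))) + k / e * (1 / real n) + f / g * (1 / real n)) \<longlonglongrightarrow> p * (s * 0 + t / d * 0) + 1 / d * 0 + 2 * (p * (m / d * 0)) + k / e * 0 + f / g * 0"
    by (intro tendsto_intros 1 2 3)
  then show ?thesis by (simp add: divide_divide_eq_left mult_ac)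
qed

text \<open>
  The tolerances are fixed first. Given \<open>\<eta>\<close>, the window length \<open>R\<^sup>2\<close> makes the part of \<open>failure_bound\<close> that survives
  for large \<open>n\<close> smaller than \<open>\<eta> / 2\<close>, and large \<open>n\<close> takes care of the remaining terms. The distance between
  estimate and change point is then less than \<open>R\<^sup>2\<close>.
\<close>

theorem theorem4p2:
  fixes M :: "nat \<Rightarrow> 'a measure"
    and p :: nat and \<alpha> :: "nat \<Rightarrow> real" and \<nu>1 \<nu>2 :: "nat pmf" and \<pi> :: "(int \<Rightarrow> nat) measure"
    and \<mu>1 \<mu>2 \<rho> :: real and \<tau> :: "nat \<Rightarrow> nat"
    and X :: "nat \<Rightarrow> int \<Rightarrow> 'a \<Rightarrow> nat"
    and \<xi> :: "nat \<Rightarrow> nat \<Rightarrow> nat \<Rightarrow> nat \<Rightarrow> 'a \<Rightarrow> nat"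
    and \<epsilon> :: "nat \<Rightarrow> nat \<Rightarrow> 'a \<Rightarrow> nat"
    and \<theta> :: "nat \<Rightarrow> 'a \<Rightarrow> real Matrix.vec"
  assumes "0 < \<rho>" and "\<rho> < 1"
    and "\<And>n. \<tau> n = max (nat \<lfloor>real n * \<rho>\<rfloor>) 1"
    and "\<And>n. n \<ge> 2 \<Longrightarrow>
           INAR_innovation_change (M n) p \<alpha> \<nu>1 \<nu>2 \<pi> (\<tau> n) n (X n) (\<xi> n) (\<epsilon> n)"
    and "measure_pmf.expectation \<nu>1 real = \<mu>1" and "measure_pmf.expectation \<nu>2 real = \<mu>2"
    and "\<mu>1 > \<mu>2" and "\<mu>2 > 0"
    and "\<And>n k. n \<ge> 2 \<Longrightarrow> k \<in> {1 - int p..0} \<Longrightarrow> integrable (M n) (\<lambda>\<omega>. (real (X n k \<omega>))^6)"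
    and "\<And>n. n \<ge> 2 \<Longrightarrow> integrable (M n) (\<lambda>\<omega>. (real (\<epsilon> n 1 \<omega>))^6)"
    and "\<And>n. n \<ge> 2 \<Longrightarrow> integrable (M n) (\<lambda>\<omega>. (real (\<epsilon> n (\<tau> n + 1) \<omega>))^6)"
    and "(\<Sum>i = 1..p. \<alpha> i) < 1"
    and "(\<Sum>i = 1..p. \<alpha> i) > 0 \<or>
           (measure_pmf.variance \<nu>1 real > 0 \<and> measure_pmf.variance \<nu>2 real > 0)"
    and "\<And>n. n \<ge> 2 \<Longrightarrow> cls_estimator (M n) p n (X n) (\<theta> n)"
  shows "bounded_in_probability M
           (\<lambda>n \<omega>. real (change_estimator p n (\<theta> n \<omega>) (\<lambda>k. X n k \<omega>)) - real_of_int \<lfloor>real n * \<rho>\<rfloor>)"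
proof -
  note rho = assms(1,2) and tau_def = assms(3) and model = assms(4) and mu1 = assms(5) and mu2 = assms(6)
    and mu = assms(7,8) and initial6 = assms(9) and stable = assms(12) and nondegenerate = assms(13) and cls = assms(14)
  \<comment> \<open>The law of the initial values is common to all \<open>n\<close>, and so is this bound.\<close>
  define B where "B = (\<Sum>k\<in>{1 - int p..0}. \<integral>y. (real (y k))\<^sup>2 \<partial>\<pi>)"
  have stab: "INAR_stable (M n) p \<alpha> \<nu>1 \<nu>2 \<pi> (\<tau> n) n (X n) (\<xi> n) (\<epsilon> n) B" if n: "n \<ge> 2" for n
  proof -
    interpret INAR_innovation_change "M n" p \<alpha> \<nu>1 \<nu>2 \<pi> "\<tau> n" n "X n" "\<xi> n" "\<epsilon> n" by (rule model[OF n])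
    show ?thesis
    proof (unfold_locales, rule stable)
      fix k assume k: "k \<in> {1 - int p..0}"
      have sq: "(real x)\<^sup>2 \<le> 1 + (real x)^6" for x :: nat
      proof (cases "x = 0")
        case False
        then have "(real x)^2 \<le> (real x)^6" by (intro power_increasing) auto
        then show ?thesis by simp
      qed simp
      have i1: "integrable (M n) (\<lambda>\<omega>. 1 + (real (X n k \<omega>))^6)" using initial6[OF n k] by simp
      show "integrable (M n) (\<lambda>\<omega>. (real (X n k \<omega>))\<^sup>2)"
        by (rule Bochner_Integration.integrable_bound[OF i1]) (use initial_measurable[OF k] sq in auto)
      have "(\<integral>y. (real (y k))\<^sup>2 \<partial>\<pi>) = expectation (\<lambda>\<omega>. (real (init \<omega> k))\<^sup>2)"
        unfolding initial_law[symmetric] init_def[symmetric]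
      proof (rule integral_distr)
        show "init \<in> measurable (M n) init_space" by (rule init_measurable)
        show "(\<lambda>y. (real (y k))\<^sup>2) \<in> borel_measurable init_space"
          by (rule measurable_compose[OF measurable_component_singleton[OF k]]) auto
      qed
      then have "expectation (\<lambda>\<omega>. (real (X n k \<omega>))\<^sup>2) = (\<integral>y. (real (y k))\<^sup>2 \<partial>\<pi>)" using k by (simp add: init_def)
      also have "\<dots> \<le> B" unfolding B_def using k by (intro member_le_sum) auto
      finally show "expectation (\<lambda>\<omega>. (real (X n k \<omega>))\<^sup>2) \<le> B" .
    qed
  qed
  have p1: "p \<ge> 1" using model[of 2] by (simp add: INAR_innovation_change_def INAR_innovation_change_axioms_def)
  have coeff: "i \<in> {1..p} \<Longrightarrow> \<alpha> i \<in> {0..1}" for i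
    using model[of 2] unfolding INAR_innovation_change_def INAR_innovation_change_axioms_def by blast
  \<comment> \<open>For large \<open>n\<close> the test variables cover at least \<open>r n\<close> steps.\<close>
  define r where "r = \<rho> / 2"
  have r0: "r > 0" using rho by (simp add: r_def)
  define usable where "usable = (\<lambda>n. n \<ge> 2 \<and> \<tau> n < n \<and> r * real n \<le> real (\<tau> n) - 2 * real p)"
  \<comment> \<open>Weights of total size \<open>3 \<kappa> n\<close>: one \<open>\<kappa> n\<close> may be lost in \<open>test_mart_same_tail\<close> and one to the average
    of the test values, which leaves \<open>\<kappa> n\<close> for the diagonal of the dual system. The quotient \<open>f / (g n)\<close> bounds the
    probability that the weights fall short.\<close>
  obtain \<kappa> f g where kappa: "\<kappa> > 0" and g: "f \<ge> 0" and rich: "\<And>n. usable n \<Longrightarrow>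
      \<exists>src q weight Bad. INAR_test (M n) p \<alpha> \<nu>1 \<nu>2 \<pi> (\<tau> n) n (X n) (\<xi> n) (\<epsilon> n) B src weight \<and>
        Bad \<in> sets (M n) \<and> measure (M n) Bad \<le> f / (g * real n) \<and>
        (\<forall>\<omega>\<in>space (M n) - Bad. 3 * \<kappa> * real n \<le>
          (\<Sum>t\<in>{int p + 1..int (\<tau> n) - int p}. INAR_innovation_change.kappa \<alpha> \<nu>1 \<nu>2 (\<tau> n) (src t) q * weight t \<omega>))"
  proof (cases "(\<Sum>i = 1..p. \<alpha> i) > 0")
    case True
    then obtain i where i: "i \<in> {1..p}" "\<alpha> i > 0"
      by (metis sum_nonpos not_less)
    have "\<alpha> i \<le> (\<Sum>i = 1..p. \<alpha> i)" using i coeff by (intro member_le_sum) auto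
    then have a1: "\<alpha> i < 1" using stable by linarith
    define P where "P = measure_pmf.prob \<nu>1 {0<..}"
    have P: "P > 0" unfolding P_def using mu mu1 by (intro pmf_prob_pos_of_expectation_pos) simp
    define \<kappa> where "\<kappa> = min (\<alpha> i) (1 - \<alpha> i) / 2 * (P * r / 2) / 3"
    show ?thesis
    proof (rule that[of \<kappa> 1 "(P * r / 2)\<^sup>2"])
      show "\<kappa> > 0" using i a1 P r0 by (simp add: \<kappa>_def)
      fix n assume u: "usable n"
      then have n: "n \<ge> 2" "\<tau> n < n" "r * real n \<le> real (\<tau> n) - 2 * real p" by (auto simp: usable_def)
      interpret INAR_stable "M n" p \<alpha> \<nu>1 \<nu>2 \<pi> "\<tau> n" n "X n" "\<xi> n" "\<epsilon> n" B by (rule stab[OF n(1)])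
      obtain Bad where Bad: "Bad \<in> events" "prob Bad \<le> 1 / ((P * r / 2)\<^sup>2 * real n)"
        "\<And>\<omega>. \<omega> \<in> space (M n) \<Longrightarrow> \<omega> \<notin> Bad \<Longrightarrow>
          min (\<alpha> i) (1 - \<alpha> i) / 2 * (P * r / 2) * real n \<le>
          (\<Sum>t\<in>{int p + 1..int (\<tau> n) - int p}. kappa (Thinning i (nat t) 1) 0 * of_bool (\<epsilon> n (nat (t - int i)) \<omega> > 0))"
        by (rule thinning_richness[OF n(2) i(1) r0 n(3) i(2) a1 P_def P]) blast
      show "\<exists>src q weight Bad. INAR_test (M n) p \<alpha> \<nu>1 \<nu>2 \<pi> (\<tau> n) n (X n) (\<xi> n) (\<epsilon> n) B src weight \<and>
        Bad \<in> sets (M n) \<and> measure (M n) Bad \<le> 1 / ((P * r / 2)\<^sup>2 * real n) \<and>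
        (\<forall>\<omega>\<in>space (M n) - Bad. 3 * \<kappa> * real n \<le>
          (\<Sum>t\<in>{int p + 1..int (\<tau> n) - int p}. kappa (src t) q * weight t \<omega>))"
      proof (intro exI conjI ballI)
        show "INAR_test (M n) p \<alpha> \<nu>1 \<nu>2 \<pi> (\<tau> n) n (X n) (\<xi> n) (\<epsilon> n) B (\<lambda>t. Thinning i (nat t) 1)
          (\<lambda>t \<omega>. of_bool (\<epsilon> n (nat (t - int i)) \<omega> > 0))"
          by (rule thinning_test(1)[OF n(2) i(1)])
        fix \<omega> assume w: "\<omega> \<in> space (M n) - Bad"
        have "3 * \<kappa> * real n = min (\<alpha> i) (1 - \<alpha> i) / 2 * (P * r / 2) * real n" by (simp add: \<kappa>_def)
        also have "\<dots> \<le> (\<Sum>t\<in>{int p + 1..int (\<tau> n) - int p}.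
          kappa (Thinning i (nat t) 1) 0 * of_bool (\<epsilon> n (nat (t - int i)) \<omega> > 0))"
          using w by (intro Bad(3)) auto
        finally show "3 * \<kappa> * real n \<le> (\<Sum>t\<in>{int p + 1..int (\<tau> n) - int p}.
          kappa (Thinning i (nat t) 1) 0 * of_bool (\<epsilon> n (nat (t - int i)) \<omega> > 0))" .
      qed (rule Bad)+
    qed simp
  next
    case False
    then have "measure_pmf.variance \<nu>1 real > 0" using nondegenerate by simp
    then obtain q where q: "0 < measure_pmf.prob \<nu>1 {q<..}" "measure_pmf.prob \<nu>1 {q<..} < 1"
      by (rule pmf_split_of_variance_pos)
    define \<kappa> where "\<kappa> = min (measure_pmf.prob \<nu>1 {q<..}) (1 - measure_pmf.prob \<nu>1 {q<..}) / 2 * r / 3"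
    show ?thesis
    proof (rule that[of \<kappa> 0 1])
      show "\<kappa> > 0" using q r0 by (simp add: \<kappa>_def)
      fix n assume u: "usable n"
      then have n: "n \<ge> 2" "\<tau> n < n" "r * real n \<le> real (\<tau> n) - 2 * real p" by (auto simp: usable_def)
      interpret INAR_stable "M n" p \<alpha> \<nu>1 \<nu>2 \<pi> "\<tau> n" n "X n" "\<xi> n" "\<epsilon> n" B by (rule stab[OF n(1)])
      show "\<exists>src q weight Bad. INAR_test (M n) p \<alpha> \<nu>1 \<nu>2 \<pi> (\<tau> n) n (X n) (\<xi> n) (\<epsilon> n) B src weight \<and>
        Bad \<in> sets (M n) \<and> measure (M n) Bad \<le> 0 / (1 * real n) \<and>
        (\<forall>\<omega>\<in>space (M n) - Bad. 3 * \<kappa> * real n \<le>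
          (\<Sum>t\<in>{int p + 1..int (\<tau> n) - int p}. kappa (src t) q * weight t \<omega>))"
      proof (intro exI conjI ballI)
        show "INAR_test (M n) p \<alpha> \<nu>1 \<nu>2 \<pi> (\<tau> n) n (X n) (\<xi> n) (\<epsilon> n) B (\<lambda>t. Innovation (nat t)) (\<lambda>_ _. 1)"
          by (rule innovation_test(1)[OF n(2)])
        show "{} \<in> sets (M n)" "prob {} \<le> 0 / (1 * real n)" by simp_all
        fix \<omega>
        have "3 * \<kappa> * real n = min (measure_pmf.prob \<nu>1 {q<..}) (1 - measure_pmf.prob \<nu>1 {q<..}) / 2 * r * real n"
          by (simp add: \<kappa>_def)
        also have "\<dots> \<le> (\<Sum>t\<in>{int p + 1..int (\<tau> n) - int p}. kappa (Innovation (nat t)) q * 1)"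
          by (rule innovation_richness[OF n(2) less_imp_le[OF r0] n(3) q])
        finally show "3 * \<kappa> * real n \<le> (\<Sum>t\<in>{int p + 1..int (\<tau> n) - int p}. kappa (Innovation (nat t)) q * 1)" .
      qed
    qed simp
  qed
  define s where "s = (\<Sum>i = 1..p. \<alpha> i)"
  define K where "K = 1 + \<mu>1 / (1 - s)"
  have s1: "s < 1" using stable by (simp add: s_def)
  have K: "K \<ge> 1" "\<mu>1 / (1 - s) \<le> K" "\<mu>2 / (1 - s) \<le> K"
  proof -
    have "\<mu>2 / (1 - s) \<le> \<mu>1 / (1 - s)" using mu s1 by (intro divide_right_mono) auto
    moreover have "0 \<le> \<mu>1 / (1 - s)" using mu s1 by simp
    ultimately show "K \<ge> 1" "\<mu>1 / (1 - s) \<le> K" "\<mu>2 / (1 - s) \<le> K" by (auto simp: K_def)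
  qed
  define E where "E = 2 * (\<mu>1 - \<mu>2) * K + 1"
  define co where "co = min (\<kappa>\<^sup>2 / (16 * (1 + K)\<^sup>2 * (real p)\<^sup>2)) (\<rho> / 2)"
  define N0 where "N0 = 2 * ((\<mu>1 - \<mu>2) * K + E) / co"
  define E2 where "E2 = 4 * K * N0 + (\<mu>1 - \<mu>2) + 1"
  define E3 where "E3 = 10 * K\<^sup>2 * N0\<^sup>2 + E * N0 + K * N0 * E2"
  define \<kappa>1 where "\<kappa>1 = \<kappa>\<^sup>2 / (32 * K\<^sup>2 * (real p)\<^sup>2)"
  define c where "c = min ((\<mu>1 - \<mu>2) * (1 - \<rho>) / 4) (\<kappa>1 * (\<mu>1 - \<mu>2) / 4)"
  have pos: "co > 0" "\<kappa>1 > 0" "c > 0" "(\<mu>1 - \<mu>2) * (1 - \<rho>) / 4 > 0" "\<kappa>1 * (\<mu>1 - \<mu>2)\<^sup>2 / 8 > 0" "\<rho> * c / 2 > 0" "co / (20 * K\<^sup>2) > 0"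
    using kappa K p1 rho mu by (auto simp: co_def \<kappa>1_def c_def)
  obtain \<delta>' where d': "\<delta>' > 0" "\<delta>' \<le> 1" "\<delta>' \<le> co / (20 * K\<^sup>2)" "\<delta>' * E2 \<le> (\<mu>1 - \<mu>2) * (1 - \<rho>) / 4" "\<delta>' * E2 \<le> \<rho> * c / 2"
      "\<delta>' * E3 < \<kappa>1 * (\<mu>1 - \<mu>2)\<^sup>2 / 8" "\<delta>' * (1 + N0) < \<rho> * c / 2"
    by (rule obtain_tolerance[OF pos(7,4,6,5,6)])
  \<comment> \<open>The average of \<open>T\<close> is multiplied by \<open>\<mu>1\<close>; it may cost the duality at most \<open>\<delta>'\<close> off the diagonal and \<open>\<kappa>\<close> on it.\<close>
  define \<delta> where "\<delta> = min (\<delta>' / (1 + \<mu>1)) (\<kappa> / \<mu>1)"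
  have d: "\<delta> > 0" "(1 + \<mu>1) * \<delta> \<le> \<delta>'" "\<mu>1 * \<delta> \<le> \<kappa>"
  proof -
    have "\<delta> \<le> \<delta>' / (1 + \<mu>1)" "\<delta> \<le> \<kappa> / \<mu>1" by (auto simp: \<delta>_def)
    then show "(1 + \<mu>1) * \<delta> \<le> \<delta>'" "\<mu>1 * \<delta> \<le> \<kappa>" using mu by (auto simp: field_simps)
    show "\<delta> > 0" using d' kappa mu by (simp add: \<delta>_def)
  qed
  have est_measurable: "(\<lambda>\<omega>. change_estimator p n (\<theta> n \<omega>) (\<lambda>k. X n k \<omega>)) \<in> measurable (M n) (count_space UNIV)" if "n \<ge> 2" for n
    by (rule INAR_stable.change_estimator_measurable[OF stab[OF that] cls[OF that]])
  have close: "\<exists>Bad\<in>sets (M n). measure (M n) Bad \<le> INAR_stable.failure_bound p \<alpha> \<nu>1 \<nu>2 n B \<delta> R \<kappa> b + f / (g * real n) \<and>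
      (\<forall>\<omega>\<in>space (M n) - Bad. \<bar>real (change_estimator p n (\<theta> n \<omega>) (\<lambda>k. X n k \<omega>)) - real (\<tau> n)\<bar> < real (R\<^sup>2))"
    if u: "usable n" and R: "R \<ge> 1" "R\<^sup>2 \<le> \<tau> n" "R\<^sup>2 \<le> n - \<tau> n" and b: "b \<ge> 1" and card: "\<bar>real (\<tau> n) - \<rho> * real n\<bar> \<le> \<delta>' * real n" for n R b
  proof -
    have n: "n \<ge> 2" "\<tau> n < n" using u by (auto simp: usable_def)
    obtain src q weight Bad1 where test: "INAR_test (M n) p \<alpha> \<nu>1 \<nu>2 \<pi> (\<tau> n) n (X n) (\<xi> n) (\<epsilon> n) B src weight"
      and Bad1: "Bad1 \<in> sets (M n)" "measure (M n) Bad1 \<le> f / (g * real n)"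
      and wt: "\<And>\<omega>. \<omega> \<in> space (M n) - Bad1 \<Longrightarrow> 3 * \<kappa> * real n \<le>
          (\<Sum>t\<in>{int p + 1..int (\<tau> n) - int p}. INAR_innovation_change.kappa \<alpha> \<nu>1 \<nu>2 (\<tau> n) (src t) q * weight t \<omega>)"
      using rich[OF u] by blast
    interpret INAR_test "M n" p \<alpha> \<nu>1 \<nu>2 \<pi> "\<tau> n" n "X n" "\<xi> n" "\<epsilon> n" B src q weight by (rule test)
    obtain Bad2 where Bad2: "Bad2 \<in> events" "prob Bad2 \<le> failure_bound \<delta> R \<kappa> b"
      "\<And>\<omega>. \<omega> \<in> space (M n) \<Longrightarrow> \<omega> \<notin> Bad2 \<Longrightarrow> (\<Sum>t\<in>core. kappa (src t) q * weight t \<omega>) \<ge> 3 * \<kappa> * real n \<Longrightarrow>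
       good_path p n (\<tau> n) R \<alpha> (\<lambda>t. mean (Innovation (nat t))) \<mu>1 \<mu>2 (\<Sum>i = 1..p. \<alpha> i) \<delta> \<kappa> (\<lambda>t. test t \<omega>) (\<lambda>k. X n k \<omega>)"
      by (rule good_path_likely[OF d(1) R kappa b mu1 mu2 d(3)]) blast
    show ?thesis
    proof (intro bexI[of _ "Bad1 \<union> Bad2"] conjI ballI)
      show "Bad1 \<union> Bad2 \<in> sets (M n)" using Bad1 Bad2 by auto
      have "prob (Bad1 \<union> Bad2) \<le> prob Bad1 + prob Bad2" using Bad1 Bad2 by (intro measure_Un_le) auto
      then show "prob (Bad1 \<union> Bad2) \<le> failure_bound \<delta> R \<kappa> b + f / (g * real n)" using Bad1(2) Bad2(2) by linarith
      fix \<omega> assume w: "\<omega> \<in> space (M n) - (Bad1 \<union> Bad2)"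
      have gp: "good_path p n (\<tau> n) R \<alpha> (\<lambda>t. mean (Innovation (nat t))) \<mu>1 \<mu>2 s \<delta> \<kappa> (\<lambda>t. test t \<omega>) (\<lambda>k. X n k \<omega>)"
        unfolding s_def using w wt[of \<omega>] by (intro Bad2(3)) auto
      have th: "\<theta> n \<omega> \<in> carrier_vec (p + 1)"
        "\<And>A. A \<in> carrier_mat (p + 1) (p + 1) \<Longrightarrow> inverts_mat (design_matrix p n (\<lambda>k. X n k \<omega>)) A \<Longrightarrow>
          inverts_mat A (design_matrix p n (\<lambda>k. X n k \<omega>)) \<Longrightarrow> \<theta> n \<omega> = A *\<^sub>v response_vec p n (\<lambda>k. X n k \<omega>)"
        using cls[OF n(1)] w unfolding cls_estimator_def by auto
      show "\<bar>real (change_estimator p n (\<theta> n \<omega>) (\<lambda>k. X n k \<omega>)) - real (\<tau> n)\<bar> < real (R\<^sup>2)"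
        by (rule good_path.change_estimator_close[OF gp rho K d(2) d'(2) card mu(1) th E_def N0_def[unfolded co_def] E2_def E3_def \<kappa>1_def c_def
            d'(3)[unfolded co_def] d'(4,5,6,7) R(1)])
    qed
  qed
  have eventually_large: "\<forall>\<^sub>F n in sequentially. real n \<ge> C" for C :: real
    using filterlim_real_sequentially unfolding filterlim_at_top by blast
  show ?thesis
    unfolding bounded_in_probability_def
  proof (intro conjI allI impI)
    show "\<forall>\<^sub>F n in sequentially. (\<lambda>\<omega>. real (change_estimator p n (\<theta> n \<omega>) (\<lambda>k. X n k \<omega>)) - real_of_int \<lfloor>real n * \<rho>\<rfloor>) \<in> borel_measurable (M n)"
    proof (rule eventually_sequentiallyI[of 2])
      fix n :: nat assume "2 \<le> n"
      from measurable_compose[OF est_measurable[OF this], of real borel]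
      show "(\<lambda>\<omega>. real (change_estimator p n (\<theta> n \<omega>) (\<lambda>k. X n k \<omega>)) - real_of_int \<lfloor>real n * \<rho>\<rfloor>) \<in> borel_measurable (M n)" by simp
    qed
    fix \<eta> :: real assume eta: "\<eta> > 0"
    let ?W = "INAR_stable.window_bound p \<alpha> \<nu>1 \<nu>2 B" and ?V = "INAR_stable.mart_bound p \<alpha> \<nu>1 \<nu>2 B"
    define A where "A = (2 * (real p * (40 * ?W)) + 2 * (40 * ?V)) / \<delta>\<^sup>2"
    define R where "R = nat \<lceil>2 * A / \<eta>\<rceil> + 1"
    have R1: "R \<ge> 1" by (simp add: R_def)
    have "2 * A / \<eta> < real R" unfolding R_def by linarith
    then have AR: "A / real R < \<eta> / 2" using eta R1 by (simp add: field_simps)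
    define rest where "rest = (\<lambda>n. real p * (real n * (INAR_stable.second_moment_bound p \<alpha> \<nu>1 \<nu>2 B / (real n powr (3/4))\<^sup>2)
        + INAR_stable.truncated_bound p \<alpha> \<nu>1 \<nu>2 B * real n powr (3/4) / (\<delta>\<^sup>2 * real n)) + 1 / (\<delta>\<^sup>2 * real n)
        + 2 * (real p * (?V / (\<delta>\<^sup>2 * real n))) + INAR_stable.product_bound p \<alpha> \<nu>1 \<nu>2 B / (\<kappa>\<^sup>2 * real n) + f / (g * real n))"
    have "rest \<longlonglongrightarrow> 0" unfolding rest_def by (rule vanishing_terms)
    then have rest: "\<forall>\<^sub>F n in sequentially. rest n < \<eta> / 2" using eta by (intro order_tendstoD) auto
    \<comment> \<open>Beyond \<open>C\<close> the rounding of \<open>n \<rho>\<close> is within the tolerance and both regimes contain a window of length \<open>R\<^sup>2\<close>.\<close>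
    define C where "C = 2 + (real (R\<^sup>2) + 1) / \<rho> + real (R\<^sup>2) / (1 - \<rho>) + 1 / \<delta>' + 2 * (1 + 2 * real p) / \<rho>"
    show "\<exists>K. \<forall>\<^sub>F n in sequentially. measure (M n) {\<omega> \<in> space (M n).
        \<bar>real (change_estimator p n (\<theta> n \<omega>) (\<lambda>k. X n k \<omega>)) - real_of_int \<lfloor>real n * \<rho>\<rfloor>\<bar> > K} < \<eta>"
    proof (rule exI[of _ "real (R\<^sup>2)"], use eventually_large[of C] rest in eventually_elim)
      fix n :: nat assume nC: "C \<le> real n" and small: "rest n < \<eta> / 2"
      have parts: "0 \<le> (real (R\<^sup>2) + 1) / \<rho>" "0 \<le> real (R\<^sup>2) / (1 - \<rho>)" "0 \<le> 1 / \<delta>'" "0 \<le> 2 * (1 + 2 * real p) / \<rho>"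
        using rho d' by auto
      have n2: "n \<ge> 2" using nC parts unfolding C_def by linarith
      have "(real (R\<^sup>2) + 1) / \<rho> \<le> real n" "real (R\<^sup>2) / (1 - \<rho>) \<le> real n" "1 / \<delta>' \<le> real n" "2 * (1 + 2 * real p) / \<rho> \<le> real n"
        using nC parts unfolding C_def by linarith+
      then have big: "real (R\<^sup>2) + 1 \<le> real n * \<rho>" "real (R\<^sup>2) \<le> real n * (1 - \<rho>)" "1 \<le> \<delta>' * real n" "2 * (1 + 2 * real p) \<le> real n * \<rho>"
        using rho d' by (simp_all add: pos_divide_le_eq mult.commute)
      have "real (R\<^sup>2) \<ge> 1" using R1 by simp
      then have fl: "\<lfloor>real n * \<rho>\<rfloor> \<ge> 1" using big(1) by linarith
      then have "nat 1 \<le> nat \<lfloor>real n * \<rho>\<rfloor>" by (rule nat_mono)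
      then have "1 \<le> nat \<lfloor>real n * \<rho>\<rfloor>" by (simp only: nat_1 One_nat_def)
      then have "\<tau> n = nat \<lfloor>real n * \<rho>\<rfloor>" unfolding tau_def by (rule max_absorb1)
      then have tau: "real (\<tau> n) = real_of_int \<lfloor>real n * \<rho>\<rfloor>" using fl by simp
      have tau_le: "real (\<tau> n) \<le> real n * \<rho>" "real n * \<rho> < real (\<tau> n) + 1" unfolding tau by linarith+
      have nr: "real n * (1 - \<rho>) = real n - real n * \<rho>" by (simp add: algebra_simps)
      have "real (\<tau> n) < real n"
      proof -
        have "real n * \<rho> < real n * 1" using rho n2 by (intro mult_strict_left_mono) auto
        then show ?thesis using tau_le by linarith
      qed
      then have tn: "\<tau> n < n" by simp
      have u: "usable n" unfolding usable_def r_def using n2 tn tau_le big(4) by (simp add: algebra_simps)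
      have Rt: "R\<^sup>2 \<le> \<tau> n"
      proof -
        have "real (R\<^sup>2) < real (\<tau> n) + 1" using big(1) tau_le by linarith
        then show ?thesis by linarith
      qed
      have "real (R\<^sup>2) \<le> real (n - \<tau> n)" using big(2) tau_le nr tn by (simp add: of_nat_diff)
      then have Rn: "R\<^sup>2 \<le> n - \<tau> n" by linarith
      have b: "real n powr (3/4) \<ge> 1" using n2 by (intro ge_one_powr_ge_zero) auto
      have card: "\<bar>real (\<tau> n) - \<rho> * real n\<bar> \<le> \<delta>' * real n" using tau_le big(3) by (simp add: mult.commute)
      obtain Bad where Bad: "Bad \<in> sets (M n)" "measure (M n) Bad \<le> INAR_stable.failure_bound p \<alpha> \<nu>1 \<nu>2 n B \<delta> R \<kappa> (real n powr (3/4)) + f / (g * real n)"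
        "\<And>\<omega>. \<omega> \<in> space (M n) - Bad \<Longrightarrow> \<bar>real (change_estimator p n (\<theta> n \<omega>) (\<lambda>k. X n k \<omega>)) - real (\<tau> n)\<bar> < real (R\<^sup>2)"
        using close[OF u R1 Rt Rn b card] by blast
      interpret INAR_stable "M n" p \<alpha> \<nu>1 \<nu>2 \<pi> "\<tau> n" n "X n" "\<xi> n" "\<epsilon> n" B by (rule stab[OF n2])
      have "failure_bound \<delta> R \<kappa> (real n powr (3/4)) + f / (g * real n) = A / real R + rest n"
        unfolding failure_bound_def rest_def A_def by (simp add: add_divide_distrib)
      then have lt: "prob Bad < \<eta>" using Bad(2) AR small by linarith
      have "{\<omega> \<in> space (M n). \<bar>real (change_estimator p n (\<theta> n \<omega>) (\<lambda>k. X n k \<omega>)) - real_of_int \<lfloor>real n * \<rho>\<rfloor>\<bar> > real (R\<^sup>2)} \<subseteq> Bad"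
        using Bad(3) unfolding tau[symmetric] by force
      then have "prob {\<omega> \<in> space (M n). \<bar>real (change_estimator p n (\<theta> n \<omega>) (\<lambda>k. X n k \<omega>)) - real_of_int \<lfloor>real n * \<rho>\<rfloor>\<bar> > real (R\<^sup>2)} \<le> prob Bad"
        using Bad(1) by (rule finite_measure_mono)
      then show "prob {\<omega> \<in> space (M n). \<bar>real (change_estimator p n (\<theta> n \<omega>) (\<lambda>k. X n k \<omega>)) - real_of_int \<lfloor>real n * \<rho>\<rfloor>\<bar> > real (R\<^sup>2)} < \<eta>"
        using lt by linarith
    qed
  qed
qed

end
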